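(* Let $R$ be a left QI-ring. Suppose that $R$ has finite Gabriel dimension, $Gdim(R)=n$, and let $\{\tau_i\}_{i=1}^n$ be the Gabriel filtration in $R\text{-tors}$. Suppose $\tau_1$ is perfect. If the ring of quotients ${}_{\tau_1}R$ is left hereditary, then $R$ is left hereditary.
   Context: Rings are associative with unit; modules are unitary left modules. A module $M$ is quasi-injective if every homomorphism $f:N\to M$ with $N\le M$ extends to an endomorphism of $M$. A ring is a left QI-ring if every quasi-injective left module over it is injective. A ring is left hereditary if every left ideal is projective. Torsion theories. A torsion theory in $R$-Mod is a pair $\tau=(\mathfrak T,\mathfrak F)$ of nonempty classes of modules such that $\mathrm{Hom}_R(T,F)=0$ for all $T\in\mathfrak T$, $F\in\mathfrak F$, and each class is maximal with this property: any $M$ with $\mathrm{Hom}_R(M,F)=0$ for all $F\in\mathfrak F$ lies in $\mathfrak T$, and any $N$ with $\mathrm{Hom}_R(T,N)=0$ for all $T\in\mathfrak T$ lies in $\mathfrak F$. Modules in $\mathfrak T$ are called $\tau$-torsion, those in $\mathfrak F$ $\tau$-torsion free. It is hereditary if $\mathfrak T$ is closed under submodules. $R\text{-tors}$ denotes the set of hereditary torsion theories, a complete lattice ordered by inclusion of torsion classes, with least element $\xi$ (only $0$ is torsion) and greatest element $\chi$ (every module is torsion). For a class $\mathcal C$ of modules, $\xi(\mathcal C)$ is the least element of $R\text{-tors}$ for which all modules in $\mathcal C$ are torsion. Gabriel filtration. For $\tau\in R\text{-tors}$, a module $N$ is $\tau$-cocritical if $N$ is $\tau$-torsion free and every proper factor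 module $N/N'$ ($0\neq N'\le N$) is $\tau$-torsion. Put $\tau_0=\xi$; $\tau_i=\tau_{i-1}\vee\bigvee\{\xi(N): N \text{ is } \tau_{i-1}\text{-cocritical}\}$ for $i$ a successor ordinal; $\tau_i=\bigvee_{j<i}\tau_j$ for $i$ a limit ordinal. Let $\alpha$ be the least ordinal with $\tau_\alpha=\tau_{\alpha+\beta}$ for all $\beta$; if $\tau_\alpha=\chi$, then $R$ has Gabriel dimension $Gdim(R)=\alpha$. Localization. For $\tau\in R\text{-tors}$ let $\mathcal F_\tau$ be its Gabriel topology, the set of left ideals $I$ with $R/I$ $\tau$-torsion. A module $N$ is $\mathcal F_\tau$-injective if every homomorphism $I\to N$ with $I\in\mathcal F_\tau$ extends to $R\to N$; it is $\tau$-closed if it is $\tau$-torsion free and $\mathcal F_\tau$-injective. For every module $M$ there is an essentially unique $\tau$-closed module ${}_\tau M=\mathfrak q_\tau(M)$ with a homomorphism $\psi_M:M\to{}_\tau M$ whose kernel and cokernel are $\tau$-torsion. ${}_\tau R$ is a ring (the ring of quotients), $\psi_R$ is a ring homomorphism, ${}_\tau M$ is a left ${}_\tau R$-module, and $\mathfrak q_\tau:R\text{-Mod}\to{}_\tau R\text{-Mod}$ is the localization functor. $\tau$ is perfect if $\psi_R:R\to{}_\tau R$ is an epimorphism in the category of rings, ${}_\tau R$ is flat as a right $R$-module, and $\mathcal F_\tau=\{I : {}_\tau R\,\psi_R(I)={}_\tau R\}$; equivalently, $\mathfrak q_\tau$ is naturally isomorphic to ${}_\tau R\otimes_R-$. 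*)

theory Defs
  imports "HOL-Algebra.Module" "HOL-Algebra.AbelCoset" "HOL-Algebra.Free_Abelian_Groups"
    "HOL-Algebra.Complete_Lattice" "HOL-Algebra.Generated_Groups" "HOL-Library.Equipollence"
begin

section \<open>Left modules\<close>

text \<open>
  The locale \<open>module\<close> of HOL-Algebra is restricted to commutative rings; its record
  type and the locale \<open>submodule\<close> are not, and are used below.
  The fields \<open>mult\<close> and \<open>one\<close> of a module record carry no meaning.

  Throughout, the type variable \<open>'u\<close> is the universe: the category \<open>R\<close>-Mod consists of the
  left \<open>R\<close>-modules whose carrier is a subset of \<open>'u\<close>. Modules that live on another type
  (\<open>R\<close> itself, quotients, the ring of quotients) belong to it up to isomorphism as soon as they
  are small enough. The smallness condition \<open>Pow (carrier R \<times> UNIV) \<lesssim> (UNIV :: 'u set)\<close>, with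
  \<open>UNIV :: nat set\<close> as second factor, says that \<open>'u\<close> has at least \<open>2\<close> to the \<open>\<bar>R\<bar> \<cdot> \<aleph>\<^sub>0\<close> elements;
  there is no upper bound on \<open>'u\<close>. It makes room for cyclic modules, injective hulls of cyclic
  modules, their countable direct sums, the rings of quotients of \<open>R\<close> and the free modules on
  their left ideals.
\<close>

locale left_module = R?: ring R + M?: abelian_group M
  for R :: "('r, 'x) ring_scheme" (structure) and M :: "('r, 'm, 'z) module_scheme" (structure) +
  assumes smult_closed [simp, intro]:
      "\<lbrakk>a \<in> carrier R; x \<in> carrier M\<rbrakk> \<Longrightarrow> a \<odot>\<^bsub>M\<^esub> x \<in> carrier M"
    and smult_l_distr:
      "\<lbrakk>a \<in> carrier R; b \<in> carrier R; x \<in> carrier M\<rbrakk> \<Longrightarrow>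
        (a \<oplus>\<^bsub>R\<^esub> b) \<odot>\<^bsub>M\<^esub> x = a \<odot>\<^bsub>M\<^esub> x \<oplus>\<^bsub>M\<^esub> b \<odot>\<^bsub>M\<^esub> x"
    and smult_r_distr:
      "\<lbrakk>a \<in> carrier R; x \<in> carrier M; y \<in> carrier M\<rbrakk> \<Longrightarrow>
        a \<odot>\<^bsub>M\<^esub> (x \<oplus>\<^bsub>M\<^esub> y) = a \<odot>\<^bsub>M\<^esub> x \<oplus>\<^bsub>M\<^esub> a \<odot>\<^bsub>M\<^esub> y"
    and smult_assoc:
      "\<lbrakk>a \<in> carrier R; b \<in> carrier R; x \<in> carrier M\<rbrakk> \<Longrightarrow>
        (a \<otimes>\<^bsub>R\<^esub> b) \<odot>\<^bsub>M\<^esub> x = a \<odot>\<^bsub>M\<^esub> (b \<odot>\<^bsub>M\<^esub> x)"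
    and smult_one [simp]:
      "x \<in> carrier M \<Longrightarrow> \<one>\<^bsub>R\<^esub> \<odot>\<^bsub>M\<^esub> x = x"

definition lmod_hom ::
    "('r, 'x) ring_scheme \<Rightarrow> ('r, 'm) module \<Rightarrow> ('r, 'n) module \<Rightarrow> ('m \<Rightarrow> 'n) set" where
  "lmod_hom R M N = {f \<in> carrier M \<rightarrow> carrier N.
     (\<forall>x\<in>carrier M. \<forall>y\<in>carrier M. f (x \<oplus>\<^bsub>M\<^esub> y) = f x \<oplus>\<^bsub>N\<^esub> f y) \<and>
     (\<forall>r\<in>carrier R. \<forall>x\<in>carrier M. f (r \<odot>\<^bsub>M\<^esub> x) = r \<odot>\<^bsub>N\<^esub> f x)}"

definition lmod_isomorphic ::
    "('r, 'x) ring_scheme \<Rightarrow> ('r, 'm) module \<Rightarrow> ('r, 'n) module \<Rightarrow> bool" where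
  "lmod_isomorphic R M N \<longleftrightarrow> (\<exists>f \<in> lmod_hom R M N. bij_betw f (carrier M) (carrier N))"

definition quotient_module :: "('r, 'm) module \<Rightarrow> 'm set \<Rightarrow> ('r, 'm set) module" where
  "quotient_module M N =
     \<lparr>carrier = a_rcosets\<^bsub>M\<^esub> N, monoid.mult = undefined, monoid.one = undefined,
      ring.zero = N, ring.add = set_add M,
      smult = (\<lambda>r C. \<Union>x\<in>C. N +>\<^bsub>M\<^esub> (r \<odot>\<^bsub>M\<^esub> x))\<rparr>"

definition regular_module :: "('r, 'x) ring_scheme \<Rightarrow> ('r, 'r) module" where
  "regular_module R =
     \<lparr>carrier = carrier R, monoid.mult = monoid.mult R, monoid.one = \<one>\<^bsub>R\<^esub>, ring.zero = \<zero>\<^bsub>R\<^esub>, ring.add = ring.add R,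
      smult = monoid.mult R\<rparr>"

definition left_ideal :: "'r set \<Rightarrow> ('r, 'x) ring_scheme \<Rightarrow> bool" where
  "left_ideal I R \<longleftrightarrow> submodule I R (regular_module R)"

definition ideal_module :: "('r, 'x) ring_scheme \<Rightarrow> 'r set \<Rightarrow> ('r, 'r) module" where
  "ideal_module R I = (regular_module R)\<lparr>carrier := I\<rparr>"

definition genlideal :: "('r, 'x) ring_scheme \<Rightarrow> 'r set \<Rightarrow> 'r set" where
  "genlideal R S = \<Inter>{J. left_ideal J R \<and> S \<subseteq> J}"


section \<open>Injective, quasi-injective and projective modules\<close>

definition injective_module :: "('r, 'x) ring_scheme \<Rightarrow> ('r, 'u) module \<Rightarrow> bool" where
  "injective_module R E \<longleftrightarrow> left_module R E \<and>
     (\<forall>(M :: ('r, 'u) module) N. left_module R M \<and> submodule N R M \<longrightarrow>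
        (\<forall>f \<in> lmod_hom R (M\<lparr>carrier := N\<rparr>) E. \<exists>g \<in> lmod_hom R M E. \<forall>x\<in>N. g x = f x))"

definition quasi_injective_module :: "('r, 'x) ring_scheme \<Rightarrow> ('r, 'u) module \<Rightarrow> bool" where
  "quasi_injective_module R M \<longleftrightarrow> left_module R M \<and>
     (\<forall>N. submodule N R M \<longrightarrow>
        (\<forall>f \<in> lmod_hom R (M\<lparr>carrier := N\<rparr>) M. \<exists>g \<in> lmod_hom R M M. \<forall>x\<in>N. g x = f x))"

definition projective_module ::
    "'u itself \<Rightarrow> ('r, 'x) ring_scheme \<Rightarrow> ('r, 'p) module \<Rightarrow> bool" where
  "projective_module _ R P \<longleftrightarrow> left_module R P \<and>
     (\<forall>(M :: ('r, 'u) module) (N :: ('r, 'u) module). left_module R M \<and> left_module R N \<longrightarrow>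
        (\<forall>p \<in> lmod_hom R M N. p ` carrier M = carrier N \<longrightarrow>
          (\<forall>f \<in> lmod_hom R P N. \<exists>g \<in> lmod_hom R P M. \<forall>x\<in>carrier P. p (g x) = f x)))"

definition left_QI_ring :: "'u itself \<Rightarrow> ('r, 'x) ring_scheme \<Rightarrow> bool" where
  "left_QI_ring _ R \<longleftrightarrow> ring R \<and>
     (\<forall>M :: ('r, 'u) module. quasi_injective_module R M \<longrightarrow> injective_module R M)"

definition left_hereditary :: "'u itself \<Rightarrow> ('r, 'x) ring_scheme \<Rightarrow> bool" where
  "left_hereditary U R \<longleftrightarrow> ring R \<and>
     (\<forall>I. left_ideal I R \<longrightarrow> projective_module U R (ideal_module R I))"


section \<open>Torsion theories\<close>

type_synonym ('r, 'u) torsion_pair = "('r, 'u) module set \<times> ('r, 'u) module set"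

definition hom_orthogonal ::
    "('r, 'x) ring_scheme \<Rightarrow> ('r, 'm) module \<Rightarrow> ('r, 'n) module \<Rightarrow> bool" where
  "hom_orthogonal R M N \<longleftrightarrow> (\<forall>f \<in> lmod_hom R M N. \<forall>x\<in>carrier M. f x = \<zero>\<^bsub>N\<^esub>)"

definition torsion_theory :: "('r, 'x) ring_scheme \<Rightarrow> ('r, 'u) torsion_pair \<Rightarrow> bool" where
  "torsion_theory R \<tau> \<longleftrightarrow>
     fst \<tau> \<noteq> {} \<and> snd \<tau> \<noteq> {} \<and>
     (\<forall>T \<in> fst \<tau>. left_module R T) \<and> (\<forall>F \<in> snd \<tau>. left_module R F) \<and>
     (\<forall>T \<in> fst \<tau>. \<forall>F \<in> snd \<tau>. hom_orthogonal R T F) \<and>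
     (\<forall>M. left_module R M \<and> (\<forall>F \<in> snd \<tau>. hom_orthogonal R M F) \<longrightarrow> M \<in> fst \<tau>) \<and>
     (\<forall>N. left_module R N \<and> (\<forall>T \<in> fst \<tau>. hom_orthogonal R T N) \<longrightarrow> N \<in> snd \<tau>)"

definition hereditary_torsion_theory ::
    "('r, 'x) ring_scheme \<Rightarrow> ('r, 'u) torsion_pair \<Rightarrow> bool" where
  "hereditary_torsion_theory R \<tau> \<longleftrightarrow> torsion_theory R \<tau> \<and>
     (\<forall>M \<in> fst \<tau>. \<forall>N. submodule N R M \<longrightarrow> M\<lparr>carrier := N\<rparr> \<in> fst \<tau>)"

definition R_tors :: "('r, 'x) ring_scheme \<Rightarrow> ('r, 'u) torsion_pair gorder" where
  "R_tors R = \<lparr>carrier = {\<tau>. hereditary_torsion_theory R \<tau>}, eq = (=),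
               le = (\<lambda>\<sigma> \<tau>. fst \<sigma> \<subseteq> fst \<tau>)\<rparr>"

definition xi :: "('r, 'x) ring_scheme \<Rightarrow> ('r, 'u) module set \<Rightarrow> ('r, 'u) torsion_pair" where
  "xi R C = (THE \<tau>. least (R_tors R) \<tau> {\<sigma> \<in> carrier (R_tors R). C \<subseteq> fst \<sigma>})"

text \<open>
  Torsion and torsion-free modules on an arbitrary carrier type. On \<open>'u\<close> this is membership in
  the respective class, because both classes are closed under isomorphism.
\<close>

definition torsion ::
    "('r, 'x) ring_scheme \<Rightarrow> ('r, 'u) torsion_pair \<Rightarrow> ('r, 'm) module \<Rightarrow> bool" where
  "torsion R \<tau> M \<longleftrightarrow> left_module R M \<and> (\<exists>T \<in> fst \<tau>. lmod_isomorphic R M T)"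

definition torsion_free ::
    "('r, 'x) ring_scheme \<Rightarrow> ('r, 'u) torsion_pair \<Rightarrow> ('r, 'm) module \<Rightarrow> bool" where
  "torsion_free R \<tau> M \<longleftrightarrow> left_module R M \<and> (\<exists>F \<in> snd \<tau>. lmod_isomorphic R M F)"


section \<open>Gabriel filtration and Gabriel dimension\<close>

definition cocritical ::
    "('r, 'x) ring_scheme \<Rightarrow> ('r, 'u) torsion_pair \<Rightarrow> ('r, 'm) module \<Rightarrow> bool" where
  "cocritical R \<tau> N \<longleftrightarrow> torsion_free R \<tau> N \<and>
     (\<forall>N'. submodule N' R N \<and> N' \<noteq> {\<zero>\<^bsub>N\<^esub>} \<longrightarrow> torsion R \<tau> (quotient_module N N'))"

definition is_predecessor :: "'o::wellorder \<Rightarrow> 'o \<Rightarrow> bool" where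
  "is_predecessor j i \<longleftrightarrow> j < i \<and> (\<forall>k<i. k \<le> j)"

lemma the_predecessor: "is_predecessor j i \<Longrightarrow> (THE j. is_predecessor j i) = j"
  unfolding is_predecessor_def by (rule the_equality) (auto intro: antisym)

text \<open>
  The index \<open>i\<close> ranges over an arbitrary well-ordered type, whose elements play the role of
  ordinals: \<open>i\<close> is zero, a successor or a limit according to its place in the order. Finite
  ordinals are obtained at the type \<open>nat\<close>. For the Gabriel dimension no larger index type is needed
  if the dimension is finite: once the filtration has reached the greatest element of \<open>R_tors R\<close>,
  it stays there.
\<close>

function gabriel_filtration ::
    "('r, 'x) ring_scheme \<Rightarrow> 'o::wellorder \<Rightarrow> ('r, 'u) torsion_pair" where
  "gabriel_filtration R i =
     (if \<forall>j. i \<le> j then \<bottom>\<^bsub>R_tors R\<^esub>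
      else if \<exists>j. is_predecessor j i then
        (let \<sigma> = gabriel_filtration R (THE j. is_predecessor j i)
         in \<sigma> \<squnion>\<^bsub>R_tors R\<^esub> \<Squnion>\<^bsub>R_tors R\<^esub> {xi R {N} | N :: ('r, 'u) module. cocritical R \<sigma> N})
      else \<Squnion>\<^bsub>R_tors R\<^esub> (gabriel_filtration R ` {..<i}))"
  by pat_completeness auto
termination
proof (relation "inv_image {(i, j). i < j} snd")
  show "wf (inv_image {(i, j :: 'o::wellorder). i < j} snd)"
    by (intro wf_inv_image wf)
qed (auto simp: the_predecessor, auto simp: is_predecessor_def)

declare gabriel_filtration.simps [simp del]

definition has_gabriel_dimension ::
    "'u itself \<Rightarrow> ('r, 'x) ring_scheme \<Rightarrow> 'o::wellorder \<Rightarrow> bool" where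
  "has_gabriel_dimension _ R \<alpha> \<longleftrightarrow>
     (let \<tau> = (gabriel_filtration R :: 'o \<Rightarrow> ('r, 'u) torsion_pair) in
        (\<forall>\<beta>\<ge>\<alpha>. \<tau> \<beta> = \<tau> \<alpha>) \<and>
        (\<forall>\<gamma>. (\<forall>\<beta>\<ge>\<gamma>. \<tau> \<beta> = \<tau> \<gamma>) \<longrightarrow> \<alpha> \<le> \<gamma>) \<and>
        \<tau> \<alpha> = \<top>\<^bsub>R_tors R\<^esub>)"


section \<open>Rings of quotients\<close>

definition gabriel_topology ::
    "('r, 'x) ring_scheme \<Rightarrow> ('r, 'u) torsion_pair \<Rightarrow> 'r set set" where
  "gabriel_topology R \<tau> =
     {I. left_ideal I R \<and> torsion R \<tau> (quotient_module (regular_module R) I)}"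

definition topology_injective ::
    "('r, 'x) ring_scheme \<Rightarrow> 'r set set \<Rightarrow> ('r, 'm) module \<Rightarrow> bool" where
  "topology_injective R \<F> N \<longleftrightarrow> left_module R N \<and>
     (\<forall>I \<in> \<F>. \<forall>f \<in> lmod_hom R (ideal_module R I) N.
        \<exists>g \<in> lmod_hom R (regular_module R) N. \<forall>x\<in>I. g x = f x)"

definition torsion_closed ::
    "('r, 'x) ring_scheme \<Rightarrow> ('r, 'u) torsion_pair \<Rightarrow> ('r, 'm) module \<Rightarrow> bool" where
  "torsion_closed R \<tau> N \<longleftrightarrow>
     torsion_free R \<tau> N \<and> topology_injective R (gabriel_topology R \<tau>) N"

definition pullback_left_module ::
    "('q, 'y) ring_scheme \<Rightarrow> ('r \<Rightarrow> 'q) \<Rightarrow> ('r, 'q) module" where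
  "pullback_left_module Q \<psi> =
     \<lparr>carrier = carrier Q, monoid.mult = monoid.mult Q, monoid.one = \<one>\<^bsub>Q\<^esub>, ring.zero = \<zero>\<^bsub>Q\<^esub>, ring.add = ring.add Q,
      smult = (\<lambda>r q. \<psi> r \<otimes>\<^bsub>Q\<^esub> q)\<rparr>"

text \<open>
  The pair \<open>(Q, \<psi>)\<close> is determined up to a unique isomorphism of rings under \<open>R\<close>; the ring
  structure on the \<open>\<tau>\<close>-closed module \<open>Q\<close> is forced by \<open>\<psi>\<close> being a ring homomorphism that
  induces the given left \<open>R\<close>-module structure.
\<close>

definition ring_of_quotients ::
    "('r, 'x) ring_scheme \<Rightarrow> ('r, 'u) torsion_pair \<Rightarrow> ('q, 'y) ring_scheme \<Rightarrow> ('r \<Rightarrow> 'q) \<Rightarrow> bool" where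
  "ring_of_quotients R \<tau> Q \<psi> \<longleftrightarrow> ring Q \<and> \<psi> \<in> ring_hom R Q \<and>
     torsion_closed R \<tau> (pullback_left_module Q \<psi>) \<and>
     torsion R \<tau> (ideal_module R (a_kernel R Q \<psi>)) \<and>
     torsion R \<tau> (quotient_module (pullback_left_module Q \<psi>) (\<psi> ` carrier R))"


section \<open>Tensor products, flatness and perfect torsion theories\<close>

text \<open>
  A right \<open>R\<close>-module \<open>A\<close> is stored in the same record type: \<open>r \<odot>\<^bsub>A\<^esub> a\<close> stands for \<open>a \<cdot> r\<close>.
\<close>

definition pullback_right_module ::
    "('q, 'y) ring_scheme \<Rightarrow> ('r \<Rightarrow> 'q) \<Rightarrow> ('r, 'q) module" where
  "pullback_right_module Q \<psi> =
     \<lparr>carrier = carrier Q, monoid.mult = monoid.mult Q, monoid.one = \<one>\<^bsub>Q\<^esub>, ring.zero = \<zero>\<^bsub>Q\<^esub>, ring.add = ring.add Q,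
      smult = (\<lambda>r q. q \<otimes>\<^bsub>Q\<^esub> \<psi> r)\<rparr>"

definition tensor_relations ::
    "('r, 'x) ring_scheme \<Rightarrow> ('r, 'a) module \<Rightarrow> ('r, 'm) module \<Rightarrow> ('a \<times> 'm \<Rightarrow>\<^sub>0 int) set" where
  "tensor_relations R A M = generate (free_Abelian_group (carrier A \<times> carrier M))
     ({frag_of (a \<oplus>\<^bsub>A\<^esub> b, m) - frag_of (a, m) - frag_of (b, m) | a b m.
         a \<in> carrier A \<and> b \<in> carrier A \<and> m \<in> carrier M} \<union>
      {frag_of (a, m \<oplus>\<^bsub>M\<^esub> n) - frag_of (a, m) - frag_of (a, n) | a m n.
         a \<in> carrier A \<and> m \<in> carrier M \<and> n \<in> carrier M} \<union>
      {frag_of (r \<odot>\<^bsub>A\<^esub> a, m) - frag_of (a, r \<odot>\<^bsub>M\<^esub> m) | r a m.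
         r \<in> carrier R \<and> a \<in> carrier A \<and> m \<in> carrier M})"

definition tensor_product ::
    "('r, 'x) ring_scheme \<Rightarrow> ('r, 'a) module \<Rightarrow> ('r, 'm) module \<Rightarrow> ('a \<times> 'm \<Rightarrow>\<^sub>0 int) set monoid" where
  "tensor_product R A M =
     free_Abelian_group (carrier A \<times> carrier M) Mod tensor_relations R A M"

text \<open>The homomorphism \<open>A \<otimes> f\<close> from \<open>A \<otimes> M\<close> to \<open>A \<otimes> N\<close> induced by \<open>f : M \<rightarrow> N\<close>, on cosets.\<close>

definition tensor_map ::
    "('r, 'x) ring_scheme \<Rightarrow> ('r, 'a) module \<Rightarrow> ('r, 'n) module \<Rightarrow> ('m \<Rightarrow> 'n)
      \<Rightarrow> ('a \<times> 'm \<Rightarrow>\<^sub>0 int) set \<Rightarrow> ('a \<times> 'n \<Rightarrow>\<^sub>0 int) set" where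
  "tensor_map R A N f C =
     the_elem ((\<lambda>c. tensor_relations R A N #>\<^bsub>free_Abelian_group (carrier A \<times> carrier N)\<^esub>
                      frag_extend (\<lambda>(a, m). frag_of (a, f m)) c) ` C)"

definition flat_right_module ::
    "'u itself \<Rightarrow> ('r, 'x) ring_scheme \<Rightarrow> ('r, 'a) module \<Rightarrow> bool" where
  "flat_right_module _ R A \<longleftrightarrow>
     (\<forall>(M :: ('r, 'u) module) (N :: ('r, 'u) module). left_module R M \<and> left_module R N \<longrightarrow>
        (\<forall>f \<in> lmod_hom R M N. inj_on f (carrier M) \<longrightarrow>
           inj_on (tensor_map R A N f) (carrier (tensor_product R A M))))"

definition ring_epimorphism ::
    "'u itself \<Rightarrow> ('r, 'x) ring_scheme \<Rightarrow> ('q, 'y) ring_scheme \<Rightarrow> ('r \<Rightarrow> 'q) \<Rightarrow> bool" where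
  "ring_epimorphism _ R Q \<psi> \<longleftrightarrow> \<psi> \<in> ring_hom R Q \<and>
     (\<forall>S :: 'u ring. ring S \<longrightarrow>
        (\<forall>f \<in> ring_hom Q S. \<forall>g \<in> ring_hom Q S.
           (\<forall>r\<in>carrier R. f (\<psi> r) = g (\<psi> r)) \<longrightarrow> (\<forall>q\<in>carrier Q. f q = g q)))"

text \<open>Perfectness of \<open>\<tau>\<close>, expressed for a ring of quotients \<open>(Q, \<psi>)\<close> of \<open>R\<close> at \<open>\<tau>\<close>.\<close>

definition perfect_torsion_theory ::
    "('r, 'x) ring_scheme \<Rightarrow> ('r, 'u) torsion_pair \<Rightarrow> ('q, 'y) ring_scheme \<Rightarrow> ('r \<Rightarrow> 'q) \<Rightarrow> bool" where
  "perfect_torsion_theory R \<tau> Q \<psi> \<longleftrightarrow>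
     ring_epimorphism TYPE('u) R Q \<psi> \<and>
     flat_right_module TYPE('u) R (pullback_right_module Q \<psi>) \<and>
     gabriel_topology R \<tau> = {I. left_ideal I R \<and> genlideal Q (\<psi> ` I) = carrier Q}"

end

theory Submission
  imports Defs
begin

text \<open>
  Over a left QI-ring semisimple modules are injective, so the semisimple modules form a hereditary
  torsion class: the socle splits off. It contains all simple modules, hence every
  \<open>\<tau>\<^sub>1\<close>-torsion module is semisimple and thereby injective.

  Given an epimorphism \<open>p : M \<rightarrow> N\<close> and \<open>f : I \<rightarrow> N\<close> on a left ideal \<open>I\<close>, tensor with \<open>Q\<close>. By flatness
  \<open>Q \<otimes> I\<close> is a left ideal of \<open>Q\<close>, hence projective, and \<open>Q \<otimes> f\<close> lifts to \<open>Q \<otimes> M\<close>; restricting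
  to \<open>I\<close> gives \<open>g : I \<rightarrow> Q \<otimes> M\<close> over \<open>f\<close>. The cokernel of \<open>M \<rightarrow> Q \<otimes> M\<close> and the kernels of
  \<open>M \<rightarrow> Q \<otimes> M\<close> and \<open>N \<rightarrow> Q \<otimes> N\<close> are \<open>\<tau>\<^sub>1\<close>-torsion. Their injectivity allows to move \<open>g\<close> into
  the image of \<open>M\<close>, to pull it back to \<open>M\<close>, and to remove the remaining error in \<open>N\<close>.
\<close>

section \<open>Left modules and homomorphisms\<close>

text \<open>Injectivity enters in one decisive form. If \<open>D \<subseteq> I\<close> are left
  ideals with I/D semisimple, the projection of I onto I/D extends to R; modulo \<open>D\<close> it
  is therefore right multiplication by a single element e of I. So a homomorphism g on I that sends
  \<open>D\<close> into a submodule U satisfies g(i) - i g(e) \<in> U for all i, and g can be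
  corrected by a map of the form i \<mapsto> i w. Such maps are defined on all of R, and lifting
  them along an epimorphism only means lifting one element. This is how a lift into Q \<otimes> M
  descends to M although nothing is known yet about the projectivity of I. The obstacle is the
  universe. Injectivity is a property of modules on \<open>'u\<close>, and projectivity is tested on
  them, whereas R, Q, I/D and tensor products live on other types. Quotients and tensor products are
  therefore formed as images under coding maps into \<open>'u\<close>, and semisimplicity is phrased
  inside submodule lattices, so that it travels along homomorphisms between modules on different
  types.\<close>

context left_module
begin

lemma smult_l_null [simp]:
  assumes "x \<in> carrier M"
  shows "\<zero> \<odot>\<^bsub>M\<^esub> x = \<zero>\<^bsub>M\<^esub>"
proof -
  have "\<zero> \<odot>\<^bsub>M\<^esub> x \<oplus>\<^bsub>M\<^esub> \<zero> \<odot>\<^bsub>M\<^esub> x = \<zero> \<odot>\<^bsub>M\<^esub> x"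
    using assms smult_l_distr[of \<zero> \<zero> x] by simp
  then show ?thesis
    using assms by (metis M.add.r_cancel_one' smult_closed R.zero_closed)
qed

lemma smult_r_null [simp]:
  assumes "a \<in> carrier R"
  shows "a \<odot>\<^bsub>M\<^esub> \<zero>\<^bsub>M\<^esub> = \<zero>\<^bsub>M\<^esub>"
proof -
  have "a \<odot>\<^bsub>M\<^esub> \<zero>\<^bsub>M\<^esub> \<oplus>\<^bsub>M\<^esub> a \<odot>\<^bsub>M\<^esub> \<zero>\<^bsub>M\<^esub> = a \<odot>\<^bsub>M\<^esub> \<zero>\<^bsub>M\<^esub>"
    using assms smult_r_distr[of a "\<zero>\<^bsub>M\<^esub>" "\<zero>\<^bsub>M\<^esub>"] by simp
  then show ?thesis
    using assms by (metis M.add.r_cancel_one' smult_closed M.zero_closed)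
qed

lemma smult_l_minus:
  assumes "a \<in> carrier R" "x \<in> carrier M"
  shows "(\<ominus> a) \<odot>\<^bsub>M\<^esub> x = \<ominus>\<^bsub>M\<^esub> (a \<odot>\<^bsub>M\<^esub> x)"
proof -
  have "(\<ominus> a) \<odot>\<^bsub>M\<^esub> x \<oplus>\<^bsub>M\<^esub> a \<odot>\<^bsub>M\<^esub> x = \<zero>\<^bsub>M\<^esub>"
    using assms smult_l_distr[of "\<ominus> a" a x] by (simp add: R.l_neg)
  then show ?thesis
    using assms by (metis M.minus_equality smult_closed R.a_inv_closed)
qed

lemma smult_r_minus:
  assumes "a \<in> carrier R" "x \<in> carrier M"
  shows "a \<odot>\<^bsub>M\<^esub> (\<ominus>\<^bsub>M\<^esub> x) = \<ominus>\<^bsub>M\<^esub> (a \<odot>\<^bsub>M\<^esub> x)"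
proof -
  have "a \<odot>\<^bsub>M\<^esub> (\<ominus>\<^bsub>M\<^esub> x) \<oplus>\<^bsub>M\<^esub> a \<odot>\<^bsub>M\<^esub> x = \<zero>\<^bsub>M\<^esub>"
    using assms smult_r_distr[of a "\<ominus>\<^bsub>M\<^esub> x" x] by (simp add: M.l_neg)
  then show ?thesis
    using assms by (metis M.minus_equality smult_closed M.a_inv_closed)
qed

lemma smult_minus_one:
  "x \<in> carrier M \<Longrightarrow> (\<ominus> \<one>) \<odot>\<^bsub>M\<^esub> x = \<ominus>\<^bsub>M\<^esub> x"
  by (simp add: smult_l_minus)

lemma smult_r_diff:
  "\<lbrakk>a \<in> carrier R; x \<in> carrier M; y \<in> carrier M\<rbrakk>
    \<Longrightarrow> a \<odot>\<^bsub>M\<^esub> (x \<ominus>\<^bsub>M\<^esub> y) = a \<odot>\<^bsub>M\<^esub> x \<ominus>\<^bsub>M\<^esub> a \<odot>\<^bsub>M\<^esub> y"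
  by (simp add: a_minus_def smult_r_distr smult_r_minus)

lemma smult_l_diff:
  "\<lbrakk>a \<in> carrier R; b \<in> carrier R; x \<in> carrier M\<rbrakk>
    \<Longrightarrow> (a \<ominus> b) \<odot>\<^bsub>M\<^esub> x = a \<odot>\<^bsub>M\<^esub> x \<ominus>\<^bsub>M\<^esub> b \<odot>\<^bsub>M\<^esub> x"
  by (simp add: a_minus_def smult_l_distr smult_l_minus)

lemma submoduleI:
  assumes "H \<subseteq> carrier M" "\<zero>\<^bsub>M\<^esub> \<in> H"
    and "\<And>x y. \<lbrakk>x \<in> H; y \<in> H\<rbrakk> \<Longrightarrow> x \<oplus>\<^bsub>M\<^esub> y \<in> H"
    and "\<And>a x. \<lbrakk>a \<in> carrier R; x \<in> H\<rbrakk> \<Longrightarrow> a \<odot>\<^bsub>M\<^esub> x \<in> H"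
  shows "submodule H R M"
proof -
  have "\<ominus>\<^bsub>M\<^esub> x \<in> H" if "x \<in> H" for x
    using assms(1) assms(4)[of "\<ominus> \<one>" x] that smult_minus_one[of x] by auto
  then have "subgroup H (add_monoid M)"
    using assms by (intro M.add.subgroupI) auto
  then show ?thesis
    using assms(4) by (auto simp: submodule_def submodule_axioms_def)
qed

lemma carrier_submodule: "submodule (carrier M) R M"
  by (rule submoduleI) auto

lemma zero_submodule: "submodule {\<zero>\<^bsub>M\<^esub>} R M"
  by (rule submoduleI) auto

end

lemma submodule_subset: "submodule H R M \<Longrightarrow> H \<subseteq> carrier M"
  using subgroup.subset[OF submodule.axioms(1)] by fastforce

lemma submodule_in_carrier: "\<lbrakk>submodule H R M; x \<in> H\<rbrakk> \<Longrightarrow> x \<in> carrier M"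
  using submodule_subset by blast

lemma submodule_zero: "submodule H R M \<Longrightarrow> \<zero>\<^bsub>M\<^esub> \<in> H"
  using subgroup.one_closed[OF submodule.axioms(1)] by fastforce

lemma submodule_add: "\<lbrakk>submodule H R M; x \<in> H; y \<in> H\<rbrakk> \<Longrightarrow> x \<oplus>\<^bsub>M\<^esub> y \<in> H"
  using subgroup.m_closed[OF submodule.axioms(1)] by fastforce

lemma submodule_smult: "\<lbrakk>submodule H R M; a \<in> carrier R; x \<in> H\<rbrakk> \<Longrightarrow> a \<odot>\<^bsub>M\<^esub> x \<in> H"
  by (rule submodule.smult_closed)

lemma submodule_neg: "\<lbrakk>submodule H R M; x \<in> H\<rbrakk> \<Longrightarrow> \<ominus>\<^bsub>M\<^esub> x \<in> H"
  unfolding a_inv_def by (rule subgroup.m_inv_closed[OF submodule.axioms(1)])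

lemma submodule_diff: "\<lbrakk>submodule H R M; x \<in> H; y \<in> H\<rbrakk> \<Longrightarrow> x \<ominus>\<^bsub>M\<^esub> y \<in> H"
  by (simp add: a_minus_def submodule_add submodule_neg)

lemmas submodule_closed = submodule_zero submodule_add submodule_smult submodule_neg submodule_diff

lemma (in left_module) submodule_add_cancel:
  assumes "submodule H R M" "x \<in> carrier M" "y \<in> H" "x \<oplus>\<^bsub>M\<^esub> y \<in> H"
  shows "x \<in> H"
proof -
  have "y \<in> carrier M" using assms submodule_subset by blast
  then have "x = (x \<oplus>\<^bsub>M\<^esub> y) \<ominus>\<^bsub>M\<^esub> y"
    using assms by (simp add: a_minus_def M.a_assoc M.r_neg)
  then show ?thesis using submodule_diff[OF assms(1,4,3)] by simp
qed

lemma (in left_module) submodule_module: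
  assumes "submodule N R M"
  shows "left_module R (M\<lparr>carrier := N\<rparr>)"
proof -
  note [simp] = submodule_in_carrier[OF assms] submodule_closed[OF assms]
  have inv: "\<exists>y\<in>N. y \<oplus>\<^bsub>M\<^esub> x = \<zero>\<^bsub>M\<^esub>" if "x \<in> N" for x
    using that by (intro bexI[of _ "\<ominus>\<^bsub>M\<^esub> x"]) (auto simp: M.l_neg)
  have "abelian_group (M\<lparr>carrier := N\<rparr>)"
    by (rule abelian_groupI) (auto simp: inv intro: M.a_assoc M.a_comm)
  then show ?thesis
    by (auto simp: left_module_def left_module_axioms_def R.ring_axioms
        smult_l_distr smult_r_distr smult_assoc)
qed

lemma (in left_module) submodule_of_submodule:
  assumes "submodule N R M"
  shows "submodule P R (M\<lparr>carrier := N\<rparr>) \<longleftrightarrow> submodule P R M \<and> P \<subseteq> N"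
proof
  interpret N: left_module R "M\<lparr>carrier := N\<rparr>" by (rule submodule_module[OF assms])
  {
    assume P: "submodule P R (M\<lparr>carrier := N\<rparr>)"
    have "P \<subseteq> N" using submodule_subset[OF P] by simp
    moreover have "submodule P R M"
      using submodule_subset[OF P] submodule_subset[OF assms] submodule_closed[OF P]
      by (intro submoduleI) auto
    ultimately show "submodule P R M \<and> P \<subseteq> N" by blast
  next
    assume P: "submodule P R M \<and> P \<subseteq> N"
    then show "submodule P R (M\<lparr>carrier := N\<rparr>)"
      by (intro N.submoduleI) (auto intro: submodule_closed)
  }
qed

lemma (in left_module) submodule_Int:
  "\<lbrakk>submodule A R M; submodule B R M\<rbrakk> \<Longrightarrow> submodule (A \<inter> B) R M"
  by (intro submoduleI) (auto intro: submodule_closed submodule_in_carrier)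

lemma set_addI: "\<lbrakk>a \<in> A; b \<in> B\<rbrakk> \<Longrightarrow> a \<oplus>\<^bsub>M\<^esub> b \<in> A <+>\<^bsub>M\<^esub> B"
  by (auto simp: set_add_def')

lemma set_addE:
  assumes "x \<in> A <+>\<^bsub>M\<^esub> B"
  obtains a b where "a \<in> A" "b \<in> B" "x = a \<oplus>\<^bsub>M\<^esub> b"
  using assms by (auto simp: set_add_def')

lemma (in left_module) submodule_set_add:
  assumes A: "submodule A R M" and B: "submodule B R M"
  shows "submodule (A <+>\<^bsub>M\<^esub> B) R M"
proof -
  note [simp] = submodule_in_carrier[OF A] submodule_in_carrier[OF B]
  show ?thesis
  proof (rule submoduleI)
    show "A <+>\<^bsub>M\<^esub> B \<subseteq> carrier M" by (auto elim!: set_addE)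
    show "\<zero>\<^bsub>M\<^esub> \<in> A <+>\<^bsub>M\<^esub> B"
      using set_addI[OF submodule_zero[OF A] submodule_zero[OF B], of M] by simp
    fix x y assume "x \<in> A <+>\<^bsub>M\<^esub> B" "y \<in> A <+>\<^bsub>M\<^esub> B"
    then obtain a b a' b' where *: "a \<in> A" "b \<in> B" "a' \<in> A" "b' \<in> B"
      "x = a \<oplus>\<^bsub>M\<^esub> b" "y = a' \<oplus>\<^bsub>M\<^esub> b'"
      by (elim set_addE)
    then have "x \<oplus>\<^bsub>M\<^esub> y = (a \<oplus>\<^bsub>M\<^esub> a') \<oplus>\<^bsub>M\<^esub> (b \<oplus>\<^bsub>M\<^esub> b')"
      by (simp add: M.a_ac)
    then show "x \<oplus>\<^bsub>M\<^esub> y \<in> A <+>\<^bsub>M\<^esub> B"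
      using * by (simp add: set_addI submodule_add[OF A] submodule_add[OF B])
  next
    fix r x assume r: "r \<in> carrier R" and "x \<in> A <+>\<^bsub>M\<^esub> B"
    then obtain a b where *: "a \<in> A" "b \<in> B" "x = a \<oplus>\<^bsub>M\<^esub> b"
      by (elim set_addE)
    then have "r \<odot>\<^bsub>M\<^esub> x = r \<odot>\<^bsub>M\<^esub> a \<oplus>\<^bsub>M\<^esub> r \<odot>\<^bsub>M\<^esub> b"
      using r by (simp add: smult_r_distr)
    then show "r \<odot>\<^bsub>M\<^esub> x \<in> A <+>\<^bsub>M\<^esub> B"
      using * r by (simp add: set_addI submodule_smult[OF A] submodule_smult[OF B])
  qed
qed

section \<open>Homomorphisms, and the submodules they pull back and push forward\<close>

lemma lmod_homI:
  assumes "\<And>x. x \<in> carrier M \<Longrightarrow> f x \<in> carrier N"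
    and "\<And>x y. \<lbrakk>x \<in> carrier M; y \<in> carrier M\<rbrakk> \<Longrightarrow> f (x \<oplus>\<^bsub>M\<^esub> y) = f x \<oplus>\<^bsub>N\<^esub> f y"
    and "\<And>r x. \<lbrakk>r \<in> carrier R; x \<in> carrier M\<rbrakk> \<Longrightarrow> f (r \<odot>\<^bsub>M\<^esub> x) = r \<odot>\<^bsub>N\<^esub> f x"
  shows "f \<in> lmod_hom R M N"
  using assms by (auto simp: lmod_hom_def)

lemma lmod_hom_closed: "\<lbrakk>f \<in> lmod_hom R M N; x \<in> carrier M\<rbrakk> \<Longrightarrow> f x \<in> carrier N"
  and lmod_hom_add: "\<lbrakk>f \<in> lmod_hom R M N; x \<in> carrier M; y \<in> carrier M\<rbrakk>
      \<Longrightarrow> f (x \<oplus>\<^bsub>M\<^esub> y) = f x \<oplus>\<^bsub>N\<^esub> f y"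
  and lmod_hom_smult: "\<lbrakk>f \<in> lmod_hom R M N; r \<in> carrier R; x \<in> carrier M\<rbrakk>
      \<Longrightarrow> f (r \<odot>\<^bsub>M\<^esub> x) = r \<odot>\<^bsub>N\<^esub> f x"
  by (auto simp: lmod_hom_def)

lemma lmod_hom_zero:
  assumes "left_module R M" "left_module R N" "f \<in> lmod_hom R M N"
  shows "f \<zero>\<^bsub>M\<^esub> = \<zero>\<^bsub>N\<^esub>"
proof -
  interpret M: left_module R M by fact
  interpret N: left_module R N by fact
  have "f \<zero>\<^bsub>M\<^esub> = f (\<zero>\<^bsub>R\<^esub> \<odot>\<^bsub>M\<^esub> \<zero>\<^bsub>M\<^esub>)" by simp
  also have "\<dots> = \<zero>\<^bsub>N\<^esub>"
    using lmod_hom_smult[OF assms(3), of "\<zero>\<^bsub>R\<^esub>" "\<zero>\<^bsub>M\<^esub>"] lmod_hom_closed[OF assms(3), of "\<zero>\<^bsub>M\<^esub>"] by simp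
  finally show ?thesis .
qed

lemma lmod_hom_minus:
  assumes "left_module R M" "left_module R N" "f \<in> lmod_hom R M N" "x \<in> carrier M"
  shows "f (\<ominus>\<^bsub>M\<^esub> x) = \<ominus>\<^bsub>N\<^esub> f x"
proof -
  interpret M: left_module R M by fact
  interpret N: left_module R N by fact
  have "f (\<ominus>\<^bsub>M\<^esub> x) = f ((\<ominus>\<^bsub>R\<^esub> \<one>\<^bsub>R\<^esub>) \<odot>\<^bsub>M\<^esub> x)" using assms by (simp add: M.smult_minus_one)
  also have "\<dots> = \<ominus>\<^bsub>N\<^esub> f x"
    using lmod_hom_smult[OF assms(3), of "\<ominus>\<^bsub>R\<^esub> \<one>\<^bsub>R\<^esub>" x] lmod_hom_closed[OF assms(3), of x] assms(4)
    by (simp add: N.smult_minus_one)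
  finally show ?thesis .
qed

lemma lmod_hom_diff:
  assumes "left_module R M" "left_module R N" "f \<in> lmod_hom R M N" "x \<in> carrier M" "y \<in> carrier M"
  shows "f (x \<ominus>\<^bsub>M\<^esub> y) = f x \<ominus>\<^bsub>N\<^esub> f y"
proof -
  interpret M: left_module R M by fact
  show ?thesis
    using assms by (simp add: a_minus_def lmod_hom_add lmod_hom_minus)
qed

lemma lmod_hom_comp:
  "\<lbrakk>f \<in> lmod_hom R M N; g \<in> lmod_hom R N P\<rbrakk> \<Longrightarrow> (\<lambda>x. g (f x)) \<in> lmod_hom R M P"
  by (auto simp: lmod_hom_def Pi_def)

lemma lmod_hom_restrict:
  "\<lbrakk>f \<in> lmod_hom R M N; S \<subseteq> carrier M\<rbrakk> \<Longrightarrow> f \<in> lmod_hom R (M\<lparr>carrier := S\<rparr>) N"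
  by (rule lmod_homI) (auto simp: lmod_hom_add lmod_hom_smult subset_iff intro: lmod_hom_closed)

lemma lmod_hom_sum:
  assumes "left_module R N" "f \<in> lmod_hom R M N" "g \<in> lmod_hom R M N"
  shows "(\<lambda>x. f x \<oplus>\<^bsub>N\<^esub> g x) \<in> lmod_hom R M N"
proof -
  interpret N: left_module R N by fact
  note [simp] = lmod_hom_closed[OF assms(2)] lmod_hom_closed[OF assms(3)]
  show ?thesis
    by (rule lmod_homI)
      (simp_all add: lmod_hom_add[OF assms(2)] lmod_hom_add[OF assms(3)] lmod_hom_smult[OF assms(2)]
        lmod_hom_smult[OF assms(3)] N.M.a_ac N.smult_r_distr)
qed

lemma lmod_hom_difference:
  assumes "left_module R N" "f \<in> lmod_hom R M N" "g \<in> lmod_hom R M N"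
  shows "(\<lambda>x. f x \<ominus>\<^bsub>N\<^esub> g x) \<in> lmod_hom R M N"
proof -
  interpret N: left_module R N by fact
  have "(\<lambda>x. \<ominus>\<^bsub>N\<^esub> g x) \<in> lmod_hom R M N"
    by (rule lmod_homI)
      (simp_all add: lmod_hom_closed[OF assms(3)] lmod_hom_add[OF assms(3)] lmod_hom_smult[OF assms(3)]
        N.M.minus_add N.smult_r_minus)
  from lmod_hom_sum[OF assms(1,2) this] show ?thesis by (simp add: a_minus_def)
qed

lemma submodule_preimage:
  assumes "left_module R M" "left_module R N" "f \<in> lmod_hom R M N" "submodule K R N"
  shows "submodule {x \<in> carrier M. f x \<in> K} R M"
proof -
  interpret M: left_module R M by fact
  show ?thesis
    using assms
    by (intro M.submoduleI)
      (auto simp: lmod_hom_add lmod_hom_smult lmod_hom_zero intro: submodule_closed)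
qed

lemma submodule_image:
  assumes "left_module R M" "left_module R N" "f \<in> lmod_hom R M N" "submodule K R M"
  shows "submodule (f ` K) R N"
proof -
  interpret M: left_module R M by fact
  interpret N: left_module R N by fact
  note K = submodule_in_carrier[OF assms(4)] submodule_closed[OF assms(4)]
  show ?thesis
  proof (rule N.submoduleI)
    show "f ` K \<subseteq> carrier N" using K(1) lmod_hom_closed[OF assms(3)] by auto
    show "\<zero>\<^bsub>N\<^esub> \<in> f ` K" using lmod_hom_zero[OF assms(1-3)] K(2) by (metis image_eqI)
    fix x y assume "x \<in> f ` K" "y \<in> f ` K"
    then obtain u v where "u \<in> K" "v \<in> K" "x = f u" "y = f v" by blast
    then show "x \<oplus>\<^bsub>N\<^esub> y \<in> f ` K"
      using K(1,3) lmod_hom_add[OF assms(3), of u v] by (metis image_eqI)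
  next
    fix a x assume "a \<in> carrier R" "x \<in> f ` K"
    moreover then obtain u where "u \<in> K" "x = f u" by blast
    ultimately show "a \<odot>\<^bsub>N\<^esub> x \<in> f ` K"
      using K(1,4) lmod_hom_smult[OF assms(3), of a u] by (metis image_eqI)
  qed
qed

lemma regular_left_module:
  assumes "ring R"
  shows "left_module R (regular_module R)"
proof -
  interpret ring R by fact
  have "abelian_group (regular_module R)"
    by (rule abelian_groupI)
      (auto simp: regular_module_def a_ac intro!: bexI[of _ "\<ominus>\<^bsub>R\<^esub> _"] r_neg l_neg)
  then show ?thesis
    by (auto simp: left_module_def left_module_axioms_def assms regular_module_def
        l_distr r_distr m_assoc)
qed

lemma regular_module_simps [simp]:
  "carrier (regular_module R) = carrier R"
  "\<zero>\<^bsub>regular_module R\<^esub> = \<zero>\<^bsub>R\<^esub>"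
  "x \<oplus>\<^bsub>regular_module R\<^esub> y = x \<oplus>\<^bsub>R\<^esub> y"
  "a \<odot>\<^bsub>regular_module R\<^esub> x = a \<otimes>\<^bsub>R\<^esub> x"
  by (simp_all add: regular_module_def)

lemma regular_module_a_inv [simp]: "\<ominus>\<^bsub>regular_module R\<^esub> x = \<ominus>\<^bsub>R\<^esub> x"
  by (simp add: regular_module_def a_inv_def m_inv_def)

lemma regular_module_a_minus [simp]: "x \<ominus>\<^bsub>regular_module R\<^esub> y = x \<ominus>\<^bsub>R\<^esub> y"
  by (simp add: a_minus_def)

lemma lmod_hom_smult_right:
  assumes "left_module R M" "x \<in> carrier M"
  shows "(\<lambda>r. r \<odot>\<^bsub>M\<^esub> x) \<in> lmod_hom R (regular_module R) M"
proof -
  interpret left_module R M by fact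
  show ?thesis using assms by (intro lmod_homI) (auto simp: smult_l_distr smult_assoc)
qed

text \<open>Transport of structure. For injective \<open>c\<close> this is a copy of
  \<open>S\<close>; if the fibres of \<open>c\<close> are the cosets of a submodule, it is the
  quotient. The target type is free, so either can be placed on \<open>'u\<close>.\<close>

definition image_module :: "('m \<Rightarrow> 'n) \<Rightarrow> ('r, 'm) module \<Rightarrow> ('r, 'n) module" where
  "image_module c S =
     \<lparr>carrier = c ` carrier S, monoid.mult = undefined, monoid.one = undefined,
      ring.zero = c \<zero>\<^bsub>S\<^esub>,
      ring.add = (\<lambda>x y. c (inv_into (carrier S) c x \<oplus>\<^bsub>S\<^esub> inv_into (carrier S) c y)),
      smult = (\<lambda>r x. c (r \<odot>\<^bsub>S\<^esub> inv_into (carrier S) c x))\<rparr>"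

lemma image_module_carrier [simp]: "carrier (image_module c S) = c ` carrier S"
  and image_module_zero [simp]: "\<zero>\<^bsub>image_module c S\<^esub> = c \<zero>\<^bsub>S\<^esub>"
  by (simp_all add: image_module_def)

text \<open>
  The module laws of \<open>S\<close> are only required modulo the kernel of \<open>c\<close>, so that \<open>S\<close> may be a mere
  presentation of the module, such as a group of formal sums.
\<close>

locale module_image =
  R?: ring R + S?: abelian_group S
  for R :: "('r, 'x) ring_scheme" and S :: "('r, 'm) module" (structure) and c :: "'m \<Rightarrow> 'n" +
  assumes smult_closed: "\<lbrakk>a \<in> carrier R; x \<in> carrier S\<rbrakk> \<Longrightarrow> a \<odot> x \<in> carrier S"
    and cong_add: "\<lbrakk>x \<in> carrier S; x' \<in> carrier S; y \<in> carrier S; y' \<in> carrier S; c x = c x'; c y = c y'\<rbrakk>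
      \<Longrightarrow> c (x \<oplus> y) = c (x' \<oplus> y')"
    and cong_smult: "\<lbrakk>a \<in> carrier R; x \<in> carrier S; x' \<in> carrier S; c x = c x'\<rbrakk>
      \<Longrightarrow> c (a \<odot> x) = c (a \<odot> x')"
    and l_distr: "\<lbrakk>a \<in> carrier R; b \<in> carrier R; x \<in> carrier S\<rbrakk>
      \<Longrightarrow> c ((a \<oplus>\<^bsub>R\<^esub> b) \<odot> x) = c (a \<odot> x \<oplus> b \<odot> x)"
    and r_distr: "\<lbrakk>a \<in> carrier R; x \<in> carrier S; y \<in> carrier S\<rbrakk>
      \<Longrightarrow> c (a \<odot> (x \<oplus> y)) = c (a \<odot> x \<oplus> a \<odot> y)"
    and assoc: "\<lbrakk>a \<in> carrier R; b \<in> carrier R; x \<in> carrier S\<rbrakk>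
      \<Longrightarrow> c ((a \<otimes>\<^bsub>R\<^esub> b) \<odot> x) = c (a \<odot> (b \<odot> x))"
    and one: "x \<in> carrier S \<Longrightarrow> c (\<one>\<^bsub>R\<^esub> \<odot> x) = c x"
begin

lemma image_add:
  assumes "x \<in> carrier S" "y \<in> carrier S"
  shows "c x \<oplus>\<^bsub>image_module c S\<^esub> c y = c (x \<oplus> y)"
  using assms unfolding image_module_def
  by (auto intro!: cong_add simp: f_inv_into_f inv_into_into)

lemma image_smult:
  assumes "a \<in> carrier R" "x \<in> carrier S"
  shows "a \<odot>\<^bsub>image_module c S\<^esub> c x = c (a \<odot> x)"
  using assms unfolding image_module_def
  by (auto intro!: cong_smult simp: f_inv_into_f inv_into_into)

lemma image_left_module: "left_module R (image_module c S)"
proof -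
  have inv: "\<exists>y\<in>carrier S. c (x \<oplus> y) = c \<zero>" if "x \<in> carrier S" for x
    using that by (intro bexI[of _ "\<ominus> x"]) (auto simp: S.r_neg)
  have "abelian_group (image_module c S)"
    by (rule abelian_groupI) (auto simp: image_add S.a_ac inv)
  then show ?thesis
    by (auto simp: left_module_def left_module_axioms_def R.ring_axioms image_add image_smult
        smult_closed l_distr r_distr assoc one)
qed

lemma image_hom: "c \<in> lmod_hom R S (image_module c S)"
  by (rule lmod_homI) (auto simp: image_add image_smult)

end

text \<open>Builds the quotient S/D on whatever type \<open>c\<close> maps to. The module laws
  already hold in \<open>S\<close>; only the two congruence conditions use that \<open>D\<close> is
  a submodule.\<close>

lemma module_image_of_kernel:
  assumes "left_module R S" "submodule D R S"
    and "\<And>x y. \<lbrakk>x \<in> carrier S; y \<in> carrier S\<rbrakk> \<Longrightarrow> c x = c y \<longleftrightarrow> x \<ominus>\<^bsub>S\<^esub> y \<in> D"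
  shows "module_image R S c"
proof -
  interpret left_module R S by fact
  show ?thesis
  proof unfold_locales
    fix x x' y y' assume *: "x \<in> carrier S" "x' \<in> carrier S" "y \<in> carrier S" "y' \<in> carrier S"
      "c x = c x'" "c y = c y'"
    have "(x \<oplus>\<^bsub>S\<^esub> y) \<ominus>\<^bsub>S\<^esub> (x' \<oplus>\<^bsub>S\<^esub> y') = (x \<ominus>\<^bsub>S\<^esub> x') \<oplus>\<^bsub>S\<^esub> (y \<ominus>\<^bsub>S\<^esub> y')"
      using * by (simp add: a_minus_def M.a_ac M.minus_add)
    then show "c (x \<oplus>\<^bsub>S\<^esub> y) = c (x' \<oplus>\<^bsub>S\<^esub> y')"
      using * assms(2,3) by (simp add: submodule_add)
  next
    fix a x x' assume "a \<in> carrier R" "x \<in> carrier S" "x' \<in> carrier S" "c x = c x'"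
    then show "c (a \<odot>\<^bsub>S\<^esub> x) = c (a \<odot>\<^bsub>S\<^esub> x')"
      using assms(2,3) by (simp add: submodule_smult flip: smult_r_diff)
  qed (auto simp: smult_l_distr smult_r_distr smult_assoc)
qed

lemma module_image_of_inj:
  assumes "left_module R S" "inj_on c (carrier S)"
  shows "module_image R S c"
proof -
  interpret left_module R S by fact
  show ?thesis
    by unfold_locales
      (auto simp: smult_l_distr smult_r_distr smult_assoc dest!: inj_onD[OF assms(2)])
qed

section \<open>Complemented intervals of submodules\<close>

text \<open>
  The interval from \<open>K\<close> to \<open>L\<close> in the lattice of submodules of \<open>M\<close> is complemented iff \<open>L/K\<close>
  is semisimple; this avoids quotient modules and simple modules altogether.
\<close>

definition semisimple_interval ::
    "('r, 'x) ring_scheme \<Rightarrow> ('r, 'm) module \<Rightarrow> 'm set \<Rightarrow> 'm set \<Rightarrow> bool" where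
  "semisimple_interval R M K L \<longleftrightarrow> submodule K R M \<and> submodule L R M \<and> K \<subseteq> L \<and>
     (\<forall>P. submodule P R M \<and> K \<subseteq> P \<and> P \<subseteq> L \<longrightarrow>
        (\<exists>P'. submodule P' R M \<and> K \<subseteq> P' \<and> P' \<subseteq> L \<and> P \<inter> P' = K \<and> L \<subseteq> P <+>\<^bsub>M\<^esub> P'))"

abbreviation semisimple_module :: "('r, 'x) ring_scheme \<Rightarrow> ('r, 'm) module \<Rightarrow> bool" where
  "semisimple_module R M \<equiv> semisimple_interval R M {\<zero>\<^bsub>M\<^esub>} (carrier M)"

lemma semisimple_intervalD:
  assumes "semisimple_interval R M K L"
  shows "submodule K R M" "submodule L R M" "K \<subseteq> L"
  using assms by (auto simp: semisimple_interval_def)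

lemma semisimple_interval_complement:
  assumes "semisimple_interval R M K L" "submodule P R M" "K \<subseteq> P" "P \<subseteq> L"
  obtains P' where "submodule P' R M" "K \<subseteq> P'" "P' \<subseteq> L" "P \<inter> P' = K"
    "\<forall>x\<in>L. \<exists>p\<in>P. \<exists>p'\<in>P'. x = p \<oplus>\<^bsub>M\<^esub> p'"
proof -
  obtain P' where P': "submodule P' R M" "K \<subseteq> P'" "P' \<subseteq> L" "P \<inter> P' = K" "L \<subseteq> P <+>\<^bsub>M\<^esub> P'"
    using assms unfolding semisimple_interval_def by blast
  then have "\<exists>p\<in>P. \<exists>p'\<in>P'. x = p \<oplus>\<^bsub>M\<^esub> p'" if "x \<in> L" for x
    using that by (metis set_addE subsetD)
  with P' that show thesis by blast
qed

lemma (in abelian_group) add_diff_cancel: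
  assumes "x \<in> carrier G" "y \<in> carrier G"
  shows "y \<oplus> (x \<ominus> y) = x"
proof -
  have "y \<oplus> (x \<ominus> y) = x \<oplus> (y \<oplus> \<ominus> y)"
    using assms by (simp add: a_minus_def a_lcomm)
  then show ?thesis using assms by (simp add: r_neg)
qed

lemma (in abelian_group) add_diff_cancel_left:
  assumes "x \<in> carrier G" "y \<in> carrier G"
  shows "(x \<oplus> y) \<ominus> x = y"
proof -
  have "(x \<oplus> y) \<ominus> x = y \<oplus> (x \<oplus> \<ominus> x)"
    using assms by (simp add: a_minus_def a_ac)
  then show ?thesis using assms by (simp add: r_neg)
qed

lemma (in left_module) set_add_upper:
  assumes "submodule A R M" "submodule B R M"
  shows "A \<subseteq> A <+>\<^bsub>M\<^esub> B" "B \<subseteq> A <+>\<^bsub>M\<^esub> B"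
proof -
  have "a \<in> A <+>\<^bsub>M\<^esub> B" if "a \<in> A" for a
    using set_addI[OF that submodule_zero[OF assms(2)], of M] submodule_in_carrier[OF assms(1) that]
    by simp
  moreover have "b \<in> A <+>\<^bsub>M\<^esub> B" if "b \<in> B" for b
    using set_addI[OF submodule_zero[OF assms(1)] that, of M] submodule_in_carrier[OF assms(2) that]
    by simp
  ultimately show "A \<subseteq> A <+>\<^bsub>M\<^esub> B" "B \<subseteq> A <+>\<^bsub>M\<^esub> B" by auto
qed

lemma set_add_least:
  assumes "submodule P R M" "A \<subseteq> P" "B \<subseteq> P"
  shows "A <+>\<^bsub>M\<^esub> B \<subseteq> P"
  using assms by (auto elim!: set_addE intro!: submodule_add)

text \<open>The map induced by \<open>h\<close> embeds the quotient of the preimages into L/K, so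
  this says that submodules of semisimple modules are semisimple. A complement is found in
  \<open>N\<close> and pulled back.\<close>

lemma semisimple_interval_preimage:
  assumes M: "left_module R M" and N: "left_module R N" and h: "h \<in> lmod_hom R M N"
    and KL: "semisimple_interval R N K L"
  shows "semisimple_interval R M {x \<in> carrier M. h x \<in> K} {x \<in> carrier M. h x \<in> L}"
    (is "semisimple_interval R M ?K ?L")
  unfolding semisimple_interval_def
proof (intro conjI allI impI)
  interpret M: left_module R M by fact
  interpret N: left_module R N by fact
  note sub = semisimple_intervalD[OF KL]
  show "submodule ?K R M" "submodule ?L R M" "?K \<subseteq> ?L"
    using sub by (auto intro: submodule_preimage[OF M N h])
  fix P assume P: "submodule P R M \<and> ?K \<subseteq> P \<and> P \<subseteq> ?L"
  \<comment> \<open>The image of \<open>P\<close> need not contain \<open>K\<close>, so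
    \<open>K\<close> is added before a complement is taken.\<close>
  let ?hP = "K <+>\<^bsub>N\<^esub> h ` P"
  have hP: "submodule (h ` P) R N" using P submodule_image[OF M N h] by blast
  have "submodule ?hP R N" by (rule N.submodule_set_add[OF sub(1) hP])
  moreover have "K \<subseteq> ?hP" by (rule N.set_add_upper[OF sub(1) hP])
  moreover have "?hP \<subseteq> L" using sub(3) P by (intro set_add_least[OF sub(2)]) auto
  ultimately obtain P' where P': "submodule P' R N" "K \<subseteq> P'" "P' \<subseteq> L" "?hP \<inter> P' = K"
    and dec: "\<forall>x\<in>L. \<exists>p\<in>?hP. \<exists>p'\<in>P'. x = p \<oplus>\<^bsub>N\<^esub> p'"
    by (rule semisimple_interval_complement[OF KL])
  let ?P' = "{x \<in> carrier M. h x \<in> P'}"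
  show "\<exists>P'. submodule P' R M \<and> ?K \<subseteq> P' \<and> P' \<subseteq> ?L \<and> P \<inter> P' = ?K \<and> ?L \<subseteq> P <+>\<^bsub>M\<^esub> P'"
  proof (intro exI[of _ ?P'] conjI)
    show "submodule ?P' R M" by (rule submodule_preimage[OF M N h P'(1)])
    show "?K \<subseteq> ?P'" "?P' \<subseteq> ?L" using P' by auto
    show "P \<inter> ?P' = ?K"
    proof
      have "h x \<in> ?hP" if "x \<in> P" for x
        using that N.set_add_upper(2)[OF sub(1) hP] by blast
      then show "P \<inter> ?P' \<subseteq> ?K" using P'(4) by blast
      show "?K \<subseteq> P \<inter> ?P'" using P P' by auto
    qed
    show "?L \<subseteq> P <+>\<^bsub>M\<^esub> ?P'"
    proof
      fix x assume "x \<in> ?L"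
      then have x: "x \<in> carrier M" "h x \<in> L" by auto
      obtain y p' where y: "y \<in> ?hP" and p': "p' \<in> P'" and hx: "h x = y \<oplus>\<^bsub>N\<^esub> p'"
        using bspec[OF dec x(2)] by blast
      from y obtain k p where k: "k \<in> K" and p: "p \<in> P" and yy: "y = k \<oplus>\<^bsub>N\<^esub> h p"
        by (auto elim!: set_addE)
      have c: "k \<in> carrier N" "p \<in> carrier M" "p' \<in> carrier N" "h p \<in> carrier N"
        using k p p' P P' sub lmod_hom_closed[OF h] by (auto dest: submodule_in_carrier)
      have "h (x \<ominus>\<^bsub>M\<^esub> p) = h x \<ominus>\<^bsub>N\<^esub> h p"
        using c x by (simp add: lmod_hom_diff[OF M N h])
      also have "\<dots> = k \<oplus>\<^bsub>N\<^esub> p'"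
        using c by (simp add: hx yy a_minus_def N.M.a_ac N.M.r_neg)
      finally have "h (x \<ominus>\<^bsub>M\<^esub> p) = k \<oplus>\<^bsub>N\<^esub> p'" .
      then have "x \<ominus>\<^bsub>M\<^esub> p \<in> ?P'"
        using k p' P' c x by (auto intro: submodule_add)
      moreover have "x = p \<oplus>\<^bsub>M\<^esub> (x \<ominus>\<^bsub>M\<^esub> p)"
        using c x by (simp add: M.M.add_diff_cancel)
      ultimately show "x \<in> P <+>\<^bsub>M\<^esub> ?P'" using set_addI[OF p, of "x \<ominus>\<^bsub>M\<^esub> p" ?P' M] by simp
    qed
  qed
qed

text \<open>L/A maps onto the quotient of K + h(L) by \<open>K\<close>, so this says that
  homomorphic images of semisimple modules are semisimple. A complement is taken in
  \<open>L\<close>, for the preimage of \<open>P\<close>, and pushed forward.\<close>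

lemma semisimple_interval_image:
  assumes M: "left_module R M" and N: "left_module R N" and h: "h \<in> lmod_hom R M N"
    and AL: "semisimple_interval R M A L" and K: "submodule K R N" and hA: "h ` A \<subseteq> K"
  shows "semisimple_interval R N K (K <+>\<^bsub>N\<^esub> h ` L)"
  unfolding semisimple_interval_def
proof (intro conjI allI impI)
  interpret M: left_module R M by fact
  interpret N: left_module R N by fact
  note sub = semisimple_intervalD[OF AL]
  have hL: "submodule (h ` L) R N" by (rule submodule_image[OF M N h sub(2)])
  show "submodule K R N" by fact
  show "submodule (K <+>\<^bsub>N\<^esub> h ` L) R N" by (rule N.submodule_set_add[OF K hL])
  show "K \<subseteq> K <+>\<^bsub>N\<^esub> h ` L" by (rule N.set_add_upper[OF K hL])
  fix P assume P: "submodule P R N \<and> K \<subseteq> P \<and> P \<subseteq> K <+>\<^bsub>N\<^esub> h ` L"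
  let ?P = "{x \<in> carrier M. h x \<in> P} \<inter> L"
  have "submodule ?P R M"
    using P sub by (intro M.submodule_Int submodule_preimage[OF M N h]) auto
  moreover have "A \<subseteq> ?P" using hA P sub submodule_subset[OF sub(1)] by auto
  moreover have "?P \<subseteq> L" by auto
  ultimately obtain P' where P': "submodule P' R M" "A \<subseteq> P'" "P' \<subseteq> L" "?P \<inter> P' = A"
    and dec: "\<forall>x\<in>L. \<exists>p\<in>?P. \<exists>p'\<in>P'. x = p \<oplus>\<^bsub>M\<^esub> p'"
    by (rule semisimple_interval_complement[OF AL])
  have hP': "submodule (h ` P') R N" by (rule submodule_image[OF M N h P'(1)])
  let ?P' = "K <+>\<^bsub>N\<^esub> h ` P'"
  show "\<exists>P'. submodule P' R N \<and> K \<subseteq> P' \<and> P' \<subseteq> K <+>\<^bsub>N\<^esub> h ` L \<and> P \<inter> P' = K \<and>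
      K <+>\<^bsub>N\<^esub> h ` L \<subseteq> P <+>\<^bsub>N\<^esub> P'"
  proof (intro exI[of _ ?P'] conjI)
    show P'': "submodule ?P' R N" by (rule N.submodule_set_add[OF K hP'])
    show "K \<subseteq> ?P'" by (rule N.set_add_upper[OF K hP'])
    show "?P' \<subseteq> K <+>\<^bsub>N\<^esub> h ` L" using P'(3) by (auto simp: set_add_def')
    show "P \<inter> ?P' = K"
    proof
      show "K \<subseteq> P \<inter> ?P'" using P N.set_add_upper(1)[OF K hP'] by auto
      show "P \<inter> ?P' \<subseteq> K"
      proof
        fix x assume "x \<in> P \<inter> ?P'"
        then obtain k p' where *: "k \<in> K" "p' \<in> P'" "x = k \<oplus>\<^bsub>N\<^esub> h p'" "x \<in> P"
          by (auto elim!: set_addE)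
        have c: "k \<in> carrier N" "p' \<in> carrier M" "h p' \<in> carrier N"
          using * K P' lmod_hom_closed[OF h] by (auto dest: submodule_in_carrier)
        have "h p' \<oplus>\<^bsub>N\<^esub> k \<in> P" using * c by (simp add: N.M.a_comm)
        moreover have "k \<in> P" using * P by blast
        ultimately have "h p' \<in> P" using N.submodule_add_cancel[of P "h p'" k] P c by blast
        then have "p' \<in> A" using * c P' by blast
        then show "x \<in> K" using * hA K by (auto intro!: submodule_add)
      qed
    qed
    show "K <+>\<^bsub>N\<^esub> h ` L \<subseteq> P <+>\<^bsub>N\<^esub> ?P'"
    proof
      fix x assume "x \<in> K <+>\<^bsub>N\<^esub> h ` L"
      then obtain k l where kl: "k \<in> K" "l \<in> L" "x = k \<oplus>\<^bsub>N\<^esub> h l" by (auto elim!: set_addE)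
      obtain p p' where pp: "p \<in> ?P" "p' \<in> P'" "l = p \<oplus>\<^bsub>M\<^esub> p'" using bspec[OF dec kl(2)] by blast
      have c: "k \<in> carrier N" "p \<in> carrier M" "p' \<in> carrier M" "h p \<in> carrier N" "h p' \<in> carrier N"
        using kl pp K P' lmod_hom_closed[OF h] by (auto dest: submodule_in_carrier)
      have "x = (k \<oplus>\<^bsub>N\<^esub> h p) \<oplus>\<^bsub>N\<^esub> h p'"
        using c by (simp add: kl pp lmod_hom_add[OF h] N.M.a_assoc)
      moreover have "k \<oplus>\<^bsub>N\<^esub> h p \<in> P" using kl pp P by (auto intro: submodule_add)
      moreover have "h p' \<in> ?P'" using pp N.set_add_upper(2)[OF K hP'] by blast
      ultimately show "x \<in> P <+>\<^bsub>N\<^esub> ?P'" by (simp add: set_addI)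
    qed
  qed
qed

lemma submodule_Union_chain:
  assumes "left_module R M" "\<C> \<noteq> {}" "\<And>C. C \<in> \<C> \<Longrightarrow> submodule C R M"
    and "\<And>A B. \<lbrakk>A \<in> \<C>; B \<in> \<C>\<rbrakk> \<Longrightarrow> A \<subseteq> B \<or> B \<subseteq> A"
  shows "submodule (\<Union>\<C>) R M"
proof -
  interpret left_module R M by fact
  show ?thesis
  proof (rule submoduleI)
    fix x y assume "x \<in> \<Union>\<C>" "y \<in> \<Union>\<C>"
    then obtain C where "C \<in> \<C>" "x \<in> C" "y \<in> C" using assms(4) by blast
    then show "x \<oplus>\<^bsub>M\<^esub> y \<in> \<Union>\<C>" using submodule_add[OF assms(3)] by auto
  next
    fix a x assume "a \<in> carrier R" "x \<in> \<Union>\<C>"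
    then show "a \<odot>\<^bsub>M\<^esub> x \<in> \<Union>\<C>" using submodule_smult[OF assms(3)] by auto
  next
    show "\<zero>\<^bsub>M\<^esub> \<in> \<Union>\<C>" using assms(2) submodule_zero[OF assms(3)] by auto
    show "\<Union>\<C> \<subseteq> carrier M" using submodule_subset[OF assms(3)] by auto
  qed
qed

text \<open>Sums of semisimple modules are semisimple. Generation by semisimple pieces is expressed
  by the condition that no proper \<open>P\<close> contains all of them, which avoids infinite sums.
  Zorn gives a \<open>C\<close> maximal with \<open>P \<inter> C = K\<close>; a piece sticking out
  of P + C would allow \<open>C\<close> to be enlarged.\<close>

lemma semisimple_interval_sum:
  assumes M: "left_module R M" and K: "submodule K R M" and L: "submodule L R M" and KL: "K \<subseteq> L"
    and gen: "\<And>P. \<lbrakk>submodule P R M; K \<subseteq> P; P \<subset> L\<rbrakk>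
      \<Longrightarrow> \<exists>W \<subseteq> L. semisimple_interval R M K W \<and> \<not> W \<subseteq> P"
  shows "semisimple_interval R M K L"
  unfolding semisimple_interval_def
proof (intro conjI allI impI K L KL)
  interpret left_module R M by fact
  fix P assume P: "submodule P R M \<and> K \<subseteq> P \<and> P \<subseteq> L"
  define \<A> where "\<A> = {C. submodule C R M \<and> K \<subseteq> C \<and> C \<subseteq> L \<and> P \<inter> C = K}"
  have "\<exists>C\<in>\<A>. \<forall>X\<in>\<A>. C \<subseteq> X \<longrightarrow> X = C"
  proof (rule subset_Zorn)
    fix \<C> assume ch: "subset.chain \<A> \<C>"
    show "\<exists>U\<in>\<A>. \<forall>X\<in>\<C>. X \<subseteq> U"
    proof (cases "\<C> = {}")
      case True
      then show ?thesis using K P KL by (auto simp: \<A>_def)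
    next
      case False
      have sub: "\<C> \<subseteq> \<A>" and lin: "\<And>A B. \<lbrakk>A \<in> \<C>; B \<in> \<C>\<rbrakk> \<Longrightarrow> A \<subseteq> B \<or> B \<subseteq> A"
        using ch by (auto simp: subset_chain_def)
      have "submodule (\<Union>\<C>) R M"
        using sub by (intro submodule_Union_chain[OF M False _ lin]) (auto simp: \<A>_def)
      then have "\<Union>\<C> \<in> \<A>" using sub False unfolding \<A>_def by blast
      then show ?thesis by blast
    qed
  qed
  then obtain C where C: "C \<in> \<A>" and max: "\<And>X. \<lbrakk>X \<in> \<A>; C \<subseteq> X\<rbrakk> \<Longrightarrow> X = C" by blast
  have C': "submodule C R M" "K \<subseteq> C" "C \<subseteq> L" "P \<inter> C = K" using C by (auto simp: \<A>_def)
  let ?S = "P <+>\<^bsub>M\<^esub> C"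
  have S: "submodule ?S R M" using P C' by (simp add: submodule_set_add)
  have PS: "P \<subseteq> ?S" "C \<subseteq> ?S" using set_add_upper[of P C] P C' by auto
  have SL: "?S \<subseteq> L" using P C' L by (intro set_add_least[of L R]) auto
  have "L \<subseteq> ?S"
  proof (rule ccontr)
    assume "\<not> L \<subseteq> ?S"
    then obtain W where W: "W \<subseteq> L" "semisimple_interval R M K W" "\<not> W \<subseteq> ?S"
      using gen[OF S] P PS SL by blast
    note WD = semisimple_intervalD[OF W(2)]
    \<comment> \<open>A complement \<open>D\<close> of \<open>W \<inter> ?S\<close> inside
      \<open>W\<close> meets \<open>?S\<close> only in \<open>K\<close>, yet is not contained in
      \<open>?S\<close>.\<close>
    have "submodule (W \<inter> ?S) R M" "K \<subseteq> W \<inter> ?S" "W \<inter> ?S \<subseteq> W"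
      using WD S P PS by (auto intro: submodule_Int)
    then obtain D where D: "submodule D R M" "K \<subseteq> D" "D \<subseteq> W" "W \<inter> ?S \<inter> D = K"
      and dec: "\<forall>x\<in>W. \<exists>p\<in>W \<inter> ?S. \<exists>p'\<in>D. x = p \<oplus>\<^bsub>M\<^esub> p'"
      by (rule semisimple_interval_complement[OF W(2)])
    have DS: "D \<inter> ?S = K" using D by blast
    have "\<not> D \<subseteq> ?S"
    proof
      assume "D \<subseteq> ?S"
      have "x \<in> ?S" if x: "x \<in> W" for x
      proof -
        obtain p p' where "p \<in> ?S" "p' \<in> D" "x = p \<oplus>\<^bsub>M\<^esub> p'" using bspec[OF dec x] by blast
        then show ?thesis using submodule_add[OF S, of p p'] \<open>D \<subseteq> ?S\<close> by auto
      qed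
      then show False using W by blast
    qed
    let ?X = "C <+>\<^bsub>M\<^esub> D"
    have X: "submodule ?X R M" using C' D by (simp add: submodule_set_add)
    have CX: "C \<subseteq> ?X" "D \<subseteq> ?X" using set_add_upper[of C D] C' D by auto
    \<comment> \<open>If c + d lies in \<open>P\<close>, then d lies in P + C, hence in
      \<open>K\<close> and in \<open>C\<close>; so c + d is in \<open>P \<inter> C\<close>, which is
      \<open>K\<close>.\<close>
    have "P \<inter> ?X \<subseteq> K"
    proof
      fix x assume "x \<in> P \<inter> ?X"
      then obtain c d where x: "x \<in> P" "c \<in> C" "d \<in> D" "x = c \<oplus>\<^bsub>M\<^esub> d" by (auto elim!: set_addE)
      have car: "c \<in> carrier M" "d \<in> carrier M" using x C' D by (auto dest: submodule_in_carrier)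
      have "d \<oplus>\<^bsub>M\<^esub> c \<in> ?S" "c \<in> ?S" using x PS M.a_comm[OF car] by auto
      then have "d \<in> ?S" by (rule submodule_add_cancel[OF S car(2), rotated])
      then have "d \<in> K" using DS x by blast
      then have "x \<in> C" using x C' submodule_add[OF C'(1), of c d] by auto
      then show "x \<in> K" using x C' by blast
    qed
    moreover have "?X \<subseteq> L" using C' D W by (intro set_add_least[OF L]) auto
    ultimately have "?X \<in> \<A>"
      using X CX C' P unfolding \<A>_def by blast
    then have "?X = C" using max CX by blast
    then show False using \<open>\<not> D \<subseteq> ?S\<close> CX PS by blast
  qed
  then show "\<exists>P'. submodule P' R M \<and> K \<subseteq> P' \<and> P' \<subseteq> L \<and> P \<inter> P' = K \<and> L \<subseteq> P <+>\<^bsub>M\<^esub> P'"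
    using C' by blast
qed

lemma semisimple_interval_zero:
  assumes "left_module R M"
  shows "semisimple_interval R M {\<zero>\<^bsub>M\<^esub>} {\<zero>\<^bsub>M\<^esub>}"
  unfolding semisimple_interval_def
proof (intro conjI allI impI subset_refl)
  interpret left_module R M by fact
  show "submodule {\<zero>\<^bsub>M\<^esub>} R M" "submodule {\<zero>\<^bsub>M\<^esub>} R M" by (rule zero_submodule)+
  fix P assume "submodule P R M \<and> {\<zero>\<^bsub>M\<^esub>} \<subseteq> P \<and> P \<subseteq> {\<zero>\<^bsub>M\<^esub>}"
  then have "P = {\<zero>\<^bsub>M\<^esub>}" by blast
  then show "\<exists>P'. submodule P' R M \<and> {\<zero>\<^bsub>M\<^esub>} \<subseteq> P' \<and> P' \<subseteq> {\<zero>\<^bsub>M\<^esub>} \<and> P \<inter> P' = {\<zero>\<^bsub>M\<^esub>} \<and>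
      {\<zero>\<^bsub>M\<^esub>} \<subseteq> P <+>\<^bsub>M\<^esub> P'"
    by (intro exI[of _ "{\<zero>\<^bsub>M\<^esub>}"]) (auto simp: zero_submodule set_add_def')
qed

section \<open>Semisimple modules, their injectivity over a QI-ring, and the socle\<close>

lemma lmod_hom_into_submodule:
  "\<lbrakk>f \<in> lmod_hom R M N; \<And>x. x \<in> carrier M \<Longrightarrow> f x \<in> S\<rbrakk> \<Longrightarrow> f \<in> lmod_hom R M (N\<lparr>carrier := S\<rparr>)"
  by (auto simp: lmod_hom_def)

lemma lmod_hom_from_submodule_codomain:
  "\<lbrakk>f \<in> lmod_hom R M (N\<lparr>carrier := S\<rparr>); S \<subseteq> carrier N\<rbrakk> \<Longrightarrow> f \<in> lmod_hom R M N"
  by (auto simp: lmod_hom_def)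

text \<open>The inclusion of \<open>S\<close> pulls the interval in \<open>M\<close> back to the
  whole submodule lattice of \<open>S\<close>.\<close>

lemma semisimple_restrict:
  assumes M: "left_module R M" and S: "semisimple_interval R M {\<zero>\<^bsub>M\<^esub>} S"
  shows "semisimple_module R (M\<lparr>carrier := S\<rparr>)"
proof -
  interpret M: left_module R M by fact
  note sub = semisimple_intervalD[OF S]
  have id: "(\<lambda>x. x) \<in> lmod_hom R (M\<lparr>carrier := S\<rparr>) M"
    using submodule_subset[OF sub(2)] by (intro lmod_homI) auto
  have "{x \<in> carrier (M\<lparr>carrier := S\<rparr>). x \<in> {\<zero>\<^bsub>M\<^esub>}} = {\<zero>\<^bsub>M\<lparr>carrier := S\<rparr>\<^esub>}"
    using sub by auto
  moreover have "{x \<in> carrier (M\<lparr>carrier := S\<rparr>). x \<in> S} = carrier (M\<lparr>carrier := S\<rparr>)" by auto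
  ultimately show ?thesis
    using semisimple_interval_preimage[OF M.submodule_module[OF sub(2)] M id S] by metis
qed

lemma semisimple_submodule:
  assumes M: "left_module R M" and S: "semisimple_module R M" and N: "submodule N R M"
  shows "semisimple_module R (M\<lparr>carrier := N\<rparr>)"
proof -
  interpret M: left_module R M by fact
  have id: "(\<lambda>x. x) \<in> lmod_hom R (M\<lparr>carrier := N\<rparr>) M"
    using submodule_subset[OF N] by (intro lmod_homI) auto
  have "{x \<in> carrier (M\<lparr>carrier := N\<rparr>). x \<in> {\<zero>\<^bsub>M\<^esub>}} = {\<zero>\<^bsub>M\<lparr>carrier := N\<rparr>\<^esub>}"
    using submodule_zero[OF N] by auto
  moreover have "{x \<in> carrier (M\<lparr>carrier := N\<rparr>). x \<in> carrier M} = carrier (M\<lparr>carrier := N\<rparr>)"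
    using submodule_subset[OF N] by auto
  ultimately show ?thesis
    using semisimple_interval_preimage[OF M.submodule_module[OF N] M id S] by metis
qed

lemma semisimple_image:
  assumes M: "left_module R M" and N: "left_module R N" and h: "h \<in> lmod_hom R M N"
    and K: "semisimple_interval R M K L" and hK: "\<And>x. x \<in> K \<Longrightarrow> h x = \<zero>\<^bsub>N\<^esub>"
  shows "semisimple_interval R N {\<zero>\<^bsub>N\<^esub>} (h ` L)"
proof -
  interpret N: left_module R N by fact
  have "h ` L \<subseteq> carrier N"
    using semisimple_intervalD(2)[OF K] lmod_hom_closed[OF h] by (auto dest: submodule_in_carrier)
  then have "{\<zero>\<^bsub>N\<^esub>} <+>\<^bsub>N\<^esub> h ` L = h ` L"
    unfolding set_add_def' by (force simp: subset_iff)
  moreover have "h ` K \<subseteq> {\<zero>\<^bsub>N\<^esub>}" using hK by auto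
  ultimately show ?thesis
    using semisimple_interval_image[OF M N h K N.zero_submodule] by simp
qed

text \<open>A homomorphism on \<open>N\<close> is extended by composing it with the projection onto
  \<open>N\<close> along a complement.\<close>

lemma semisimple_quasi_injective:
  assumes M: "left_module R M" and S: "semisimple_module R M"
  shows "quasi_injective_module R M"
  unfolding quasi_injective_module_def
proof (intro conjI M allI impI ballI)
  interpret M: left_module R M by fact
  fix N f assume N: "submodule N R M" and f: "f \<in> lmod_hom R (M\<lparr>carrier := N\<rparr>) M"
  have "{\<zero>\<^bsub>M\<^esub>} \<subseteq> N" using submodule_zero[OF N] by simp
  then obtain C where C: "submodule C R M" "N \<inter> C = {\<zero>\<^bsub>M\<^esub>}"
    and dec: "\<forall>x\<in>carrier M. \<exists>n\<in>N. \<exists>c\<in>C. x = n \<oplus>\<^bsub>M\<^esub> c"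
    by (rule semisimple_interval_complement[OF S N _ submodule_subset[OF N]])
  note car [simp] = submodule_in_carrier[OF N] submodule_in_carrier[OF C(1)]
  note cl [simp] = submodule_closed[OF N] submodule_closed[OF C(1)]
  have uniq: "n = n'" if *: "n \<in> N" "n' \<in> N" "c \<in> C" "c' \<in> C" "n \<oplus>\<^bsub>M\<^esub> c = n' \<oplus>\<^bsub>M\<^esub> c'" for n n' c c'
  proof -
    have "(n \<ominus>\<^bsub>M\<^esub> n') \<oplus>\<^bsub>M\<^esub> c = (n \<oplus>\<^bsub>M\<^esub> c) \<ominus>\<^bsub>M\<^esub> n'"
      using *(1-4) by (simp add: a_minus_def M.M.a_ac)
    also have "\<dots> = c'"
      unfolding *(5) using *(1-4) by (simp add: M.M.add_diff_cancel_left)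
    finally have "n \<ominus>\<^bsub>M\<^esub> n' \<in> C"
      using * M.submodule_add_cancel[OF C(1), of "n \<ominus>\<^bsub>M\<^esub> n'" c] by simp
    then have "n \<ominus>\<^bsub>M\<^esub> n' \<in> N \<inter> C" using * by auto
    then have "n \<ominus>\<^bsub>M\<^esub> n' = \<zero>\<^bsub>M\<^esub>" using C by simp
    then show ?thesis using M.M.add_diff_cancel[of n n'] *(1,2) by simp
  qed
  \<comment> \<open>The projection onto \<open>N\<close> along \<open>C\<close>; the description is
    definite because \<open>N \<inter> C\<close> is zero.\<close>
  define \<pi> where "\<pi> x = (THE n. n \<in> N \<and> (\<exists>c\<in>C. x = n \<oplus>\<^bsub>M\<^esub> c))" for x
  have \<pi>: "\<pi> (n \<oplus>\<^bsub>M\<^esub> c) = n" if "n \<in> N" "c \<in> C" for n c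
    unfolding \<pi>_def using that uniq by (intro the_equality) blast+
  have decE: thesis if "x \<in> carrier M" "\<And>n c. \<lbrakk>n \<in> N; c \<in> C; x = n \<oplus>\<^bsub>M\<^esub> c\<rbrakk> \<Longrightarrow> thesis" for x thesis
    using dec that by blast
  have "(\<lambda>x. f (\<pi> x)) \<in> lmod_hom R M M"
  proof (rule lmod_homI)
    fix x assume "x \<in> carrier M"
    then show "f (\<pi> x) \<in> carrier M"
      by (rule decE) (use lmod_hom_closed[OF f] \<pi> in auto)
    fix y assume "y \<in> carrier M"
    then obtain n' c' where y: "n' \<in> N" "c' \<in> C" "y = n' \<oplus>\<^bsub>M\<^esub> c'" by (rule decE)
    obtain n c where x: "n \<in> N" "c \<in> C" "x = n \<oplus>\<^bsub>M\<^esub> c" using \<open>x \<in> carrier M\<close> by (rule decE)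
    have "x \<oplus>\<^bsub>M\<^esub> y = (n \<oplus>\<^bsub>M\<^esub> n') \<oplus>\<^bsub>M\<^esub> (c \<oplus>\<^bsub>M\<^esub> c')" using x y by (simp add: M.M.a_ac)
    then have "\<pi> (x \<oplus>\<^bsub>M\<^esub> y) = n \<oplus>\<^bsub>M\<^esub> n'" using \<pi> x y by simp
    then show "f (\<pi> (x \<oplus>\<^bsub>M\<^esub> y)) = f (\<pi> x) \<oplus>\<^bsub>M\<^esub> f (\<pi> y)"
      using x y \<pi> lmod_hom_add[OF f, of n n'] by simp
  next
    fix r x assume r: "r \<in> carrier R" and "x \<in> carrier M"
    then obtain n c where x: "n \<in> N" "c \<in> C" "x = n \<oplus>\<^bsub>M\<^esub> c" by (elim decE)
    have "r \<odot>\<^bsub>M\<^esub> x = r \<odot>\<^bsub>M\<^esub> n \<oplus>\<^bsub>M\<^esub> r \<odot>\<^bsub>M\<^esub> c" using x r by (simp add: M.smult_r_distr)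
    then have "\<pi> (r \<odot>\<^bsub>M\<^esub> x) = r \<odot>\<^bsub>M\<^esub> n" using \<pi> x r by simp
    then show "f (\<pi> (r \<odot>\<^bsub>M\<^esub> x)) = r \<odot>\<^bsub>M\<^esub> f (\<pi> x)"
      using x r \<pi> lmod_hom_smult[OF f, of r n] by simp
  qed
  moreover have "f (\<pi> x) = f x" if "x \<in> N" for x
    using \<pi>[OF that submodule_zero[OF C(1)]] that by simp
  ultimately show "\<exists>g\<in>lmod_hom R M M. \<forall>x\<in>N. g x = f x"
    by (intro bexI[of _ "\<lambda>x. f (\<pi> x)"]) auto
qed

text \<open>The only point at which the QI condition is turned into injectivity; all later
  injectivity arguments go through this lemma.\<close>

lemma QI_semisimple_injective:
  fixes M :: "('r, 'u) module"
  assumes "left_QI_ring TYPE('u) R" "left_module R M" "semisimple_module R M"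
  shows "injective_module R M"
  using assms semisimple_quasi_injective unfolding left_QI_ring_def by blast

lemma injective_moduleD:
  fixes M E :: "('r, 'u) module"
  assumes "injective_module R E" "left_module R M" "submodule N R M"
    and "f \<in> lmod_hom R (M\<lparr>carrier := N\<rparr>) E"
  shows "\<exists>g\<in>lmod_hom R M E. \<forall>x\<in>N. g x = f x"
  using assms by (simp add: injective_module_def)

text \<open>The identity of the injective module \<open>S\<close> extends to \<open>M\<close>, which
  makes \<open>S\<close> a direct summand.\<close>

lemma QI_semisimple_retract:
  fixes M :: "('r, 'u) module"
  assumes QI: "left_QI_ring TYPE('u) R" and M: "left_module R M"
    and S: "semisimple_interval R M {\<zero>\<^bsub>M\<^esub>} S"
  obtains e where "e \<in> lmod_hom R M M" "\<And>x. x \<in> carrier M \<Longrightarrow> e x \<in> S" "\<And>x. x \<in> S \<Longrightarrow> e x = x"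
proof -
  interpret M: left_module R M by fact
  note sub = semisimple_intervalD(2)[OF S]
  let ?S = "M\<lparr>carrier := S\<rparr>"
  have "injective_module R ?S"
    by (rule QI_semisimple_injective[OF QI M.submodule_module[OF sub] semisimple_restrict[OF M S]])
  moreover have "(\<lambda>x. x) \<in> lmod_hom R ?S ?S" by (auto simp: lmod_hom_def)
  ultimately obtain e where e: "e \<in> lmod_hom R M ?S" "\<forall>x\<in>S. e x = x"
    using injective_moduleD[OF _ M sub] by blast
  show thesis
  proof (rule that)
    show "e \<in> lmod_hom R M M"
      by (rule lmod_hom_from_submodule_codomain[OF e(1) submodule_subset[OF sub]])
    show "e x \<in> S" if "x \<in> carrier M" for x using lmod_hom_closed[OF e(1) that] by simp
    show "e x = x" if "x \<in> S" for x using e that by blast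
  qed
qed

text \<open>The classical socle, the sum of all simple submodules, described without simple modules
  as the largest semisimple submodule.\<close>

definition socle :: "('r, 'x) ring_scheme \<Rightarrow> ('r, 'm) module \<Rightarrow> 'm set" where
  "socle R M = \<Union>{W. semisimple_interval R M {\<zero>\<^bsub>M\<^esub>} W}"

text \<open>The union is closed under addition because the sum of two semisimple submodules is
  semisimple. A proper \<open>P\<close> misses an element of the socle, hence some semisimple
  \<open>W\<close>, so \<open>semisimple_interval_sum\<close> applies a second time to the whole
  union.\<close>

lemma semisimple_socle:
  assumes M: "left_module R M"
  shows "semisimple_interval R M {\<zero>\<^bsub>M\<^esub>} (socle R M)"
proof -
  interpret M: left_module R M by fact
  have sum: "semisimple_interval R M {\<zero>\<^bsub>M\<^esub>} (A <+>\<^bsub>M\<^esub> B)"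
    if "semisimple_interval R M {\<zero>\<^bsub>M\<^esub>} A" "semisimple_interval R M {\<zero>\<^bsub>M\<^esub>} B" for A B
  proof -
    note A = semisimple_intervalD[OF that(1)] and B = semisimple_intervalD[OF that(2)]
    note up = M.set_add_upper[OF A(2) B(2)]
    show ?thesis
    proof (rule semisimple_interval_sum[OF M M.zero_submodule M.submodule_set_add[OF A(2) B(2)]])
      show "{\<zero>\<^bsub>M\<^esub>} \<subseteq> A <+>\<^bsub>M\<^esub> B" using up A by blast
      fix P assume P: "submodule P R M" "P \<subset> A <+>\<^bsub>M\<^esub> B"
      then have "\<not> (A \<subseteq> P \<and> B \<subseteq> P)" using set_add_least[OF P(1)] by blast
      then show "\<exists>W\<subseteq>A <+>\<^bsub>M\<^esub> B. semisimple_interval R M {\<zero>\<^bsub>M\<^esub>} W \<and> \<not> W \<subseteq> P"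
        using up that by blast
    qed
  qed
  have sub: "submodule (socle R M) R M"
  proof (rule M.submoduleI)
    show "socle R M \<subseteq> carrier M"
      unfolding socle_def using semisimple_intervalD(2) submodule_subset by blast
    show "\<zero>\<^bsub>M\<^esub> \<in> socle R M"
      unfolding socle_def using semisimple_interval_zero[OF M] by blast
    fix x y assume "x \<in> socle R M" "y \<in> socle R M"
    then obtain A B where "semisimple_interval R M {\<zero>\<^bsub>M\<^esub>} A" "semisimple_interval R M {\<zero>\<^bsub>M\<^esub>} B"
      "x \<in> A" "y \<in> B" unfolding socle_def by blast
    then show "x \<oplus>\<^bsub>M\<^esub> y \<in> socle R M"
      unfolding socle_def using sum set_addI[of x A y B M] by blast
  next
    fix a x assume "a \<in> carrier R" "x \<in> socle R M"
    moreover then obtain A where "semisimple_interval R M {\<zero>\<^bsub>M\<^esub>} A" "x \<in> A" unfolding socle_def by blast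
    ultimately have "a \<odot>\<^bsub>M\<^esub> x \<in> A" "A \<subseteq> socle R M"
      using submodule_smult[OF semisimple_intervalD(2)] by (auto simp: socle_def)
    then show "a \<odot>\<^bsub>M\<^esub> x \<in> socle R M" by blast
  qed
  show ?thesis
  proof (rule semisimple_interval_sum[OF M M.zero_submodule sub])
    show "{\<zero>\<^bsub>M\<^esub>} \<subseteq> socle R M" using submodule_zero[OF sub] by blast
    fix P assume "P \<subset> socle R M"
    then obtain x where "x \<in> socle R M" "x \<notin> P" by blast
    then show "\<exists>W\<subseteq>socle R M. semisimple_interval R M {\<zero>\<^bsub>M\<^esub>} W \<and> \<not> W \<subseteq> P"
      unfolding socle_def by blast
  qed
qed

lemma socle_upper: "semisimple_interval R M {\<zero>\<^bsub>M\<^esub>} W \<Longrightarrow> W \<subseteq> socle R M"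
  by (auto simp: socle_def)

section \<open>The lattice of hereditary torsion theories\<close>

definition torsion_pair_of :: "('r, 'x) ring_scheme \<Rightarrow> ('r, 'u) module set \<Rightarrow> ('r, 'u) torsion_pair" where
  "torsion_pair_of R T = (T, {N. left_module R N \<and> (\<forall>M\<in>T. hom_orthogonal R M N)})"

lemma R_tors_carrier [simp]: "\<tau> \<in> carrier (R_tors R) \<longleftrightarrow> hereditary_torsion_theory R \<tau>"
  and R_tors_le [simp]: "\<sigma> \<sqsubseteq>\<^bsub>R_tors R\<^esub> \<tau> \<longleftrightarrow> fst \<sigma> \<subseteq> fst \<tau>"
  by (simp_all add: R_tors_def)

text \<open>The order of \<open>R_tors\<close> compares torsion classes only; antisymmetry, and with
  it uniqueness of least elements, rests on this.\<close>

lemma torsion_theory_eq: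
  assumes "torsion_theory R \<tau>"
  shows "\<tau> = torsion_pair_of R (fst \<tau>)"
proof (rule prod_eqI)
  show "snd \<tau> = snd (torsion_pair_of R (fst \<tau>))"
    using assms unfolding torsion_theory_def torsion_pair_of_def snd_conv by blast
qed (simp add: torsion_pair_of_def)

lemma torsion_theoryD:
  assumes "torsion_theory R \<tau>"
  shows "T \<in> fst \<tau> \<Longrightarrow> left_module R T"
    and "F \<in> snd \<tau> \<Longrightarrow> left_module R F"
    and "\<lbrakk>T \<in> fst \<tau>; F \<in> snd \<tau>\<rbrakk> \<Longrightarrow> hom_orthogonal R T F"
    and "\<lbrakk>left_module R M; \<And>F. F \<in> snd \<tau> \<Longrightarrow> hom_orthogonal R M F\<rbrakk> \<Longrightarrow> M \<in> fst \<tau>"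
  using assms unfolding torsion_theory_def by blast+

text \<open>Serves as the witness that the torsion class and the torsion-free class are
  nonempty.\<close>

definition trivial_module :: "'u \<Rightarrow> ('r, 'u) module" where
  "trivial_module u = \<lparr>carrier = {u}, monoid.mult = undefined, monoid.one = undefined,
     ring.zero = u, ring.add = (\<lambda>_ _. u), smult = (\<lambda>_ _. u)\<rparr>"

lemma trivial_left_module:
  assumes "ring R"
  shows "left_module R (trivial_module u)"
proof -
  have "abelian_group (trivial_module u)"
    by (rule abelian_groupI) (auto simp: trivial_module_def)
  then show ?thesis
    using assms by (auto simp: left_module_def left_module_axioms_def trivial_module_def)
qed

lemma hom_orthogonal_trivial:
  assumes "ring R"
  shows "hom_orthogonal R (M :: ('r, 'm) module) (trivial_module u)"
    and "left_module R N \<Longrightarrow> hom_orthogonal R (trivial_module u) N"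
proof -
  show "hom_orthogonal R M (trivial_module u)"
    by (auto simp: hom_orthogonal_def lmod_hom_def trivial_module_def)
  assume "left_module R N"
  then show "hom_orthogonal R (trivial_module u) N"
    using lmod_hom_zero[OF trivial_left_module[OF assms]]
    by (fastforce simp: hom_orthogonal_def trivial_module_def)
qed

text \<open>The hypothesis \<open>orth\<close> says that \<open>T\<close> is its own double
  orthogonal. With the torsion-free class taken as the right orthogonal of \<open>T\<close>, both
  maximality conditions follow.\<close>

lemma hereditary_torsion_theoryI:
  fixes T :: "('r, 'u) module set"
  assumes R: "ring R" and ne: "T \<noteq> {}" and mod: "\<And>M. M \<in> T \<Longrightarrow> left_module R M"
    and orth: "\<And>M. \<lbrakk>left_module R M; \<And>N :: ('r, 'u) module. \<lbrakk>left_module R N; \<And>M. M \<in> T \<Longrightarrow> hom_orthogonal R M N\<rbrakk>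
      \<Longrightarrow> hom_orthogonal R M N\<rbrakk> \<Longrightarrow> M \<in> T"
    and sub: "\<And>M N. \<lbrakk>M \<in> T; submodule N R M\<rbrakk> \<Longrightarrow> M\<lparr>carrier := N\<rparr> \<in> T"
  shows "hereditary_torsion_theory R (torsion_pair_of R T)"
proof -
  have "trivial_module undefined \<in> snd (torsion_pair_of R T)"
    by (simp add: torsion_pair_of_def trivial_left_module[OF R] hom_orthogonal_trivial[OF R])
  then have "snd (torsion_pair_of R T) \<noteq> {}" by blast
  have max: "M \<in> T" if "left_module R M" "\<forall>F\<in>snd (torsion_pair_of R T). hom_orthogonal R M F" for M
  proof (rule orth[OF that(1)])
    fix N :: "('r, 'u) module"
    assume "left_module R N" "\<And>M. M \<in> T \<Longrightarrow> hom_orthogonal R M N"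
    then have "N \<in> snd (torsion_pair_of R T)" by (simp add: torsion_pair_of_def)
    then show "hom_orthogonal R M N" using that(2) by blast
  qed
  have fst: "fst (torsion_pair_of R T) = T"
    and snd: "N \<in> snd (torsion_pair_of R T) \<longleftrightarrow> left_module R N \<and> (\<forall>M\<in>T. hom_orthogonal R M N)" for N
    by (simp_all add: torsion_pair_of_def)
  show ?thesis
    unfolding hereditary_torsion_theory_def torsion_theory_def fst
  proof (intro conjI ballI allI impI)
    show "T \<noteq> {}" "snd (torsion_pair_of R T) \<noteq> {}" by fact+
    show "M \<in> T" if "left_module R M \<and> (\<forall>F\<in>snd (torsion_pair_of R T). hom_orthogonal R M F)" for M
      using that max by blast
    show "N \<in> snd (torsion_pair_of R T)" if "left_module R N \<and> (\<forall>M\<in>T. hom_orthogonal R M N)" for N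
      using that snd by blast
  qed (use mod sub snd in \<open>blast+\<close>)
qed

lemma torsion_theory_trivial:
  assumes "ring R" "torsion_theory R \<tau>"
  shows "trivial_module u \<in> fst \<tau>"
proof -
  have "hom_orthogonal R (trivial_module u) F" if "F \<in> snd \<tau>" for F
    by (rule hom_orthogonal_trivial(2)[OF assms(1) torsion_theoryD(2)[OF assms(2) that]])
  then show ?thesis
    by (rule torsion_theoryD(4)[OF assms(2) trivial_left_module[OF assms(1)]])
qed

text \<open>Shrinking the torsion class enlarges its right orthogonal, so each
  \<open>snd \<tau>\<close> lies in the orthogonal of the intersection. A module left orthogonal to
  the latter is thus orthogonal to every \<open>snd \<tau>\<close>, hence torsion for every
  \<open>\<tau>\<close>.\<close>

lemma hereditary_torsion_theory_Inter:
  fixes A :: "('r, 'u) torsion_pair set"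
  assumes R: "ring R" and ne: "A \<noteq> {}" and A: "\<And>\<tau>. \<tau> \<in> A \<Longrightarrow> hereditary_torsion_theory R \<tau>"
  shows "hereditary_torsion_theory R (torsion_pair_of R (\<Inter>\<tau>\<in>A. fst \<tau>))"
proof (rule hereditary_torsion_theoryI[OF R])
  have A': "torsion_theory R \<tau>" if "\<tau> \<in> A" for \<tau>
    using A[OF that] by (simp add: hereditary_torsion_theory_def)
  have "trivial_module undefined \<in> (\<Inter>\<tau>\<in>A. fst \<tau>)" using torsion_theory_trivial[OF R A'] by auto
  then show "(\<Inter>\<tau>\<in>A. fst \<tau>) \<noteq> {}" by blast
  obtain \<tau>\<^sub>0 where \<tau>0: "\<tau>\<^sub>0 \<in> A" using ne by blast
  show "left_module R M" if "M \<in> (\<Inter>\<tau>\<in>A. fst \<tau>)" for M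
    using that \<tau>0 torsion_theoryD(1)[OF A'[OF \<tau>0]] by blast
  show "M\<lparr>carrier := N\<rparr> \<in> (\<Inter>\<tau>\<in>A. fst \<tau>)" if "M \<in> (\<Inter>\<tau>\<in>A. fst \<tau>)" "submodule N R M" for M N
    using that A by (simp add: hereditary_torsion_theory_def)
  fix M :: "('r, 'u) module"
  assume M: "left_module R M"
    and o: "\<And>N :: ('r, 'u) module. \<lbrakk>left_module R N; \<And>M. M \<in> (\<Inter>\<tau>\<in>A. fst \<tau>) \<Longrightarrow> hom_orthogonal R M N\<rbrakk>
      \<Longrightarrow> hom_orthogonal R M N"
  show "M \<in> (\<Inter>\<tau>\<in>A. fst \<tau>)"
  proof
    fix \<tau> assume \<tau>: "\<tau> \<in> A"
    have "hom_orthogonal R M N" if N: "N \<in> snd \<tau>" for N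
    proof (rule o)
      show "left_module R N" by (rule torsion_theoryD(2)[OF A'[OF \<tau>] N])
      show "hom_orthogonal R M' N" if "M' \<in> (\<Inter>\<tau>\<in>A. fst \<tau>)" for M'
      proof -
        have "M' \<in> fst \<tau>" using that \<tau> by simp
        then show ?thesis by (rule torsion_theoryD(3)[OF A'[OF \<tau>] _ N])
      qed
    qed
    then show "M \<in> fst \<tau>" by (rule torsion_theoryD(4)[OF A'[OF \<tau>] M])
  qed
qed

text \<open>The least element is the intersection of the torsion classes. Uniqueness is included
  because \<open>xi\<close> is a definite description.\<close>

lemma R_tors_least_exists:
  fixes A :: "('r, 'u) torsion_pair set"
  assumes R: "ring R" and ne: "A \<noteq> {}" and A: "A \<subseteq> carrier (R_tors R)"
    and Inter: "\<And>\<rho>. \<lbrakk>hereditary_torsion_theory R \<rho>; fst \<rho> = (\<Inter>\<tau>\<in>A. fst \<tau>)\<rbrakk> \<Longrightarrow> \<rho> \<in> A"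
  shows "\<exists>!\<tau>. least (R_tors R) \<tau> A"
proof (rule ex_ex1I)
  let ?\<rho> = "torsion_pair_of R (\<Inter>\<tau>\<in>A. fst \<tau>)"
  have "hereditary_torsion_theory R ?\<rho>"
    using A by (intro hereditary_torsion_theory_Inter[OF R ne]) auto
  then have "?\<rho> \<in> A" by (rule Inter) (simp add: torsion_pair_of_def)
  then have "least (R_tors R) ?\<rho> A"
    using A unfolding least_def by (auto simp: torsion_pair_of_def)
  then show "\<exists>\<tau>. least (R_tors R) \<tau> A" by blast
  fix \<sigma> \<tau> assume "least (R_tors R) \<sigma> A" "least (R_tors R) \<tau> A"
  then have "fst \<sigma> = fst \<tau>" "torsion_theory R \<sigma>" "torsion_theory R \<tau>"
    using A unfolding least_def by (auto simp: hereditary_torsion_theory_def)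
  then show "\<sigma> = \<tau>" using torsion_theory_eq by metis
qed

text \<open>The bound \<open>\<sigma>\<close> makes the set of upper bounds nonempty, as the
  intersection argument demands. It will be the theory of semisimple modules.\<close>

lemma R_tors_sup_le:
  fixes A :: "('r, 'u) torsion_pair set"
  assumes R: "ring R" and A: "A \<subseteq> carrier (R_tors R)" and \<sigma>: "hereditary_torsion_theory R \<sigma>"
    and ub: "\<And>\<tau>. \<tau> \<in> A \<Longrightarrow> fst \<tau> \<subseteq> fst \<sigma>"
  shows "hereditary_torsion_theory R (\<Squnion>\<^bsub>R_tors R\<^esub> A)" "fst (\<Squnion>\<^bsub>R_tors R\<^esub> A) \<subseteq> fst \<sigma>"
proof -
  let ?U = "Upper (R_tors R) A"
  have \<sigma>U: "\<sigma> \<in> ?U" using \<sigma> ub by (simp add: Upper_def del: split_paired_All)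
  have "\<exists>!\<tau>. least (R_tors R) \<tau> ?U"
  proof (rule R_tors_least_exists[OF R])
    show "?U \<noteq> {}" using \<sigma>U by blast
    show "?U \<subseteq> carrier (R_tors R)" by (auto simp: Upper_def)
    fix \<rho> :: "('r, 'u) torsion_pair"
    assume "hereditary_torsion_theory R \<rho>" "fst \<rho> = (\<Inter>\<tau>\<in>?U. fst \<tau>)"
    then show "\<rho> \<in> ?U" by (auto simp: Upper_def)
  qed
  then have "least (R_tors R) (\<Squnion>\<^bsub>R_tors R\<^esub> A) ?U"
    unfolding sup_def by (metis someI_ex)
  then show "hereditary_torsion_theory R (\<Squnion>\<^bsub>R_tors R\<^esub> A)" "fst (\<Squnion>\<^bsub>R_tors R\<^esub> A) \<subseteq> fst \<sigma>"
    using \<sigma>U unfolding least_def by (auto simp: Upper_def simp del: split_paired_All)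
qed

lemma xi_le:
  fixes \<sigma> :: "('r, 'u) torsion_pair"
  assumes R: "ring R" and \<sigma>: "hereditary_torsion_theory R \<sigma>" and C: "C \<subseteq> fst \<sigma>"
  shows "hereditary_torsion_theory R (xi R C)" "fst (xi R C) \<subseteq> fst \<sigma>"
proof -
  let ?U = "{\<sigma> \<in> carrier (R_tors R). C \<subseteq> fst \<sigma>}"
  have \<sigma>U: "\<sigma> \<in> ?U" using C \<sigma> by auto
  have "\<exists>!\<tau>. least (R_tors R) \<tau> ?U"
  proof (rule R_tors_least_exists[OF R])
    show "?U \<noteq> {}" using \<sigma>U by blast
    fix \<rho> :: "('r, 'u) torsion_pair"
    assume "hereditary_torsion_theory R \<rho>" "fst \<rho> = (\<Inter>\<tau>\<in>?U. fst \<tau>)"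
    then show "\<rho> \<in> ?U" by auto
  qed auto
  then have "least (R_tors R) (xi R C) ?U"
    unfolding xi_def by (rule theI')
  then show "hereditary_torsion_theory R (xi R C)" "fst (xi R C) \<subseteq> fst \<sigma>"
    using \<sigma>U unfolding least_def by (auto simp del: split_paired_All)
qed

section \<open>Cosets, quotient modules and torsion quotients\<close>

lemma mem_a_r_coset:
  assumes "left_module R M" "submodule N R M" "x \<in> carrier M"
  shows "z \<in> N +>\<^bsub>M\<^esub> x \<longleftrightarrow> z \<in> carrier M \<and> z \<ominus>\<^bsub>M\<^esub> x \<in> N"
proof -
  interpret left_module R M by fact
  note [simp] = submodule_in_carrier[OF assms(2)]
  show ?thesis
  proof
    assume "z \<in> N +>\<^bsub>M\<^esub> x"
    then obtain n where n: "n \<in> N" "z = n \<oplus>\<^bsub>M\<^esub> x" by (auto simp: a_r_coset_def')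
    moreover have "(x \<oplus>\<^bsub>M\<^esub> n) \<ominus>\<^bsub>M\<^esub> x = n" using n assms(3) by (simp add: M.add_diff_cancel_left)
    ultimately show "z \<in> carrier M \<and> z \<ominus>\<^bsub>M\<^esub> x \<in> N" using assms(3) by (simp add: M.a_comm)
  next
    assume z: "z \<in> carrier M \<and> z \<ominus>\<^bsub>M\<^esub> x \<in> N"
    have "z = x \<oplus>\<^bsub>M\<^esub> (z \<ominus>\<^bsub>M\<^esub> x)" using z assms(3) by (simp add: M.add_diff_cancel)
    also have "\<dots> = (z \<ominus>\<^bsub>M\<^esub> x) \<oplus>\<^bsub>M\<^esub> x" using z assms(3) by (simp add: M.a_comm)
    finally show "z \<in> N +>\<^bsub>M\<^esub> x" using z unfolding a_r_coset_def' by blast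
  qed
qed

lemma (in abelian_group) diff_add_diff:
  assumes "x \<in> carrier G" "y \<in> carrier G" "z \<in> carrier G"
  shows "(x \<ominus> y) \<oplus> (y \<ominus> z) = x \<ominus> z"
proof -
  have "(x \<ominus> y) \<oplus> (y \<ominus> z) = (x \<oplus> \<ominus> z) \<oplus> (y \<oplus> \<ominus> y)"
    using assms by (simp add: a_minus_def a_ac)
  then show ?thesis using assms by (simp add: r_neg a_minus_def)
qed

lemma (in abelian_group) diff_zero:
  "x \<in> carrier G \<Longrightarrow> x \<ominus> \<zero> = x"
  using add_diff_cancel[of x \<zero>] by simp

lemma (in abelian_group) minus_diff:
  assumes "x \<in> carrier G" "y \<in> carrier G"
  shows "\<ominus> (x \<ominus> y) = y \<ominus> x"
  using assms by (simp add: a_minus_def minus_add a_comm)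

lemma a_r_coset_eq_iff:
  assumes "left_module R M" "submodule N R M" "x \<in> carrier M" "y \<in> carrier M"
  shows "N +>\<^bsub>M\<^esub> x = N +>\<^bsub>M\<^esub> y \<longleftrightarrow> x \<ominus>\<^bsub>M\<^esub> y \<in> N"
proof -
  interpret left_module R M by fact
  show ?thesis
  proof
    assume "N +>\<^bsub>M\<^esub> x = N +>\<^bsub>M\<^esub> y"
    moreover have "x \<in> N +>\<^bsub>M\<^esub> x"
      using assms by (simp add: mem_a_r_coset a_minus_def M.r_neg submodule_zero)
    ultimately have "x \<in> N +>\<^bsub>M\<^esub> y" by simp
    then show "x \<ominus>\<^bsub>M\<^esub> y \<in> N" by (simp add: mem_a_r_coset[OF assms(1,2,4)])
  next
    assume xy: "x \<ominus>\<^bsub>M\<^esub> y \<in> N"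
    then have yx: "y \<ominus>\<^bsub>M\<^esub> x \<in> N"
      using submodule_neg[OF assms(2) xy] assms by (simp add: M.minus_diff)
    have iff: "z \<ominus>\<^bsub>M\<^esub> x \<in> N \<longleftrightarrow> z \<ominus>\<^bsub>M\<^esub> y \<in> N" if "z \<in> carrier M" for z
      using submodule_add[OF assms(2) _ xy, of "z \<ominus>\<^bsub>M\<^esub> x"] submodule_add[OF assms(2) _ yx, of "z \<ominus>\<^bsub>M\<^esub> y"]
        that assms by (auto simp: M.diff_add_diff)
    then show "N +>\<^bsub>M\<^esub> x = N +>\<^bsub>M\<^esub> y" 
      using iff by (auto simp: mem_a_r_coset[OF assms(1,2,3)] mem_a_r_coset[OF assms(1,2,4)])
  qed
qed

lemma quotient_module_hom:
  assumes M: "left_module R M" and N: "submodule N R M"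
  shows "(\<lambda>x. N +>\<^bsub>M\<^esub> x) \<in> lmod_hom R M (quotient_module M N)"
proof -
  interpret left_module R M by fact
  interpret N: abelian_subgroup N M
    by (rule abelian_subgroupI3[OF _ M.abelian_group_axioms])
      (rule additive_subgroup.intro[OF submodule.axioms(1)[OF N]])
  show ?thesis
  proof (rule lmod_homI)
    fix x assume x: "x \<in> carrier M"
    then show "N +>\<^bsub>M\<^esub> x \<in> carrier (quotient_module M N)"
      by (auto simp: quotient_module_def A_RCOSETS_def')
    fix y assume "y \<in> carrier M"
    then show "N +>\<^bsub>M\<^esub> (x \<oplus>\<^bsub>M\<^esub> y) = (N +>\<^bsub>M\<^esub> x) \<oplus>\<^bsub>quotient_module M N\<^esub> (N +>\<^bsub>M\<^esub> y)"
      using x by (simp add: quotient_module_def N.a_rcos_sum)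
  next
    fix r x assume r: "r \<in> carrier R" and x: "x \<in> carrier M"
    \<comment> \<open>Scalar multiplication on the quotient is a union over all members of a coset;
      every member contributes the same coset.\<close>
    have "N +>\<^bsub>M\<^esub> (r \<odot>\<^bsub>M\<^esub> y) = N +>\<^bsub>M\<^esub> (r \<odot>\<^bsub>M\<^esub> x)" if "y \<in> N +>\<^bsub>M\<^esub> x" for y
    proof -
      have y: "y \<in> carrier M" "y \<ominus>\<^bsub>M\<^esub> x \<in> N" using that x by (simp_all add: mem_a_r_coset[OF M N])
      then have "r \<odot>\<^bsub>M\<^esub> y \<ominus>\<^bsub>M\<^esub> r \<odot>\<^bsub>M\<^esub> x \<in> N"
        using r x submodule_smult[OF N r y(2)] by (simp add: smult_r_diff)
      then show ?thesis using r x y by (simp add: a_r_coset_eq_iff[OF M N])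
    qed
    moreover have "x \<in> N +>\<^bsub>M\<^esub> x"
      using x by (simp add: mem_a_r_coset[OF M N] a_minus_def M.r_neg submodule_zero[OF N])
    ultimately have "(\<lambda>y. N +>\<^bsub>M\<^esub> (r \<odot>\<^bsub>M\<^esub> y)) ` (N +>\<^bsub>M\<^esub> x) = {N +>\<^bsub>M\<^esub> (r \<odot>\<^bsub>M\<^esub> x)}"
      by blast
    then show "N +>\<^bsub>M\<^esub> (r \<odot>\<^bsub>M\<^esub> x) = r \<odot>\<^bsub>quotient_module M N\<^esub> (N +>\<^bsub>M\<^esub> x)"
      by (simp add: quotient_module_def)
  qed
qed

text \<open>A quotient module has sets as elements, and \<open>torsion\<close> only provides an
  isomorphic copy \<open>T\<close> on \<open>'u\<close>. Composing the coset map with that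
  isomorphism replaces the quotient by a homomorphism from \<open>M\<close> onto \<open>T\<close>
  with kernel \<open>N\<close>.\<close>

lemma torsion_quotient_hom:
  fixes \<tau> :: "('r, 'u) torsion_pair"
  assumes M: "left_module R M" and N: "submodule N R M" and \<tau>: "torsion_theory R \<tau>"
    and tor: "torsion R \<tau> (quotient_module M N)"
  obtains T h where "T \<in> fst \<tau>" "h \<in> lmod_hom R M T" "\<And>t. t \<in> carrier T \<Longrightarrow> \<exists>x\<in>carrier M. t = h x"
    "\<And>x. x \<in> carrier M \<Longrightarrow> h x = \<zero>\<^bsub>T\<^esub> \<longleftrightarrow> x \<in> N"
proof -
  interpret left_module R M by fact
  from tor obtain T f where T: "T \<in> fst \<tau>" and quot: "left_module R (quotient_module M N)"
    and f: "f \<in> lmod_hom R (quotient_module M N) T"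
    and bij: "bij_betw f (carrier (quotient_module M N)) (carrier T)"
    unfolding torsion_def lmod_isomorphic_def by blast
  have Tm: "left_module R T" by (rule torsion_theoryD(1)[OF \<tau> T])
  have car: "carrier (quotient_module M N) = (\<lambda>x. N +>\<^bsub>M\<^esub> x) ` carrier M"
    by (auto simp: quotient_module_def A_RCOSETS_def')
  have zero: "\<zero>\<^bsub>quotient_module M N\<^esub> = N +>\<^bsub>M\<^esub> \<zero>\<^bsub>M\<^esub>"
    using lmod_hom_zero[OF M quot quotient_module_hom[OF M N]] by simp
  show thesis
  proof (rule that[OF T])
    show "(\<lambda>x. f (N +>\<^bsub>M\<^esub> x)) \<in> lmod_hom R M T"
      by (rule lmod_hom_comp[OF quotient_module_hom[OF M N] f])
    fix t assume "t \<in> carrier T"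
    then show "\<exists>x\<in>carrier M. t = f (N +>\<^bsub>M\<^esub> x)"
      using bij_betw_imp_surj_on[OF bij] car by auto
  next
    fix x assume x: "x \<in> carrier M"
    have "f (N +>\<^bsub>M\<^esub> x) = \<zero>\<^bsub>T\<^esub> \<longleftrightarrow> f (N +>\<^bsub>M\<^esub> x) = f (N +>\<^bsub>M\<^esub> \<zero>\<^bsub>M\<^esub>)"
      using lmod_hom_zero[OF quot Tm f] zero by simp
    also have "\<dots> \<longleftrightarrow> N +>\<^bsub>M\<^esub> x = N +>\<^bsub>M\<^esub> \<zero>\<^bsub>M\<^esub>"
      using bij_betw_imp_inj_on[OF bij] x car by (intro inj_on_eq_iff) auto
    also have "\<dots> \<longleftrightarrow> x \<in> N" using x by (simp add: a_r_coset_eq_iff[OF M N] M.diff_zero)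
    finally show "f (N +>\<^bsub>M\<^esub> x) = \<zero>\<^bsub>T\<^esub> \<longleftrightarrow> x \<in> N" .
  qed
qed

section \<open>The first step of the Gabriel filtration\<close>

definition semisimple_torsion :: "('r, 'x) ring_scheme \<Rightarrow> ('r, 'u) torsion_pair" where
  "semisimple_torsion R = torsion_pair_of R {M. left_module R M \<and> semisimple_module R M}"

lemma fst_semisimple_torsion:
  "fst (semisimple_torsion R) = {M. left_module R M \<and> semisimple_module R M}"
  by (simp add: semisimple_torsion_def torsion_pair_of_def)

lemma semisimple_trivial:
  assumes "left_module R M" "carrier M = {\<zero>\<^bsub>M\<^esub>}"
  shows "semisimple_module R M"
  using semisimple_interval_zero[OF assms(1)] by (simp add: assms(2))

text \<open>
  The semisimple modules are closed under extensions because the socle is injective and therefore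
  a direct summand with socle-free complement.
\<close>

lemma semisimple_torsion_hereditary:
  fixes R :: "('r, 'x) ring_scheme"
  assumes QI: "left_QI_ring TYPE('u) R"
  shows "hereditary_torsion_theory R (semisimple_torsion R :: ('r, 'u) torsion_pair)"
  unfolding semisimple_torsion_def
proof (rule hereditary_torsion_theoryI)
  let ?T = "{M :: ('r, 'u) module. left_module R M \<and> semisimple_module R M}"
  show R: "ring R" using QI by (simp add: left_QI_ring_def)
  have "semisimple_module R (trivial_module undefined :: ('r, 'u) module)"
    by (rule semisimple_trivial[OF trivial_left_module[OF R]]) (simp add: trivial_module_def)
  then have "trivial_module undefined \<in> ?T" by (simp add: trivial_left_module[OF R])
  then show "?T \<noteq> {}" by blast
  show "left_module R M" if "M \<in> ?T" for M using that by simp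
  show "M\<lparr>carrier := N\<rparr> \<in> ?T" if "M \<in> ?T" "submodule N R M" for M N
    using that semisimple_submodule left_module.submodule_module by fastforce
  fix M :: "('r, 'u) module"
  assume M: "left_module R M"
    and o: "\<And>N :: ('r, 'u) module. \<lbrakk>left_module R N; \<And>M. M \<in> ?T \<Longrightarrow> hom_orthogonal R M N\<rbrakk> \<Longrightarrow> hom_orthogonal R M N"
  interpret left_module R M by fact
  note soc = semisimple_socle[OF M]
  obtain e where e: "e \<in> lmod_hom R M M" "\<And>x. x \<in> carrier M \<Longrightarrow> e x \<in> socle R M"
    "\<And>x. x \<in> socle R M \<Longrightarrow> e x = x" by (rule QI_semisimple_retract[OF QI M soc]) blast
  note socD = semisimple_intervalD(2)[OF soc]
  \<comment> \<open>The complement of the socle cut out by the retraction \<open>e\<close>.\<close>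
  let ?K = "{x \<in> carrier M. e x \<in> {\<zero>\<^bsub>M\<^esub>}}"
  let ?M' = "M\<lparr>carrier := ?K\<rparr>"
  have K: "submodule ?K R M" by (rule submodule_preimage[OF M M e(1) zero_submodule])
  have M': "left_module R ?M'" by (rule submodule_module[OF K])
  \<comment> \<open>The image in \<open>M\<close> of a semisimple module lies in the socle, where
    \<open>e\<close> is the identity; inside \<open>?K\<close> it is also killed by
    \<open>e\<close>. So \<open>?M'\<close> is right orthogonal to all semisimple modules, and
    therefore to \<open>M\<close>.\<close>
  have "hom_orthogonal R M ?M'"
  proof (rule o[OF M'])
    fix T assume T: "T \<in> ?T"
    show "hom_orthogonal R T ?M'"
      unfolding hom_orthogonal_def
    proof (intro ballI)
      fix h x assume h: "h \<in> lmod_hom R T ?M'" and x: "x \<in> carrier T"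
      have hM: "h \<in> lmod_hom R T M"
        by (rule lmod_hom_from_submodule_codomain[OF h]) auto
      have "semisimple_interval R M {\<zero>\<^bsub>M\<^esub>} (h ` carrier T)"
        using T lmod_hom_zero[OF _ M hM] by (intro semisimple_image[OF _ M hM]) auto
      then have "h x \<in> socle R M" using socle_upper x by blast
      then have "e (h x) = h x" using e by blast
      moreover have "h x \<in> ?K" using lmod_hom_closed[OF h x] by simp
      ultimately show "h x = \<zero>\<^bsub>?M'\<^esub>" by simp
    qed
  qed
  \<comment> \<open>The projection of \<open>M\<close> onto the complement must then vanish, which
    leaves \<open>M\<close> equal to its socle.\<close>
  moreover have "(\<lambda>x. x \<ominus>\<^bsub>M\<^esub> e x) \<in> lmod_hom R M ?M'"
  proof (rule lmod_homI)
    fix x assume x: "x \<in> carrier M"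
    have ex: "e x \<in> carrier M" using lmod_hom_closed[OF e(1) x] .
    have "e (x \<ominus>\<^bsub>M\<^esub> e x) = e x \<ominus>\<^bsub>M\<^esub> e x"
      using e(3)[OF e(2)[OF x]] by (simp add: lmod_hom_diff[OF M M e(1) x ex])
    then show "x \<ominus>\<^bsub>M\<^esub> e x \<in> carrier ?M'"
      using x ex by (simp add: a_minus_def M.r_neg)
    fix y assume y: "y \<in> carrier M"
    then show "x \<oplus>\<^bsub>M\<^esub> y \<ominus>\<^bsub>M\<^esub> e (x \<oplus>\<^bsub>M\<^esub> y) = (x \<ominus>\<^bsub>M\<^esub> e x) \<oplus>\<^bsub>?M'\<^esub> (y \<ominus>\<^bsub>M\<^esub> e y)"
      using x ex lmod_hom_closed[OF e(1) y]
      by (simp add: lmod_hom_add[OF e(1)] a_minus_def M.minus_add M.a_ac)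
  next
    fix r x assume "r \<in> carrier R" and x: "x \<in> carrier M"
    then show "r \<odot>\<^bsub>M\<^esub> x \<ominus>\<^bsub>M\<^esub> e (r \<odot>\<^bsub>M\<^esub> x) = r \<odot>\<^bsub>?M'\<^esub> (x \<ominus>\<^bsub>M\<^esub> e x)"
      using lmod_hom_closed[OF e(1) x] by (simp add: lmod_hom_smult[OF e(1)] smult_r_diff)
  qed
  ultimately have diff: "x \<ominus>\<^bsub>M\<^esub> e x = \<zero>\<^bsub>M\<^esub>" if "x \<in> carrier M" for x
    using that unfolding hom_orthogonal_def by fastforce
  have "x \<in> socle R M" if x: "x \<in> carrier M" for x
  proof -
    have "e x = x" using M.add_diff_cancel[of x "e x"] diff[OF x] x lmod_hom_closed[OF e(1) x] by simp
    then show ?thesis using e(2)[OF x] by simp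
  qed
  then have "socle R M = carrier M" using submodule_subset[OF socD] by blast
  then show "M \<in> ?T" using soc M by simp
qed

section \<open>The bottom of the filtration and its first step\<close>

definition trivial_torsion :: "('r, 'x) ring_scheme \<Rightarrow> ('r, 'u) torsion_pair" where
  "trivial_torsion R = torsion_pair_of R {M. left_module R M \<and> carrier M = {\<zero>\<^bsub>M\<^esub>}}"

text \<open>Zero modules are left orthogonal to everything, in particular to \<open>M\<close>; the
  double orthogonality condition then applies to the identity of \<open>M\<close> and forces
  \<open>M\<close> to be zero.\<close>

lemma trivial_torsion_hereditary:
  fixes R :: "('r, 'x) ring_scheme"
  assumes R: "ring R"
  shows "hereditary_torsion_theory R (trivial_torsion R :: ('r, 'u) torsion_pair)"
  unfolding trivial_torsion_def
proof (rule hereditary_torsion_theoryI[OF R])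
  let ?T = "{M :: ('r, 'u) module. left_module R M \<and> carrier M = {\<zero>\<^bsub>M\<^esub>}}"
  have "carrier (trivial_module undefined :: ('r, 'u) module) = {\<zero>\<^bsub>trivial_module undefined :: ('r, 'u) module\<^esub>}"
    by (simp add: trivial_module_def)
  then have "trivial_module undefined \<in> ?T" by (simp add: trivial_left_module[OF R])
  then show "?T \<noteq> {}" by blast
  show "left_module R M" if "M \<in> ?T" for M using that by simp
  show "M\<lparr>carrier := N\<rparr> \<in> ?T" if "M \<in> ?T" "submodule N R M" for M N
    using that submodule_zero[OF that(2)] submodule_subset[OF that(2)]
    by (auto simp: left_module.submodule_module)
  fix M :: "('r, 'u) module"
  assume M: "left_module R M"
    and o: "\<And>N :: ('r, 'u) module. \<lbrakk>left_module R N; \<And>M. M \<in> ?T \<Longrightarrow> hom_orthogonal R M N\<rbrakk> \<Longrightarrow> hom_orthogonal R M N"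
  interpret left_module R M by fact
  have "hom_orthogonal R M M"
  proof (rule o[OF M])
    fix T assume T: "T \<in> ?T"
    then show "hom_orthogonal R T M"
      using lmod_hom_zero[OF _ M, of T] by (auto simp: hom_orthogonal_def)
  qed
  moreover have "(\<lambda>x. x) \<in> lmod_hom R M M" by (auto simp: lmod_hom_def)
  ultimately have "carrier M = {\<zero>\<^bsub>M\<^esub>}" using zero_submodule submodule_subset
    unfolding hom_orthogonal_def by fastforce
  then show "M \<in> ?T" using M by simp
qed

lemma gabriel_filtration_zero:
  "(gabriel_filtration R (0::nat) :: ('r, 'u) torsion_pair) = \<bottom>\<^bsub>R_tors R\<^esub>"
  by (subst gabriel_filtration.simps) simp

lemma gabriel_filtration_one:
  "(gabriel_filtration R (1::nat) :: ('r, 'u) torsion_pair) =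
     \<bottom>\<^bsub>R_tors R\<^esub> \<squnion>\<^bsub>R_tors R\<^esub> \<Squnion>\<^bsub>R_tors R\<^esub> {xi R {N} | N :: ('r, 'u) module. cocritical R (\<bottom>\<^bsub>R_tors R\<^esub> :: ('r, 'u) torsion_pair) N}"
proof -
  have p: "is_predecessor (0::nat) 1" by (simp add: is_predecessor_def)
  have "\<not> (\<forall>j. (1::nat) \<le> j)" by (auto intro: exI[of _ 0])
  moreover have "\<exists>j. is_predecessor j (1::nat)" using p by blast
  ultimately show ?thesis
    unfolding gabriel_filtration.simps[of R "1::nat"] the_predecessor[OF p] gabriel_filtration_zero Let_def
    by (simp only: if_False if_True)
qed

lemma R_tors_bottom_le:
  fixes \<sigma> :: "('r, 'u) torsion_pair"
  assumes R: "ring R" and \<sigma>: "hereditary_torsion_theory R \<sigma>"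
  shows "hereditary_torsion_theory R (\<bottom>\<^bsub>R_tors R\<^esub> :: ('r, 'u) torsion_pair)"
    and "fst (\<bottom>\<^bsub>R_tors R\<^esub>) \<subseteq> fst \<sigma>"
proof -
  have "\<exists>!\<tau> :: ('r, 'u) torsion_pair. least (R_tors R) \<tau> (carrier (R_tors R))"
  proof (rule R_tors_least_exists[OF R])
    show "carrier (R_tors R :: ('r, 'u) torsion_pair gorder) \<noteq> {}"
      using trivial_torsion_hereditary[OF R] by (metis R_tors_carrier empty_iff)
  qed auto
  then have "least (R_tors R) (\<bottom>\<^bsub>R_tors R\<^esub> :: ('r, 'u) torsion_pair) (carrier (R_tors R))"
    unfolding bottom_def by (metis someI_ex)
  then show "hereditary_torsion_theory R (\<bottom>\<^bsub>R_tors R\<^esub> :: ('r, 'u) torsion_pair)"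
    and "fst (\<bottom>\<^bsub>R_tors R\<^esub>) \<subseteq> fst \<sigma>"
    using \<sigma> by (auto simp: least_def)
qed

text \<open>Only zero modules are torsion for the bottom theory, so a nonzero submodule has zero
  quotient and is everything. Cocritical modules at this level are thus simple or zero, and the two
  possible submodules complement each other.\<close>

lemma cocritical_bottom_semisimple:
  fixes R :: "('r, 'x) ring_scheme" and N :: "('r, 'u) module"
  assumes R: "ring R" and N: "cocritical R (\<bottom>\<^bsub>R_tors R\<^esub> :: ('r, 'u) torsion_pair) N"
  shows "left_module R N \<and> semisimple_module R N"
proof -
  have Nm: "left_module R N" using N by (simp add: cocritical_def torsion_free_def)
  interpret left_module R N by fact
  have triv_tors: "hereditary_torsion_theory R (trivial_torsion R :: ('r, 'u) torsion_pair)"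
    by (rule trivial_torsion_hereditary[OF R])
  have bot: "torsion_theory R (\<bottom>\<^bsub>R_tors R\<^esub> :: ('r, 'u) torsion_pair)"
    using R_tors_bottom_le(1)[OF R triv_tors] by (simp only: hereditary_torsion_theory_def)
  have triv: "P = {\<zero>\<^bsub>N\<^esub>} \<or> P = carrier N" if P: "submodule P R N" for P
  proof (cases "P = {\<zero>\<^bsub>N\<^esub>}")
    case False
    then have "torsion R (\<bottom>\<^bsub>R_tors R\<^esub> :: ('r, 'u) torsion_pair) (quotient_module N P)"
      using N P by (simp add: cocritical_def)
    then obtain T :: "('r, 'u) module" and h where T: "T \<in> fst (\<bottom>\<^bsub>R_tors R\<^esub>)" and h: "h \<in> lmod_hom R N T"
      and ker: "\<And>x. x \<in> carrier N \<Longrightarrow> h x = \<zero>\<^bsub>T\<^esub> \<longleftrightarrow> x \<in> P"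
      by (rule torsion_quotient_hom[OF Nm P bot]) blast
    have "carrier T = {\<zero>\<^bsub>T\<^esub>}"
      using T R_tors_bottom_le(2)[OF R triv_tors]
      by (auto simp: trivial_torsion_def torsion_pair_of_def)
    then have "carrier N \<subseteq> P" using ker lmod_hom_closed[OF h] by blast
    then show ?thesis using submodule_subset[OF P] by blast
  qed simp
  have "semisimple_module R N"
    unfolding semisimple_interval_def
  proof (intro conjI allI impI zero_submodule carrier_submodule)
    fix P assume "submodule P R N \<and> {\<zero>\<^bsub>N\<^esub>} \<subseteq> P \<and> P \<subseteq> carrier N"
    then have "submodule P R N" by blast
    from triv[OF this] show "\<exists>P'. submodule P' R N \<and> {\<zero>\<^bsub>N\<^esub>} \<subseteq> P' \<and> P' \<subseteq> carrier N \<and>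
        P \<inter> P' = {\<zero>\<^bsub>N\<^esub>} \<and> carrier N \<subseteq> P <+>\<^bsub>N\<^esub> P'"
    proof
      assume "P = {\<zero>\<^bsub>N\<^esub>}"
      then show ?thesis
        using set_add_upper(2)[OF zero_submodule carrier_submodule]
        by (intro exI[of _ "carrier N"]) (auto simp: carrier_submodule)
    next
      assume "P = carrier N"
      then show ?thesis
        using set_add_upper(1)[OF carrier_submodule zero_submodule]
        by (intro exI[of _ "{\<zero>\<^bsub>N\<^esub>}"]) (auto simp: zero_submodule)
    qed
  qed simp
  then show ?thesis using Nm by simp
qed

text \<open>The bottom theory and each \<open>xi R {N}\<close> with \<open>N\<close> cocritical lie
  below the hereditary theory of semisimple modules, and hence so does their join.\<close>

lemma gabriel_filtration_one_le:
  fixes R :: "('r, 'x) ring_scheme"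
  assumes QI: "left_QI_ring TYPE('u) R"
  defines "\<tau> \<equiv> gabriel_filtration R (1::nat) :: ('r, 'u) torsion_pair"
  shows "hereditary_torsion_theory R \<tau>"
    and "\<And>T. T \<in> fst \<tau> \<Longrightarrow> left_module R T \<and> semisimple_module R T"
proof -
  let ?\<sigma> = "semisimple_torsion R :: ('r, 'u) torsion_pair"
  have R: "ring R" using QI by (simp add: left_QI_ring_def)
  note \<sigma> = semisimple_torsion_hereditary[OF QI]
  let ?A = "{xi R {N} | N :: ('r, 'u) module. cocritical R (\<bottom>\<^bsub>R_tors R\<^esub> :: ('r, 'u) torsion_pair) N}"
  have xi: "hereditary_torsion_theory R (xi R {N}) \<and> fst (xi R {N}) \<subseteq> fst ?\<sigma>"
    if "cocritical R (\<bottom>\<^bsub>R_tors R\<^esub> :: ('r, 'u) torsion_pair) N" for N :: "('r, 'u) module"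
    using xi_le[OF R \<sigma>, of "{N}"] cocritical_bottom_semisimple[OF R that]
    by (simp add: fst_semisimple_torsion)
  have A: "?A \<subseteq> carrier (R_tors R)"
  proof
    fix \<rho> assume "\<rho> \<in> ?A"
    then obtain N where "\<rho> = xi R {N}" "cocritical R (\<bottom>\<^bsub>R_tors R\<^esub> :: ('r, 'u) torsion_pair) N" by blast
    then show "\<rho> \<in> carrier (R_tors R)" using xi by simp
  qed
  have A_le: "fst \<rho> \<subseteq> fst ?\<sigma>" if "\<rho> \<in> ?A" for \<rho>
  proof -
    from that obtain N where "\<rho> = xi R {N}" "cocritical R (\<bottom>\<^bsub>R_tors R\<^esub> :: ('r, 'u) torsion_pair) N" by blast
    then show ?thesis using xi by simp
  qed
  note sup = R_tors_sup_le[OF R A \<sigma> A_le]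
  have "hereditary_torsion_theory R \<tau> \<and> fst \<tau> \<subseteq> fst ?\<sigma>"
    unfolding \<tau>_def gabriel_filtration_one join_def
    using sup R_tors_bottom_le[OF R \<sigma>] by (intro conjI R_tors_sup_le[OF R _ \<sigma>]) auto
  then show "hereditary_torsion_theory R \<tau>"
    and "\<And>T. T \<in> fst \<tau> \<Longrightarrow> left_module R T \<and> semisimple_module R T"
    by (auto simp: fst_semisimple_torsion)
qed

text \<open>The homomorphism to \<open>T\<close> with kernel \<open>N\<close> pulls the
  semisimplicity of \<open>T\<close> back to the interval above \<open>N\<close>, so the quotient
  itself never has to be handled again.\<close>

lemma torsion_quotient_semisimple:
  fixes \<tau> :: "('r, 'u) torsion_pair"
  assumes M: "left_module R M" and N: "submodule N R M" and \<tau>: "torsion_theory R \<tau>"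
    and ss: "\<And>T. T \<in> fst \<tau> \<Longrightarrow> semisimple_module R T"
    and tor: "torsion R \<tau> (quotient_module M N)"
  shows "semisimple_interval R M N (carrier M)"
proof -
  obtain T h where T: "T \<in> fst \<tau>" and h: "h \<in> lmod_hom R M T"
    and ker: "\<And>x. x \<in> carrier M \<Longrightarrow> h x = \<zero>\<^bsub>T\<^esub> \<longleftrightarrow> x \<in> N"
    by (rule torsion_quotient_hom[OF M N \<tau> tor]) blast
  have Tm: "left_module R T" by (rule torsion_theoryD(1)[OF \<tau> T])
  have "{x \<in> carrier M. h x \<in> {\<zero>\<^bsub>T\<^esub>}} = N" using ker submodule_subset[OF N] by auto
  moreover have "{x \<in> carrier M. h x \<in> carrier T} = carrier M" using lmod_hom_closed[OF h] by auto
  ultimately show ?thesis using semisimple_interval_preimage[OF M Tm h ss[OF T]] by simp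
qed

text \<open>The inverse is a description over the carrier, so changing the carrier does not preserve
  it by definition; uniqueness of inverses does.\<close>

lemma (in left_module) a_inv_restrict:
  assumes N: "submodule N R M" and y: "y \<in> N"
  shows "\<ominus>\<^bsub>M\<lparr>carrier := N\<rparr>\<^esub> y = \<ominus>\<^bsub>M\<^esub> y"
proof -
  interpret N: left_module R "M\<lparr>carrier := N\<rparr>" by (rule submodule_module[OF N])
  show ?thesis
    using y submodule_neg[OF N y] submodule_in_carrier[OF N y]
    by (intro N.M.minus_equality) (auto simp: M.l_neg)
qed

lemma (in left_module) a_minus_restrict:
  assumes "submodule N R M" "y \<in> N"
  shows "x \<ominus>\<^bsub>M\<lparr>carrier := N\<rparr>\<^esub> y = x \<ominus>\<^bsub>M\<^esub> y"
  using a_inv_restrict[OF assms] by (simp add: a_minus_def)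

text \<open>I/D is semisimple, hence injective, so the projection of \<open>I\<close> onto it
  extends to R. The extension is determined by its value at \<open>\<one>\<close>, the class of some
  \<open>e\<close> in \<open>I\<close>, and R-linearity gives the formula. Injectivity concerns
  modules on \<open>'u\<close>, hence the copies of I/D and R below.\<close>

lemma QI_left_ideal_projection:
  fixes R :: "('r, 'x) ring_scheme"
  assumes QI: "left_QI_ring TYPE('u) R" and small: "Pow (carrier R) \<lesssim> (UNIV :: 'u set)"
    and left_ideal: "left_ideal I R" and DI: "semisimple_interval R (ideal_module R I) D I"
  shows "\<exists>e\<in>I. \<forall>i\<in>I. i \<ominus>\<^bsub>R\<^esub> i \<otimes>\<^bsub>R\<^esub> e \<in> D"
proof -
  have R: "ring R" using QI by (simp add: left_QI_ring_def)
  interpret R: ring R by fact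
  let ?P = "regular_module R"
  let ?I = "?P\<lparr>carrier := I\<rparr>"
  have ss: "semisimple_interval R ?I D (carrier ?I)" using DI by (simp add: ideal_module_def)
  have P: "left_module R ?P" by (rule regular_left_module[OF R])
  interpret P: left_module R ?P by fact
  have I: "submodule I R ?P" using left_ideal by (simp add: left_ideal_def)
  note DI' = semisimple_intervalD(1)[OF ss]
  then have D: "submodule D R ?P" and sub: "D \<subseteq> I" by (simp_all add: P.submodule_of_submodule[OF I])
  have IR: "i \<in> carrier R" if "i \<in> I" for i using submodule_in_carrier[OF I that] by simp
  have Im: "left_module R ?I" by (rule P.submodule_module[OF I])
  obtain j :: "'r set \<Rightarrow> 'u" where j: "inj_on j (Pow (carrier R))"
    using small by (auto simp: lepoll_def)
  \<comment> \<open>Codes the coset of \<open>i\<close> modulo \<open>D\<close>, so that the image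
    under \<open>c\<close> is I/D on \<open>'u\<close>.\<close>
  define c where "c i = j (D +>\<^bsub>?P\<^esub> i)" for i
  have "D +>\<^bsub>?P\<^esub> i \<in> Pow (carrier R)" if "i \<in> carrier R" for i
    using that mem_a_r_coset[OF P D, of i] by auto
  then have c_eq: "c x = c y \<longleftrightarrow> x \<ominus>\<^bsub>R\<^esub> y \<in> D" if "x \<in> carrier R" "y \<in> carrier R" for x y
    using that inj_on_eq_iff[OF j] a_r_coset_eq_iff[OF P D, of x y] by (simp add: c_def)
  interpret c: module_image R ?I c
  proof (rule module_image_of_kernel[OF Im DI'])
    fix x y assume "x \<in> carrier ?I" "y \<in> carrier ?I"
    then show "c x = c y \<longleftrightarrow> x \<ominus>\<^bsub>?I\<^esub> y \<in> D"
      by (simp add: c_eq IR P.a_minus_restrict[OF I])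
  qed
  let ?W = "image_module c ?I"
  note W = c.image_left_module
  have "c x = \<zero>\<^bsub>?W\<^esub>" if "x \<in> D" for x
    using that sub c_eq[of x "\<zero>\<^bsub>R\<^esub>"] IR by (auto simp: a_minus_def)
  then have "semisimple_module R ?W"
    using semisimple_image[OF Im W c.image_hom ss] by simp
  then have inj: "injective_module R ?W" by (rule QI_semisimple_injective[OF QI W])
  \<comment> \<open>The same injection \<open>j\<close>, applied to singletons, yields a copy of R
    on \<open>'u\<close>.\<close>
  define \<epsilon> where "\<epsilon> r = j {r}" for r
  have \<epsilon>: "inj_on \<epsilon> (carrier R)"
    unfolding \<epsilon>_def using inj_on_eq_iff[OF j] by (intro inj_onI) auto
  interpret e: module_image R ?P \<epsilon> by (rule module_image_of_inj[OF P]) (simp add: \<epsilon>)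
  let ?R' = "image_module \<epsilon> ?P"
  note R' = e.image_left_module
  have I': "submodule (\<epsilon> ` I) R ?R'" by (rule submodule_image[OF P R' e.image_hom I])
  define f where "f y = c (inv_into (carrier R) \<epsilon> y)" for y
  have f: "f (\<epsilon> i) = c i" if "i \<in> carrier R" for i
    using that by (simp add: f_def inv_into_f_f[OF \<epsilon>])
  have "f \<in> lmod_hom R (?R'\<lparr>carrier := \<epsilon> ` I\<rparr>) ?W"
  proof (rule lmod_homI)
    fix x assume x: "x \<in> carrier (?R'\<lparr>carrier := \<epsilon> ` I\<rparr>)"
    then show "f x \<in> carrier ?W" using f IR by auto
    fix y assume "y \<in> carrier (?R'\<lparr>carrier := \<epsilon> ` I\<rparr>)"
    then obtain i i' where *: "i \<in> I" "i' \<in> I" "x = \<epsilon> i" "y = \<epsilon> i'" using x by auto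
    then show "f (x \<oplus>\<^bsub>?R'\<lparr>carrier := \<epsilon> ` I\<rparr>\<^esub> y) = f x \<oplus>\<^bsub>?W\<^esub> f y"
      using e.image_add[of i i'] c.image_add[of i i'] by (simp add: f IR)
  next
    fix r x assume "r \<in> carrier R" "x \<in> carrier (?R'\<lparr>carrier := \<epsilon> ` I\<rparr>)"
    moreover then obtain i where "i \<in> I" "x = \<epsilon> i" by auto
    ultimately show "f (r \<odot>\<^bsub>?R'\<lparr>carrier := \<epsilon> ` I\<rparr>\<^esub> x) = r \<odot>\<^bsub>?W\<^esub> f x"
      using e.image_smult[of r i] c.image_smult[of r i] by (simp add: f IR)
  qed
  then obtain g where g: "g \<in> lmod_hom R ?R' ?W" "\<forall>x\<in>\<epsilon> ` I. g x = f x"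
    using injective_moduleD[OF inj R' I'] by blast
  have "g (\<epsilon> \<one>\<^bsub>R\<^esub>) \<in> c ` I" using lmod_hom_closed[OF g(1), of "\<epsilon> \<one>\<^bsub>R\<^esub>"] by simp
  then obtain e where e: "e \<in> I" "g (\<epsilon> \<one>\<^bsub>R\<^esub>) = c e" by blast
  have "i \<ominus>\<^bsub>R\<^esub> i \<otimes>\<^bsub>R\<^esub> e \<in> D" if i: "i \<in> I" for i
  proof -
    have "c i = g (i \<odot>\<^bsub>?R'\<^esub> \<epsilon> \<one>\<^bsub>R\<^esub>)"
      using e.image_smult[of i "\<one>\<^bsub>R\<^esub>"] g(2) i f by (simp add: IR)
    also have "\<dots> = i \<odot>\<^bsub>?W\<^esub> c e"
      using lmod_hom_smult[OF g(1), of i "\<epsilon> \<one>\<^bsub>R\<^esub>"] i e(2) by (simp add: IR)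
    also have "\<dots> = c (i \<otimes>\<^bsub>R\<^esub> e)" using c.image_smult[of i e] i e(1) by (simp add: IR)
    finally show ?thesis using c_eq i e(1) by (simp add: IR)
  qed
  then show ?thesis using e(1) by blast
qed

section \<open>Extension of scalars\<close>

definition restrict_scalars :: "('r \<Rightarrow> 'q) \<Rightarrow> ('q, 'm) module \<Rightarrow> ('r, 'm) module" where
  "restrict_scalars \<psi> X =
     \<lparr>carrier = carrier X, monoid.mult = undefined, monoid.one = undefined,
      ring.zero = \<zero>\<^bsub>X\<^esub>, ring.add = ring.add X, smult = (\<lambda>r. smult X (\<psi> r))\<rparr>"

lemma restrict_scalars_simps [simp]:
  "carrier (restrict_scalars \<psi> X) = carrier X"
  "\<zero>\<^bsub>restrict_scalars \<psi> X\<^esub> = \<zero>\<^bsub>X\<^esub>"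
  "x \<oplus>\<^bsub>restrict_scalars \<psi> X\<^esub> y = x \<oplus>\<^bsub>X\<^esub> y"
  "r \<odot>\<^bsub>restrict_scalars \<psi> X\<^esub> x = \<psi> r \<odot>\<^bsub>X\<^esub> x"
  by (simp_all add: restrict_scalars_def)

lemma restrict_scalars_a_minus [simp]: "x \<ominus>\<^bsub>restrict_scalars \<psi> X\<^esub> y = x \<ominus>\<^bsub>X\<^esub> y"
  by (simp add: a_minus_def a_inv_def m_inv_def)

lemma restrict_scalars_module:
  assumes "ring R" "\<psi> \<in> ring_hom R Q" "left_module Q X"
  shows "left_module R (restrict_scalars \<psi> X)"
proof -
  interpret X: left_module Q X by fact
  have "abelian_group (restrict_scalars \<psi> X)"
    by (rule abelian_groupI) (auto simp: X.M.a_ac intro!: bexI[of _ "\<ominus>\<^bsub>X\<^esub> _"] X.M.r_neg)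
  then show ?thesis
    using assms
    by (auto simp: left_module_def left_module_axioms_def ring_hom_closed ring_hom_add ring_hom_mult
        ring_hom_one X.smult_l_distr X.smult_r_distr X.smult_assoc)
qed

lemma restrict_scalars_hom:
  assumes "\<psi> \<in> ring_hom R Q" "f \<in> lmod_hom Q X Y"
  shows "f \<in> lmod_hom R (restrict_scalars \<psi> X) (restrict_scalars \<psi> Y)"
  using assms
  by (intro lmod_homI) (auto simp: lmod_hom_add lmod_hom_smult lmod_hom_closed ring_hom_closed)

text \<open>A formal sum is determined by the finite set of pairs of a basis element and its
  coefficient, and an infinite type has as many finite subsets as elements.\<close>

lemma free_Abelian_group_lepoll:
  fixes S :: "'a set"
  assumes inf: "infinite (UNIV :: 'u set)" and S: "S \<lesssim> (UNIV :: 'u set)"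
  shows "carrier (free_Abelian_group S) \<lesssim> (UNIV :: 'u set)"
proof -
  have "(UNIV :: int set) \<lesssim> (UNIV :: nat set)"
    using inj_to_nat[where 'a = int] by (auto simp: lepoll_def)
  also have "(UNIV :: nat set) \<lesssim> (UNIV :: 'u set)"
    using inf infinite_le_lepoll by blast
  finally have "S \<times> (UNIV :: int set) \<lesssim> (UNIV :: 'u set) \<times> (UNIV :: 'u set)"
    by (intro times_lepoll_mono S)
  also have "(UNIV :: 'u set) \<times> (UNIV :: 'u set) \<lesssim> (UNIV :: 'u set)"
    using card_of_Times_same_infinite[OF inf] eqpoll_iff_card_of_ordIso eqpoll_imp_lepoll by blast
  finally obtain g :: "'a \<times> int \<Rightarrow> 'u" where g: "inj_on g (S \<times> UNIV)" by (auto simp: lepoll_def)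
  define F where "F c = (\<lambda>x. g (x, Poly_Mapping.lookup c x)) ` Poly_Mapping.keys c" for c
  have "inj_on F (carrier (free_Abelian_group S))"
  proof (rule inj_onI)
    fix c d assume cd: "c \<in> carrier (free_Abelian_group S)" "d \<in> carrier (free_Abelian_group S)" "F c = F d"
    have sub: "Poly_Mapping.lookup d x = Poly_Mapping.lookup c x"
      if "F c = F d" "Poly_Mapping.keys c \<subseteq> S" "Poly_Mapping.keys d \<subseteq> S" "x \<in> Poly_Mapping.keys c" for c d x
    proof -
      have "g (x, Poly_Mapping.lookup c x) \<in> F d" using that by (auto simp: F_def)
      then obtain y where y: "y \<in> Poly_Mapping.keys d"
        "g (x, Poly_Mapping.lookup c x) = g (y, Poly_Mapping.lookup d y)" by (auto simp: F_def)
      then have "(x, Poly_Mapping.lookup c x) = (y, Poly_Mapping.lookup d y)"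
        using that by (intro inj_onD[OF g]) auto
      then show ?thesis by auto
    qed
    show "c = d"
    proof (rule poly_mapping_eqI)
      fix x show "Poly_Mapping.lookup c x = Poly_Mapping.lookup d x"
      proof (cases "x \<in> Poly_Mapping.keys c")
        case True
        then show ?thesis using sub[OF cd(3), of x] cd by simp
      next
        case False
        then show ?thesis
          using sub[OF cd(3)[symmetric], of x] cd by (cases "x \<in> Poly_Mapping.keys d") (simp_all add: in_keys_iff)
      qed
    qed
  qed
  moreover have "F ` carrier (free_Abelian_group S) \<subseteq> Fpow UNIV" by (auto simp: F_def Fpow_def)
  ultimately have "carrier (free_Abelian_group S) \<lesssim> Fpow (UNIV :: 'u set)" unfolding lepoll_def by blast
  also have "Fpow (UNIV :: 'u set) \<approx> (UNIV :: 'u set)" by (rule eqpoll_Fpow[OF inf])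
  finally show ?thesis .
qed

text \<open>
  \<open>emb\<close> witnesses that \<open>Q\<close> is small enough for \<open>Q \<otimes> M\<close> to have an isomorphic copy on \<open>'u\<close>.
\<close>

locale base_change =
  R: ring R + Q: ring Q for R :: "('r, 'x) ring_scheme" and Q :: "('q, 'y) ring_scheme" +
  fixes \<psi> :: "'r \<Rightarrow> 'q" and emb :: "'q \<Rightarrow> 'u"
  assumes \<psi>: "\<psi> \<in> ring_hom R Q"
    and infinite_universe: "infinite (UNIV :: 'u set)"
    and emb: "inj_on emb (carrier Q)"
begin

lemma \<psi>_simps [simp]:
  "r \<in> carrier R \<Longrightarrow> \<psi> r \<in> carrier Q"
  "\<psi> \<one>\<^bsub>R\<^esub> = \<one>\<^bsub>Q\<^esub>"
  using \<psi> by (auto simp: ring_hom_closed ring_hom_one)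

abbreviation frags :: "('r, 'u) module \<Rightarrow> ('q \<times> 'u \<Rightarrow>\<^sub>0 int) set" where
  "frags M \<equiv> carrier (free_Abelian_group (carrier Q \<times> carrier M))"

abbreviation rels :: "('r, 'u) module \<Rightarrow> ('q \<times> 'u \<Rightarrow>\<^sub>0 int) set" where
  "rels M \<equiv> tensor_relations R (pullback_right_module Q \<psi>) M"

lemma frags_closed [simp]:
  "0 \<in> frags M"
  "\<lbrakk>x \<in> frags M; y \<in> frags M\<rbrakk> \<Longrightarrow> x + y \<in> frags M"
  "\<lbrakk>x \<in> frags M; y \<in> frags M\<rbrakk> \<Longrightarrow> x - y \<in> frags M"
  "x \<in> frags M \<Longrightarrow> - x \<in> frags M"
  "\<lbrakk>q \<in> carrier Q; m \<in> carrier M\<rbrakk> \<Longrightarrow> frag_of (q, m) \<in> frags M"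
  using keys_add[of x y] keys_diff[of x y] by (auto simp: keys_minus)

lemma frags_subgroupI:
  assumes "H \<subseteq> frags M" "0 \<in> H" "\<And>x y. \<lbrakk>x \<in> H; y \<in> H\<rbrakk> \<Longrightarrow> x - y \<in> H"
  shows "subgroup H (free_Abelian_group (carrier Q \<times> carrier M))"
proof (rule group.subgroupI[OF group_free_Abelian_group])
  have neg: "- x \<in> H" if "x \<in> H" for x using assms(3)[OF assms(2) that] by simp
  show "inv\<^bsub>free_Abelian_group (carrier Q \<times> carrier M)\<^esub> x \<in> H" if "x \<in> H" for x
  proof -
    have "x \<in> frags M" using assms(1) that by blast
    then have "Poly_Mapping.keys x \<subseteq> carrier Q \<times> carrier M" by simp
    then show ?thesis using neg[OF that] by simp
  qed
  show "x \<otimes>\<^bsub>free_Abelian_group (carrier Q \<times> carrier M)\<^esub> y \<in> H" if "x \<in> H" "y \<in> H" for x y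
    using assms(3)[OF that(1) neg[OF that(2)]] by simp
qed (use assms in auto)

lemma frags_induct:
  assumes "c \<in> frags M" "P 0"
    and "\<And>x y. \<lbrakk>x \<in> frags M; y \<in> frags M; P x; P y\<rbrakk> \<Longrightarrow> P (x - y)"
    and "\<And>q m. \<lbrakk>q \<in> carrier Q; m \<in> carrier M\<rbrakk> \<Longrightarrow> P (frag_of (q, m))"
  shows "P c"
  using assms by (intro free_Abelian_group_induct[of c "carrier Q \<times> carrier M" P]) auto

text \<open>Left multiplication on the first tensor factor. It is additive in the formal sum, but
  additive in \<open>q\<close> only modulo \<open>rels\<close>.\<close>

definition scal :: "'q \<Rightarrow> ('q \<times> 'u \<Rightarrow>\<^sub>0 int) \<Rightarrow> ('q \<times> 'u \<Rightarrow>\<^sub>0 int)" where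
  "scal q = frag_extend (\<lambda>(a, m). frag_of (q \<otimes>\<^bsub>Q\<^esub> a, m))"

lemma scal_simps [simp]:
  "scal q 0 = 0" "scal q (x + y) = scal q x + scal q y" "scal q (x - y) = scal q x - scal q y"
  "scal q (frag_of (a, m)) = frag_of (q \<otimes>\<^bsub>Q\<^esub> a, m)"
  by (simp_all add: scal_def frag_extend_add frag_extend_diff)

lemma scal_closed [simp]:
  assumes "q \<in> carrier Q" "c \<in> frags M"
  shows "scal q c \<in> frags M"
  using assms(2) by (rule frags_induct) (use assms(1) in \<open>simp_all del: carrier_free_Abelian_group_iff\<close>)

section \<open>The relations defining the tensor product\<close>

context
  fixes M :: "('r, 'u) module"
  assumes M: "left_module R M"
begin

interpretation M: left_module R M by (rule M)

lemma rels_subgroup: "subgroup (rels M) (free_Abelian_group (carrier Q \<times> carrier M))"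
  unfolding tensor_relations_def pullback_right_module_def
  by (simp, rule group.generate_is_subgroup[OF group_free_Abelian_group])
    (auto simp del: carrier_free_Abelian_group_iff intro!: frags_closed)

lemma rels_closed:
  "0 \<in> rels M"
  "\<lbrakk>x \<in> rels M; y \<in> rels M\<rbrakk> \<Longrightarrow> x - y \<in> rels M"
  "\<lbrakk>x \<in> rels M; y \<in> rels M\<rbrakk> \<Longrightarrow> x + y \<in> rels M"
  and rels_in_frags: "x \<in> rels M \<Longrightarrow> x \<in> frags M"
proof -
  note s = rels_subgroup
  show f: "x \<in> frags M" if "x \<in> rels M" for x using subgroup.subset[OF s] that by blast
  show "0 \<in> rels M" using subgroup.one_closed[OF s] by simp
  show add: "x + y \<in> rels M" if "x \<in> rels M" "y \<in> rels M" for x y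
    using subgroup.m_closed[OF s that] by simp
  have "- y \<in> rels M" if "y \<in> rels M" for y
    using subgroup.m_inv_closed[OF s that] f[OF that] by simp
  then show "x - y \<in> rels M" if "x \<in> rels M" "y \<in> rels M" for x y
    using add[of x "- y"] that by simp
qed

lemma rels_gens:
  "\<lbrakk>a \<in> carrier Q; b \<in> carrier Q; m \<in> carrier M\<rbrakk>
    \<Longrightarrow> frag_of (a \<oplus>\<^bsub>Q\<^esub> b, m) - frag_of (a, m) - frag_of (b, m) \<in> rels M"
  "\<lbrakk>a \<in> carrier Q; m \<in> carrier M; n \<in> carrier M\<rbrakk>
    \<Longrightarrow> frag_of (a, m \<oplus>\<^bsub>M\<^esub> n) - frag_of (a, m) - frag_of (a, n) \<in> rels M"
  "\<lbrakk>r \<in> carrier R; a \<in> carrier Q; m \<in> carrier M\<rbrakk>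
    \<Longrightarrow> frag_of (a \<otimes>\<^bsub>Q\<^esub> \<psi> r, m) - frag_of (a, r \<odot>\<^bsub>M\<^esub> m) \<in> rels M"
  unfolding tensor_relations_def pullback_right_module_def
  by (simp; intro generate.incl UnI1 UnI2 CollectI; blast)+

lemma rels_least:
  assumes "H \<subseteq> frags M" "0 \<in> H" "\<And>x y. \<lbrakk>x \<in> H; y \<in> H\<rbrakk> \<Longrightarrow> x - y \<in> H"
    and "\<And>a b m. \<lbrakk>a \<in> carrier Q; b \<in> carrier Q; m \<in> carrier M\<rbrakk>
      \<Longrightarrow> frag_of (a \<oplus>\<^bsub>Q\<^esub> b, m) - frag_of (a, m) - frag_of (b, m) \<in> H"
    and "\<And>a m n. \<lbrakk>a \<in> carrier Q; m \<in> carrier M; n \<in> carrier M\<rbrakk>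
      \<Longrightarrow> frag_of (a, m \<oplus>\<^bsub>M\<^esub> n) - frag_of (a, m) - frag_of (a, n) \<in> H"
    and "\<And>r a m. \<lbrakk>r \<in> carrier R; a \<in> carrier Q; m \<in> carrier M\<rbrakk>
      \<Longrightarrow> frag_of (a \<otimes>\<^bsub>Q\<^esub> \<psi> r, m) - frag_of (a, r \<odot>\<^bsub>M\<^esub> m) \<in> H"
  shows "rels M \<subseteq> H"
  unfolding tensor_relations_def pullback_right_module_def
  by (simp, rule group.generate_subgroup_incl[OF group_free_Abelian_group _ frags_subgroupI[OF assms(1-3)]])
    (auto intro: assms(4-6))

text \<open>The action multiplies from the left, the balancing relation from the right.
  Distributivity and associativity in Q therefore carry each generating relation to one of the same
  kind.\<close>

lemma rels_scal:
  assumes q: "q \<in> carrier Q" and c: "c \<in> rels M"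
  shows "scal q c \<in> rels M"
proof -
  have "rels M \<subseteq> {c \<in> frags M. scal q c \<in> rels M}"
  proof (rule rels_least)
    fix a b m assume *: "a \<in> carrier Q" "b \<in> carrier Q" "m \<in> carrier M"
    then show "frag_of (a \<oplus>\<^bsub>Q\<^esub> b, m) - frag_of (a, m) - frag_of (b, m) \<in> {c \<in> frags M. scal q c \<in> rels M}"
      using rels_gens(1)[of "q \<otimes>\<^bsub>Q\<^esub> a" "q \<otimes>\<^bsub>Q\<^esub> b" m] q
      by (simp add: Q.r_distr del: carrier_free_Abelian_group_iff)
  next
    fix a m n assume *: "a \<in> carrier Q" "m \<in> carrier M" "n \<in> carrier M"
    then show "frag_of (a, m \<oplus>\<^bsub>M\<^esub> n) - frag_of (a, m) - frag_of (a, n) \<in> {c \<in> frags M. scal q c \<in> rels M}"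
      using rels_gens(2)[of "q \<otimes>\<^bsub>Q\<^esub> a" m n] q by (simp del: carrier_free_Abelian_group_iff)
  next
    fix r a m assume *: "r \<in> carrier R" "a \<in> carrier Q" "m \<in> carrier M"
    then show "frag_of (a \<otimes>\<^bsub>Q\<^esub> \<psi> r, m) - frag_of (a, r \<odot>\<^bsub>M\<^esub> m) \<in> {c \<in> frags M. scal q c \<in> rels M}"
      using rels_gens(3)[of r "q \<otimes>\<^bsub>Q\<^esub> a" m] q by (simp add: Q.m_assoc del: carrier_free_Abelian_group_iff)
  qed (auto simp: rels_closed simp del: carrier_free_Abelian_group_iff)
  then show ?thesis using c by blast
qed

end

text \<open>A code in \<open>'u\<close> for the class of a formal sum modulo \<open>rels\<close>.
  Its existence is a matter of cardinality, hence the choice operator; see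
  \<open>cl_eq_iff\<close>.\<close>

definition cl :: "('r, 'u) module \<Rightarrow> ('q \<times> 'u \<Rightarrow>\<^sub>0 int) \<Rightarrow> 'u" where
  "cl M = (SOME c. \<forall>x \<in> frags M. \<forall>y \<in> frags M. c x = c y \<longleftrightarrow> x - y \<in> rels M)"

definition formal_tensors :: "('r, 'u) module \<Rightarrow> ('q, 'q \<times> 'u \<Rightarrow>\<^sub>0 int) module" where
  "formal_tensors M = \<lparr>carrier = frags M, monoid.mult = undefined, monoid.one = undefined,
     ring.zero = 0, ring.add = (+), smult = scal\<rparr>"

lemma formal_tensors_simps [simp]:
  "carrier (formal_tensors M) = frags M"
  "\<zero>\<^bsub>formal_tensors M\<^esub> = 0"
  "x \<oplus>\<^bsub>formal_tensors M\<^esub> y = x + y"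
  "q \<odot>\<^bsub>formal_tensors M\<^esub> x = scal q x"
  by (simp_all add: formal_tensors_def)

text \<open>The module Q \<otimes> M. The carrier of \<open>tensor_product\<close> consists of sets
  of formal sums; this copy lies on \<open>'u\<close>, where the functor can be compared with
  \<open>M\<close> and projectivity can be tested.\<close>

definition tens :: "('r, 'u) module \<Rightarrow> ('q, 'u) module" where
  "tens M = image_module (cl M) (formal_tensors M)"

definition pure :: "('r, 'u) module \<Rightarrow> 'q \<Rightarrow> 'u \<Rightarrow> 'u" where
  "pure M q m = cl M (frag_of (q, m))"

section \<open>The coded tensor product and its universal property\<close>

context
  fixes M :: "('r, 'u) module"
  assumes M: "left_module R M"
begin

interpretation M: left_module R M by (rule M)

lemmas rels_closed' = rels_closed[OF M] and rels_gens' = rels_gens[OF M]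

text \<open>Formal sums embed into the infinite type \<open>'u\<close>; choosing a representative of
  each class first makes the code depend on the class alone.\<close>

lemma cl_eq_iff:
  assumes "x \<in> frags M" "y \<in> frags M"
  shows "cl M x = cl M y \<longleftrightarrow> x - y \<in> rels M"
proof -
  have "carrier Q \<times> carrier M \<lesssim> (UNIV :: 'u set) \<times> (UNIV :: 'u set)"
    using emb by (intro times_lepoll_mono subset_imp_lepoll) (auto simp: lepoll_def)
  also have "(UNIV :: 'u set) \<times> (UNIV :: 'u set) \<lesssim> (UNIV :: 'u set)"
    using card_of_Times_same_infinite[OF infinite_universe] eqpoll_iff_card_of_ordIso eqpoll_imp_lepoll
    by blast
  finally obtain \<iota> :: "('q \<times> 'u \<Rightarrow>\<^sub>0 int) \<Rightarrow> 'u" where \<iota>: "inj_on \<iota> (frags M)"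
    using free_Abelian_group_lepoll[OF infinite_universe] unfolding lepoll_def by meson
  \<comment> \<open>For congruent \<open>x\<close> and \<open>y\<close> the predicates under
    \<open>SOME\<close> coincide, so \<open>rep\<close> is constant on classes.\<close>
  define rep where "rep x = (SOME z. z \<in> frags M \<and> x - z \<in> rels M)" for x
  have rep: "rep x \<in> frags M \<and> x - rep x \<in> rels M" if "x \<in> frags M" for x
    unfolding rep_def using that rels_closed'(1)
    by (intro someI[of "\<lambda>z. z \<in> frags M \<and> x - z \<in> rels M" x]) (simp only: diff_self simp_thms)
  have "rep x = rep y \<longleftrightarrow> x - y \<in> rels M" if xy: "x \<in> frags M" "y \<in> frags M" for x y
  proof
    assume "rep x = rep y"
    then show "x - y \<in> rels M"
      using rels_closed'(2)[of "x - rep x" "y - rep y"] rep[OF xy(1)] rep[OF xy(2)] by simp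
  next
    assume "x - y \<in> rels M"
    then have "x - z \<in> rels M \<longleftrightarrow> y - z \<in> rels M" for z
      using rels_closed'(2)[of "x - z" "x - y"] rels_closed'(3)[of "x - y" "y - z"] by auto
    then show "rep x = rep y" by (simp add: rep_def)
  qed
  then have "\<forall>x \<in> frags M. \<forall>y \<in> frags M. \<iota> (rep x) = \<iota> (rep y) \<longleftrightarrow> x - y \<in> rels M"
    using inj_on_eq_iff[OF \<iota>] rep by blast
  then have "\<exists>c :: _ \<Rightarrow> 'u. \<forall>x \<in> frags M. \<forall>y \<in> frags M. c x = c y \<longleftrightarrow> x - y \<in> rels M"
    by (intro exI[of _ "\<lambda>x. \<iota> (rep x)"])
  from someI_ex[OF this] show ?thesis using assms by (simp only: cl_def)
qed

text \<open>Among the module laws only additivity in the scalar uses a generator of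
  \<open>rels\<close>; the others hold already for formal sums.\<close>

lemma module_image_tens: "module_image Q (formal_tensors M) (cl M)"
proof -
  note [simp del] = carrier_free_Abelian_group_iff
  have "abelian_group (formal_tensors M)"
    by (rule abelian_groupI) (auto intro: bexI[of _ "- _"])
  then interpret F: abelian_group "formal_tensors M" .
  show ?thesis
  proof unfold_locales
    fix x x' y y'
    assume *: "x \<in> carrier (formal_tensors M)" "x' \<in> carrier (formal_tensors M)"
      "y \<in> carrier (formal_tensors M)" "y' \<in> carrier (formal_tensors M)" "cl M x = cl M x'" "cl M y = cl M y'"
    then have "(x - x') + (y - y') \<in> rels M" by (simp add: cl_eq_iff rels_closed')
    then show "cl M (x \<oplus>\<^bsub>formal_tensors M\<^esub> y) = cl M (x' \<oplus>\<^bsub>formal_tensors M\<^esub> y')"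
      using * by (simp add: cl_eq_iff algebra_simps)
  next
    fix q x x' assume *: "q \<in> carrier Q" "x \<in> carrier (formal_tensors M)" "x' \<in> carrier (formal_tensors M)"
      "cl M x = cl M x'"
    then show "cl M (q \<odot>\<^bsub>formal_tensors M\<^esub> x) = cl M (q \<odot>\<^bsub>formal_tensors M\<^esub> x')"
      using rels_scal[OF M, of q "x - x'"] by (simp add: cl_eq_iff)
  next
    fix a b x assume ab: "a \<in> carrier Q" "b \<in> carrier Q" and "x \<in> carrier (formal_tensors M)"
    then have x: "x \<in> frags M" by simp
    have "scal (a \<oplus>\<^bsub>Q\<^esub> b) x - (scal a x + scal b x) \<in> rels M" using x
    proof (rule frags_induct)
      fix x y assume "scal (a \<oplus>\<^bsub>Q\<^esub> b) x - (scal a x + scal b x) \<in> rels M"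
        "scal (a \<oplus>\<^bsub>Q\<^esub> b) y - (scal a y + scal b y) \<in> rels M"
      from rels_closed'(2)[OF this] show "scal (a \<oplus>\<^bsub>Q\<^esub> b) (x - y) - (scal a (x - y) + scal b (x - y)) \<in> rels M"
        by (simp add: algebra_simps)
    next
      fix q m assume "q \<in> carrier Q" "m \<in> carrier M"
      then show "scal (a \<oplus>\<^bsub>Q\<^esub> b) (frag_of (q, m)) - (scal a (frag_of (q, m)) + scal b (frag_of (q, m))) \<in> rels M"
        using rels_gens'(1)[of "a \<otimes>\<^bsub>Q\<^esub> q" "b \<otimes>\<^bsub>Q\<^esub> q" m] ab by (simp add: Q.l_distr algebra_simps)
    qed (simp add: rels_closed')
    then show "cl M ((a \<oplus>\<^bsub>Q\<^esub> b) \<odot>\<^bsub>formal_tensors M\<^esub> x)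
        = cl M (a \<odot>\<^bsub>formal_tensors M\<^esub> x \<oplus>\<^bsub>formal_tensors M\<^esub> b \<odot>\<^bsub>formal_tensors M\<^esub> x)"
      using ab x by (simp add: cl_eq_iff)
    have "scal (a \<otimes>\<^bsub>Q\<^esub> b) x = scal a (scal b x)" using x
      by (rule frags_induct) (use ab in \<open>simp_all add: Q.m_assoc\<close>)
    then show "cl M ((a \<otimes>\<^bsub>Q\<^esub> b) \<odot>\<^bsub>formal_tensors M\<^esub> x)
        = cl M (a \<odot>\<^bsub>formal_tensors M\<^esub> (b \<odot>\<^bsub>formal_tensors M\<^esub> x))"
      by simp
  next
    fix x assume "x \<in> carrier (formal_tensors M)"
    then have "x \<in> frags M" by simp
    then have "scal \<one>\<^bsub>Q\<^esub> x = x" by (rule frags_induct) simp_all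
    then show "cl M (\<one>\<^bsub>Q\<^esub> \<odot>\<^bsub>formal_tensors M\<^esub> x) = cl M x" by simp
  qed simp_all
qed

lemma tens_module: "left_module Q (tens M)"
  unfolding tens_def by (rule module_image.image_left_module[OF module_image_tens])

lemma cl_hom: "cl M \<in> lmod_hom Q (formal_tensors M) (tens M)"
  unfolding tens_def by (rule module_image.image_hom[OF module_image_tens])

lemma tens_carrier: "carrier (tens M) = cl M ` frags M"
  by (simp add: tens_def)

interpretation T: left_module Q "tens M" by (rule tens_module)

lemma cl_simps:
  "\<zero>\<^bsub>tens M\<^esub> = cl M 0"
  "\<lbrakk>x \<in> frags M; y \<in> frags M\<rbrakk> \<Longrightarrow> cl M (x + y) = cl M x \<oplus>\<^bsub>tens M\<^esub> cl M y"
  "x \<in> frags M \<Longrightarrow> cl M x \<in> carrier (tens M)"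
  "\<lbrakk>q \<in> carrier Q; x \<in> frags M\<rbrakk> \<Longrightarrow> cl M (scal q x) = q \<odot>\<^bsub>tens M\<^esub> cl M x"
  using lmod_hom_add[OF cl_hom, of x y] lmod_hom_smult[OF cl_hom, of q x]
  by (simp_all add: tens_def del: carrier_free_Abelian_group_iff)

lemma cl_diff:
  assumes "x \<in> frags M" "y \<in> frags M"
  shows "cl M (x - y) = cl M x \<ominus>\<^bsub>tens M\<^esub> cl M y"
proof -
  have "cl M x = cl M y \<oplus>\<^bsub>tens M\<^esub> cl M (x - y)"
    using assms cl_simps(2)[of y "x - y"] by (simp del: carrier_free_Abelian_group_iff)
  then show ?thesis
    using assms cl_simps(3)[of y] cl_simps(3)[of "x - y"]
    by (simp add: T.M.add_diff_cancel_left del: carrier_free_Abelian_group_iff)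
qed

lemma pure_closed [simp]: "\<lbrakk>q \<in> carrier Q; m \<in> carrier M\<rbrakk> \<Longrightarrow> pure M q m \<in> carrier (tens M)"
  by (simp add: pure_def cl_simps del: carrier_free_Abelian_group_iff)

lemma pure_add_right:
  assumes "q \<in> carrier Q" "m \<in> carrier M" "n \<in> carrier M"
  shows "pure M q (m \<oplus>\<^bsub>M\<^esub> n) = pure M q m \<oplus>\<^bsub>tens M\<^esub> pure M q n"
  using assms rels_gens'(2)[OF assms]
  by (simp add: pure_def cl_eq_iff diff_diff_eq del: carrier_free_Abelian_group_iff flip: cl_simps(2))

lemma pure_balanced:
  assumes "q \<in> carrier Q" "r \<in> carrier R" "m \<in> carrier M"
  shows "pure M (q \<otimes>\<^bsub>Q\<^esub> \<psi> r) m = pure M q (r \<odot>\<^bsub>M\<^esub> m)"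
  using assms rels_gens'(3)[OF assms(2,1,3)]
  by (simp add: pure_def cl_eq_iff del: carrier_free_Abelian_group_iff)

lemma smult_pure:
  "\<lbrakk>a \<in> carrier Q; q \<in> carrier Q; m \<in> carrier M\<rbrakk> \<Longrightarrow> a \<odot>\<^bsub>tens M\<^esub> pure M q m = pure M (a \<otimes>\<^bsub>Q\<^esub> q) m"
  using cl_simps(4)[of a "frag_of (q, m)"] by (simp add: pure_def del: carrier_free_Abelian_group_iff)

lemma tens_induct:
  assumes "y \<in> carrier (tens M)" "P \<zero>\<^bsub>tens M\<^esub>"
    and "\<And>x y. \<lbrakk>x \<in> carrier (tens M); y \<in> carrier (tens M); P x; P y\<rbrakk> \<Longrightarrow> P (x \<ominus>\<^bsub>tens M\<^esub> y)"
    and "\<And>q m. \<lbrakk>q \<in> carrier Q; m \<in> carrier M\<rbrakk> \<Longrightarrow> P (pure M q m)"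
  shows "P y"
proof -
  obtain c where c: "c \<in> frags M" "y = cl M c" using assms(1) by (auto simp: tens_carrier)
  have "P (cl M c)" using c(1)
  proof (rule frags_induct)
    show "P (cl M 0)" using assms(2) by (simp add: cl_simps)
    show "P (cl M (x - y))" if "x \<in> frags M" "y \<in> frags M" "P (cl M x)" "P (cl M y)" for x y
      using that assms(3) by (simp only: cl_diff cl_simps)
    show "P (cl M (frag_of (q, m)))" if "q \<in> carrier Q" "m \<in> carrier M" for q m
      using assms(4)[OF that] by (simp add: pure_def)
  qed
  then show ?thesis by (simp add: c)
qed

text \<open>One direction of the adjunction between extension and restriction of scalars. The free
  abelian group supplies a map on formal sums, whose kernel contains the generating relations
  because \<open>f\<close> is R-linear.\<close>

lemma tens_extend:
  assumes X: "left_module Q X" and f: "f \<in> lmod_hom R M (restrict_scalars \<psi> X)"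
  obtains \<phi> where "\<phi> \<in> lmod_hom Q (tens M) X"
    "\<And>q m. \<lbrakk>q \<in> carrier Q; m \<in> carrier M\<rbrakk> \<Longrightarrow> \<phi> (pure M q m) = q \<odot>\<^bsub>X\<^esub> f m"
proof -
  note [simp del] = carrier_free_Abelian_group_iff
  interpret X: left_module Q X by fact
  have fX: "f m \<in> carrier X" if "m \<in> carrier M" for m using lmod_hom_closed[OF f that] by simp
  have "(\<lambda>(q, m). q \<odot>\<^bsub>X\<^esub> f m) ` (carrier Q \<times> carrier M) \<subseteq> carrier (add_monoid X)"
    using fX by auto
  then obtain h where h: "h \<in> hom (free_Abelian_group (carrier Q \<times> carrier M)) (add_monoid X)"
    and h_of': "\<And>x. x \<in> carrier Q \<times> carrier M \<Longrightarrow> h (frag_of x) = (\<lambda>(q, m). q \<odot>\<^bsub>X\<^esub> f m) x"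
    using comm_group.free_Abelian_group_universal[OF X.M.a_comm_group] by metis
  have h_of: "h (frag_of (q, m)) = q \<odot>\<^bsub>X\<^esub> f m" if "q \<in> carrier Q" "m \<in> carrier M" for q m
    using h_of'[of "(q, m)"] that by simp
  have h_closed [simp]: "h c \<in> carrier X" if "c \<in> frags M" for c
    using hom_in_carrier[OF h that] by simp
  have h_add: "h (c + d) = h c \<oplus>\<^bsub>X\<^esub> h d" if "c \<in> frags M" "d \<in> frags M" for c d
    using hom_mult[OF h that] by simp
  have h_diff: "h (c - d) = h c \<ominus>\<^bsub>X\<^esub> h d" if "c \<in> frags M" "d \<in> frags M" for c d
  proof -
    have "h c = h d \<oplus>\<^bsub>X\<^esub> h (c - d)" using h_add[of d "c - d"] that by simp
    then show ?thesis using that by (simp add: X.M.add_diff_cancel_left)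
  qed
  have h0: "h 0 = \<zero>\<^bsub>X\<^esub>" using h_diff[of 0 0] by (simp add: a_minus_def X.M.r_neg)
  have h_scal: "h (scal q c) = q \<odot>\<^bsub>X\<^esub> h c" if q: "q \<in> carrier Q" and c: "c \<in> frags M" for q c
    using c by (rule frags_induct)
      (use q in \<open>simp_all add: h0 h_diff h_of X.smult_r_diff X.smult_assoc fX\<close>)
  have "rels M \<subseteq> {c \<in> frags M. h c = \<zero>\<^bsub>X\<^esub>}"
  proof (rule rels_least[OF M])
    fix x y assume "x \<in> {c \<in> frags M. h c = \<zero>\<^bsub>X\<^esub>}" "y \<in> {c \<in> frags M. h c = \<zero>\<^bsub>X\<^esub>}"
    then show "x - y \<in> {c \<in> frags M. h c = \<zero>\<^bsub>X\<^esub>}" by (simp add: h_diff X.M.diff_zero)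
  next
    fix a b m assume "a \<in> carrier Q" "b \<in> carrier Q" "m \<in> carrier M"
    then show "frag_of (a \<oplus>\<^bsub>Q\<^esub> b, m) - frag_of (a, m) - frag_of (b, m) \<in> {c \<in> frags M. h c = \<zero>\<^bsub>X\<^esub>}"
      by (simp add: h_diff h_of fX X.smult_l_distr X.M.add_diff_cancel_left) (simp add: a_minus_def X.M.r_neg fX)
  next
    fix a m n assume "a \<in> carrier Q" "m \<in> carrier M" "n \<in> carrier M"
    then show "frag_of (a, m \<oplus>\<^bsub>M\<^esub> n) - frag_of (a, m) - frag_of (a, n) \<in> {c \<in> frags M. h c = \<zero>\<^bsub>X\<^esub>}"
      using lmod_hom_add[OF f, of m n]
      by (simp add: h_diff h_of fX X.smult_r_distr X.M.add_diff_cancel_left) (simp add: a_minus_def X.M.r_neg fX)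
  next
    fix r a m assume "r \<in> carrier R" "a \<in> carrier Q" "m \<in> carrier M"
    then show "frag_of (a \<otimes>\<^bsub>Q\<^esub> \<psi> r, m) - frag_of (a, r \<odot>\<^bsub>M\<^esub> m) \<in> {c \<in> frags M. h c = \<zero>\<^bsub>X\<^esub>}"
      using lmod_hom_smult[OF f, of r m]
      by (simp add: h_diff h_of fX X.smult_assoc) (simp add: a_minus_def X.M.r_neg fX)
  qed (auto simp: h0)
  then have h_rel: "h c = \<zero>\<^bsub>X\<^esub>" if "c \<in> rels M" for c using that by blast
  \<comment> \<open>The choice of the formal sum behind \<open>y\<close> is immaterial, since
    \<open>h\<close> vanishes on \<open>rels M\<close>.\<close>
  define \<phi> where "\<phi> y = h (inv_into (frags M) (cl M) y)" for y
  have \<phi>: "\<phi> (cl M c) = h c" if c: "c \<in> frags M" for c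
  proof -
    let ?d = "inv_into (frags M) (cl M) (cl M c)"
    have d: "?d \<in> frags M" "cl M ?d = cl M c"
      using c by (auto intro: inv_into_into f_inv_into_f)
    then have "h (?d - c) = \<zero>\<^bsub>X\<^esub>" using h_rel c by (simp add: cl_eq_iff)
    then have "h ?d = h c" using X.M.add_diff_cancel[of "h ?d" "h c"] d c by (simp add: h_diff)
    then show ?thesis by (simp add: \<phi>_def)
  qed
  show thesis
  proof (rule that)
    show "\<phi> \<in> lmod_hom Q (tens M) X"
    proof (rule lmod_homI)
      fix x assume "x \<in> carrier (tens M)"
      then obtain c where c: "c \<in> frags M" "x = cl M c" by (auto simp: tens_carrier)
      then show "\<phi> x \<in> carrier X" by (simp add: \<phi>)
      show "\<phi> (q \<odot>\<^bsub>tens M\<^esub> x) = q \<odot>\<^bsub>X\<^esub> \<phi> x" if "q \<in> carrier Q" for q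
        using c that by (simp add: \<phi> h_scal flip: cl_simps(4))
      fix y assume "y \<in> carrier (tens M)"
      then obtain d where d: "d \<in> frags M" "y = cl M d" by (auto simp: tens_carrier)
      then show "\<phi> (x \<oplus>\<^bsub>tens M\<^esub> y) = \<phi> x \<oplus>\<^bsub>X\<^esub> \<phi> y"
        using c by (simp add: \<phi> h_add flip: cl_simps(2))
    qed
    show "\<phi> (pure M q m) = q \<odot>\<^bsub>X\<^esub> f m" if "q \<in> carrier Q" "m \<in> carrier M" for q m
      using that by (simp add: pure_def \<phi> h_of)
  qed
qed

lemma tens_restrict_module: "left_module R (restrict_scalars \<psi> (tens M))"
  by (rule restrict_scalars_module[OF R.ring_axioms \<psi> tens_module])

lemma pure_one_hom: "pure M \<one>\<^bsub>Q\<^esub> \<in> lmod_hom R M (restrict_scalars \<psi> (tens M))"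
  by (rule lmod_homI) (simp_all add: pure_add_right smult_pure flip: pure_balanced)

end

section \<open>Functoriality and flatness\<close>

lemma tens_map:
  assumes M: "left_module R M" and N: "left_module R N" and p: "p \<in> lmod_hom R M N"
  obtains \<phi> where "\<phi> \<in> lmod_hom Q (tens M) (tens N)"
    "\<And>q m. \<lbrakk>q \<in> carrier Q; m \<in> carrier M\<rbrakk> \<Longrightarrow> \<phi> (pure M q m) = pure N q (p m)"
proof -
  obtain \<phi> where \<phi>: "\<phi> \<in> lmod_hom Q (tens M) (tens N)"
    and eq: "\<And>q m. \<lbrakk>q \<in> carrier Q; m \<in> carrier M\<rbrakk> \<Longrightarrow> \<phi> (pure M q m) = q \<odot>\<^bsub>tens N\<^esub> pure N \<one>\<^bsub>Q\<^esub> (p m)"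
    by (rule tens_extend[OF M tens_module[OF N] lmod_hom_comp[OF p pure_one_hom[OF N]]]) blast
  show thesis
    by (rule that[OF \<phi>]) (use lmod_hom_closed[OF p] in \<open>simp add: eq smult_pure[OF N]\<close>)
qed

text \<open>Flatness is formulated for \<open>tensor_map\<close> on sets of cosets. This transfers
  it to the coded tensor product, by matching \<open>\<phi>\<close> with \<open>tensor_map\<close>
  on each class.\<close>

lemma flat_tens_inj:
  assumes flat: "flat_right_module TYPE('u) R (pullback_right_module Q \<psi>)"
    and M: "left_module R M" and N: "left_module R N" and p: "p \<in> lmod_hom R M N"
    and inj: "inj_on p (carrier M)"
    and \<phi>: "\<phi> \<in> lmod_hom Q (tens M) (tens N)"
    and pure: "\<And>q m. \<lbrakk>q \<in> carrier Q; m \<in> carrier M\<rbrakk> \<Longrightarrow> \<phi> (pure M q m) = pure N q (p m)"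
    and y: "y \<in> carrier (tens M)" "\<phi> y = \<zero>\<^bsub>tens N\<^esub>"
  shows "y = \<zero>\<^bsub>tens M\<^esub>"
proof -
  note [simp del] = carrier_free_Abelian_group_iff
  let ?A = "pullback_right_module Q \<psi>"
  let ?F = "frag_extend (\<lambda>(a, m). frag_of (a, p m))"
  let ?G = "\<lambda>M. free_Abelian_group (carrier Q \<times> carrier M)"
  interpret TM: left_module Q "tens M" by (rule tens_module[OF M])
  interpret TN: left_module Q "tens N" by (rule tens_module[OF N])
  have F: "?F c \<in> frags N \<and> \<phi> (cl M c) = cl N (?F c)" if "c \<in> frags M" for c
    using that
  proof (rule frags_induct)
    show "?F 0 \<in> frags N \<and> \<phi> (cl M 0) = cl N (?F 0)"
      using lmod_hom_zero[OF tens_module[OF M] tens_module[OF N] \<phi>] by (simp add: cl_simps(1)[OF M] cl_simps(1)[OF N])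
    show "?F (frag_of (q, m)) \<in> frags N \<and> \<phi> (cl M (frag_of (q, m))) = cl N (?F (frag_of (q, m)))"
      if "q \<in> carrier Q" "m \<in> carrier M" for q m
      using pure[OF that] lmod_hom_closed[OF p] that by (simp add: pure_def)
    show "?F (x - y) \<in> frags N \<and> \<phi> (cl M (x - y)) = cl N (?F (x - y))"
      if "x \<in> frags M" "y \<in> frags M" "?F x \<in> frags N \<and> \<phi> (cl M x) = cl N (?F x)"
        "?F y \<in> frags N \<and> \<phi> (cl M y) = cl N (?F y)" for x y
      using that by (simp add: frag_extend_diff cl_diff[OF M] cl_diff[OF N] cl_simps[OF M]
          lmod_hom_diff[OF tens_module[OF M] tens_module[OF N] \<phi>])
  qed
  have coset: "x \<in> rels K #>\<^bsub>?G K\<^esub> c \<longleftrightarrow> x - c \<in> rels K" for K c x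
    unfolding r_coset_def by (force simp: algebra_simps)
  have coset_eq: "rels K #>\<^bsub>?G K\<^esub> c = rels K #>\<^bsub>?G K\<^esub> d" if "left_module R K" "c - d \<in> rels K" for K c d
  proof -
    have eq: "x - c \<in> rels K \<longleftrightarrow> x - d \<in> rels K" for x
      using rels_closed(3)[OF that(1), of "x - c" "c - d"] rels_closed(2)[OF that(1), of "x - d" "c - d"] that(2)
      by auto
    show ?thesis by (intro Set.set_eqI) (simp only: coset eq)
  qed
  \<comment> \<open>\<open>tensor_map\<close> takes \<open>the_elem\<close> of the image of a coset,
    so that image must first be seen to be a singleton.\<close>
  have map: "tensor_map R ?A N p (rels M #>\<^bsub>?G M\<^esub> c) = rels N #>\<^bsub>?G N\<^esub> ?F c" if c: "c \<in> frags M" for c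
  proof -
    have "rels N #>\<^bsub>?G N\<^esub> ?F x = rels N #>\<^bsub>?G N\<^esub> ?F c" if x: "x \<in> rels M #>\<^bsub>?G M\<^esub> c" for x
    proof -
      have xc: "x - c \<in> rels M" using x coset by blast
      then have "x \<in> frags M" using frags_closed(2)[OF rels_in_frags[OF M xc] c] by simp
      then have "cl N (?F x) = cl N (?F c)" using xc F[of x] F[OF c] cl_eq_iff[OF M, of x c] c by simp
      then show ?thesis
        using cl_eq_iff[OF N] F[of x] F[OF c] \<open>x \<in> frags M\<close> by (intro coset_eq[OF N]) auto
    qed
    moreover have "c \<in> rels M #>\<^bsub>?G M\<^esub> c" by (simp add: coset rels_closed[OF M])
    ultimately have "(\<lambda>x. rels N #>\<^bsub>?G N\<^esub> ?F x) ` (rels M #>\<^bsub>?G M\<^esub> c) = {rels N #>\<^bsub>?G N\<^esub> ?F c}"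
      by blast
    then show ?thesis by (simp add: tensor_map_def pullback_right_module_def)
  qed
  have tinj: "inj_on (tensor_map R ?A N p) (carrier (tensor_product R ?A M))"
    using flat M N p inj unfolding flat_right_module_def by blast
  have car: "rels M #>\<^bsub>?G M\<^esub> c \<in> carrier (tensor_product R ?A M)" if "c \<in> frags M" for c
    using that by (auto simp: tensor_product_def FactGroup_def RCOSETS_def pullback_right_module_def)
  obtain c where c: "c \<in> frags M" "y = cl M c" using y(1) by (auto simp: tens_carrier[OF M])
  have "cl N (?F c) = cl N (?F 0)" using F[OF c(1)] y(2) c(2) by (simp add: cl_simps(1)[OF N])
  then have "?F c - ?F 0 \<in> rels N" using cl_eq_iff[OF N, of "?F c" "?F 0"] F[OF c(1)] F[OF frags_closed(1)] by simp
  then have "tensor_map R ?A N p (rels M #>\<^bsub>?G M\<^esub> c) = tensor_map R ?A N p (rels M #>\<^bsub>?G M\<^esub> 0)"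
    using coset_eq[OF N] map[OF c(1)] map[of 0] by simp
  then have "rels M #>\<^bsub>?G M\<^esub> c = rels M #>\<^bsub>?G M\<^esub> 0"
    using inj_onD[OF tinj] car[OF c(1)] car[of 0] by simp
  then have "c - 0 \<in> rels M" using coset[of c M c] coset[of c M 0] rels_closed(1)[OF M] by simp
  then show ?thesis using cl_eq_iff[OF M c(1), of 0] c(2) by (simp add: cl_simps(1)[OF M])
qed

end

section \<open>Left ideals of Q generated by annihilators\<close>

lemma left_ideal_genlideal:
  assumes "ring Q" "S \<subseteq> carrier Q"
  shows "left_ideal (genlideal Q S) Q" "S \<subseteq> genlideal Q S"
proof -
  interpret reg: left_module Q "regular_module Q" by (rule regular_left_module[OF assms(1)])
  have "left_ideal (carrier Q) Q" using reg.carrier_submodule by (simp add: left_ideal_def)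
  then have "genlideal Q S \<subseteq> carrier Q" using assms(2) unfolding genlideal_def by blast
  then show "left_ideal (genlideal Q S) Q"
    unfolding left_ideal_def
    by (intro reg.submoduleI)
      (auto simp: genlideal_def left_ideal_def
        intro: submodule_add[where M = "regular_module Q", simplified]
          submodule_smult[where M = "regular_module Q", simplified]
          submodule_zero[where M = "regular_module Q", simplified])
  show "S \<subseteq> genlideal Q S" by (auto simp: genlideal_def)
qed

context base_change
begin

text \<open>
  If \<open>1 \<otimes> x\<close> vanishes in \<open>Q \<otimes> M\<close>, then by flatness already in \<open>Q \<otimes> Rx\<close>, which is the quotient of
  \<open>Q\<close> by the left ideal generated by the annihilator of \<open>x\<close>.
\<close>

lemma genlideal_annihilator:
  assumes flat: "flat_right_module TYPE('u) R (pullback_right_module Q \<psi>)"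
    and M: "left_module R M" and x: "x \<in> carrier M" and zero: "pure M \<one>\<^bsub>Q\<^esub> x = \<zero>\<^bsub>tens M\<^esub>"
  shows "genlideal Q (\<psi> ` {r \<in> carrier R. r \<odot>\<^bsub>M\<^esub> x \<in> {\<zero>\<^bsub>M\<^esub>}}) = carrier Q"
proof -
  interpret M: left_module R M by fact
  let ?Ann = "{r \<in> carrier R. r \<odot>\<^bsub>M\<^esub> x \<in> {\<zero>\<^bsub>M\<^esub>}}"
  let ?A = "genlideal Q (\<psi> ` ?Ann)"
  let ?P = "regular_module Q"
  have P: "left_module Q ?P" by (rule regular_left_module[OF Q.ring_axioms])
  have Ann: "\<psi> ` ?Ann \<subseteq> carrier Q" by auto
  have A: "submodule ?A Q ?P" and gen: "\<psi> ` ?Ann \<subseteq> ?A"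
    using left_ideal_genlideal[OF Q.ring_axioms Ann] by (simp_all add: left_ideal_def)
  let ?C = "(\<lambda>r. r \<odot>\<^bsub>M\<^esub> x) ` carrier R"
  let ?M = "M\<lparr>carrier := ?C\<rparr>"
  have C: "submodule ?C R M"
    using submodule_image[OF regular_left_module[OF R.ring_axioms] M lmod_hom_smult_right[OF M x],
        of "carrier R"] left_module.carrier_submodule[OF regular_left_module[OF R.ring_axioms]] by simp
  have MC: "left_module R ?M" by (rule M.submodule_module[OF C])
  have xC: "x \<in> ?C" using x by (intro image_eqI[of _ _ "\<one>\<^bsub>R\<^esub>"]) auto
  have incl: "(\<lambda>y. y) \<in> lmod_hom R ?M M" using submodule_subset[OF C] by (intro lmod_homI) auto
  obtain \<phi> where \<phi>: "\<phi> \<in> lmod_hom Q (tens ?M) (tens M)"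
    and \<phi>_pure: "\<And>q m. \<lbrakk>q \<in> carrier Q; m \<in> carrier ?M\<rbrakk> \<Longrightarrow> \<phi> (pure ?M q m) = pure M q m"
    by (rule tens_map[OF MC M incl]) blast
  have x0: "pure ?M \<one>\<^bsub>Q\<^esub> x = \<zero>\<^bsub>tens ?M\<^esub>"
    using xC \<phi>_pure zero by (intro flat_tens_inj[OF flat MC M incl _ \<phi> \<phi>_pure]) (auto simp: pure_closed[OF MC])
  define c where "c q = ?A +>\<^bsub>?P\<^esub> q" for q
  have c_eq: "c a = c b \<longleftrightarrow> a \<ominus>\<^bsub>Q\<^esub> b \<in> ?A" if "a \<in> carrier Q" "b \<in> carrier Q" for a b
    using a_r_coset_eq_iff[OF P A, of a b] that by (simp add: c_def)
  interpret c: module_image Q ?P c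
    by (rule module_image_of_kernel[OF P A]) (simp add: c_eq)
  let ?X = "image_module c ?P"
  note X = c.image_left_module
  define f where "f y = c (\<psi> (SOME r. r \<in> carrier R \<and> y = r \<odot>\<^bsub>M\<^esub> x))" for y
  \<comment> \<open>Two scalars with the same multiple of \<open>x\<close> differ by an element of
    the annihilator, whose image under \<open>\<psi>\<close> lies in \<open>?A\<close>; so the map
    from Rx to Q/A is well defined.\<close>
  have f: "f (r \<odot>\<^bsub>M\<^esub> x) = c (\<psi> r)" if r: "r \<in> carrier R" for r
  proof -
    define s where "s = (SOME s. s \<in> carrier R \<and> r \<odot>\<^bsub>M\<^esub> x = s \<odot>\<^bsub>M\<^esub> x)"
    have s: "s \<in> carrier R \<and> r \<odot>\<^bsub>M\<^esub> x = s \<odot>\<^bsub>M\<^esub> x"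
      unfolding s_def by (rule someI[of _ r]) (simp add: r)
    then have "(s \<ominus>\<^bsub>R\<^esub> r) \<odot>\<^bsub>M\<^esub> x = \<zero>\<^bsub>M\<^esub>"
      using r x by (simp add: M.smult_l_diff) (simp add: a_minus_def M.M.r_neg)
    then have "\<psi> (s \<ominus>\<^bsub>R\<^esub> r) \<in> ?A" using s r gen by auto
    moreover have "\<psi> (s \<ominus>\<^bsub>R\<^esub> r) = \<psi> s \<ominus>\<^bsub>Q\<^esub> \<psi> r"
      using s r lmod_hom_diff[OF regular_left_module[OF R.ring_axioms]
          restrict_scalars_module[OF R.ring_axioms \<psi> P], of \<psi> s r] \<psi>
      by (simp add: lmod_hom_def ring_hom_add ring_hom_mult ring_hom_closed Pi_def)
    ultimately have "c (\<psi> s) = c (\<psi> r)" using s r by (simp add: c_eq)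
    then show ?thesis by (simp add: f_def s_def)
  qed
  have "f \<in> lmod_hom R ?M (restrict_scalars \<psi> ?X)"
  proof (rule lmod_homI)
    fix y assume "y \<in> carrier ?M"
    then obtain r where r: "r \<in> carrier R" "y = r \<odot>\<^bsub>M\<^esub> x" by auto
    then show "f y \<in> carrier (restrict_scalars \<psi> ?X)" using f by auto
    fix z assume "z \<in> carrier ?M"
    then obtain s where s: "s \<in> carrier R" "z = s \<odot>\<^bsub>M\<^esub> x" by auto
    have "y \<oplus>\<^bsub>M\<^esub> z = (r \<oplus>\<^bsub>R\<^esub> s) \<odot>\<^bsub>M\<^esub> x" using r s x by (simp add: M.smult_l_distr)
    then show "f (y \<oplus>\<^bsub>?M\<^esub> z) = f y \<oplus>\<^bsub>restrict_scalars \<psi> ?X\<^esub> f z"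
      using r s f c.image_add[of "\<psi> r" "\<psi> s"] by (simp add: ring_hom_add[OF \<psi>])
  next
    fix a y assume a: "a \<in> carrier R" and "y \<in> carrier ?M"
    then obtain r where r: "r \<in> carrier R" "y = r \<odot>\<^bsub>M\<^esub> x" by auto
    have "a \<odot>\<^bsub>M\<^esub> y = (a \<otimes>\<^bsub>R\<^esub> r) \<odot>\<^bsub>M\<^esub> x" using a r x by (simp add: M.smult_assoc)
    then show "f (a \<odot>\<^bsub>?M\<^esub> y) = a \<odot>\<^bsub>restrict_scalars \<psi> ?X\<^esub> f y"
      using a r f c.image_smult[of "\<psi> a" "\<psi> r"] by (simp add: ring_hom_mult[OF \<psi>])
  qed
  then obtain \<theta> where \<theta>: "\<theta> \<in> lmod_hom Q (tens ?M) ?X"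
    and \<theta>_pure: "\<And>q m. \<lbrakk>q \<in> carrier Q; m \<in> carrier ?M\<rbrakk> \<Longrightarrow> \<theta> (pure ?M q m) = q \<odot>\<^bsub>?X\<^esub> f m"
    by (rule tens_extend[OF MC X]) blast
  \<comment> \<open>At 1 \<otimes> x the map \<open>\<theta>\<close> is zero by \<open>x0\<close>,
    and by construction it is the class of 1. Hence 1 lies in \<open>?A\<close>.\<close>
  have "c \<zero>\<^bsub>Q\<^esub> = \<theta> (pure ?M \<one>\<^bsub>Q\<^esub> x)"
    using lmod_hom_zero[OF tens_module[OF MC] X \<theta>] by (simp add: x0)
  also have "\<dots> = \<one>\<^bsub>Q\<^esub> \<odot>\<^bsub>?X\<^esub> f (\<one>\<^bsub>R\<^esub> \<odot>\<^bsub>M\<^esub> x)" using \<theta>_pure[of "\<one>\<^bsub>Q\<^esub>" x] xC x by simp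
  also have "\<dots> = c \<one>\<^bsub>Q\<^esub>" using c.image_smult[of "\<one>\<^bsub>Q\<^esub>" "\<one>\<^bsub>Q\<^esub>"] by (simp only: f R.one_closed) simp
  finally have "\<one>\<^bsub>Q\<^esub> \<ominus>\<^bsub>Q\<^esub> \<zero>\<^bsub>Q\<^esub> \<in> ?A" using c_eq[of "\<one>\<^bsub>Q\<^esub>" "\<zero>\<^bsub>Q\<^esub>"] by simp
  then have one: "\<one>\<^bsub>Q\<^esub> \<in> ?A" by (simp add: Q.diff_zero)
  have "q \<in> ?A" if "q \<in> carrier Q" for q
    using submodule_smult[OF A that one] that by simp
  then show ?thesis using submodule_subset[OF A] by auto
qed

end

section \<open>Lifting along the localization\<close>

text \<open>What the lifting uses about \<open>\<tau>\<^sub>1\<close>, stated without torsion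
  theories. The last two assumptions express that torsion quotients are semisimple; in the last one,
  perfectness is what describes the Gabriel topology by Q.\<close>

locale semisimple_base_change = base_change R Q \<psi> emb
  for R :: "('r, 'x) ring_scheme" and Q :: "('q, 'y) ring_scheme" and \<psi> and emb :: "'q \<Rightarrow> 'u" +
  assumes QI: "left_QI_ring TYPE('u) R"
    and small: "Pow (carrier R) \<lesssim> (UNIV :: 'u set)"
    and flat: "flat_right_module TYPE('u) R (pullback_right_module Q \<psi>)"
    and Q_hereditary: "left_hereditary TYPE('u) Q"
    and semisimple_cokernel:
      "semisimple_interval R (pullback_left_module Q \<psi>) (\<psi> ` carrier R) (carrier Q)"
    and semisimple_topology: "\<And>J. \<lbrakk>left_ideal J R; genlideal Q (\<psi> ` J) = carrier Q\<rbrakk>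
      \<Longrightarrow> semisimple_interval R (regular_module R) J (carrier R)"
begin

abbreviation unit :: "('r, 'u) module \<Rightarrow> 'u \<Rightarrow> 'u" where
  "unit M \<equiv> pure M \<one>\<^bsub>Q\<^esub>"

abbreviation tensR :: "('r, 'u) module \<Rightarrow> ('r, 'u) module" where
  "tensR M \<equiv> restrict_scalars \<psi> (tens M)"

lemma regular: "left_module R (regular_module R)" "left_module Q (regular_module Q)"
  by (rule regular_left_module, rule R.ring_axioms) (rule regular_left_module, rule Q.ring_axioms)

text \<open>For \<open>x\<close> in the kernel, \<open>genlideal_annihilator\<close> places the
  annihilator of \<open>x\<close> in the topology, so Rx, being R modulo that annihilator, is
  semisimple. The kernel is the sum of these cyclic submodules.\<close>

lemma semisimple_unit_kernel:
  assumes M: "left_module R M"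
  shows "semisimple_interval R M {\<zero>\<^bsub>M\<^esub>} {x \<in> carrier M. unit M x \<in> {\<zero>\<^bsub>tens M\<^esub>}}"
    (is "semisimple_interval R M _ ?Z")
proof -
  interpret M: left_module R M by fact
  interpret TR: left_module R "tensR M" by (rule tens_restrict_module[OF M])
  have Z: "submodule ?Z R M"
    using submodule_preimage[OF M tens_restrict_module[OF M] pure_one_hom[OF M] TR.zero_submodule] by simp
  show ?thesis
  proof (rule semisimple_interval_sum[OF M M.zero_submodule Z])
    show "{\<zero>\<^bsub>M\<^esub>} \<subseteq> ?Z" using submodule_zero[OF Z] by blast
    fix P assume "P \<subset> ?Z"
    then obtain x where xP: "x \<notin> P" and x: "x \<in> carrier M" and x0: "unit M x = \<zero>\<^bsub>tens M\<^esub>" by blast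
    have hom: "(\<lambda>r. r \<odot>\<^bsub>M\<^esub> x) \<in> lmod_hom R (regular_module R) M" by (rule lmod_hom_smult_right[OF M x])
    let ?Ann = "{r \<in> carrier R. r \<odot>\<^bsub>M\<^esub> x \<in> {\<zero>\<^bsub>M\<^esub>}}"
    have "left_ideal ?Ann R"
      using submodule_preimage[OF regular(1) M hom M.zero_submodule] by (simp add: left_ideal_def)
    then have "semisimple_interval R (regular_module R) ?Ann (carrier R)"
      by (rule semisimple_topology[OF _ genlideal_annihilator[OF flat M x x0]])
    then have "semisimple_interval R M {\<zero>\<^bsub>M\<^esub>} ((\<lambda>r. r \<odot>\<^bsub>M\<^esub> x) ` carrier R)"
      by (rule semisimple_image[OF regular(1) M hom]) simp
    moreover have "(\<lambda>r. r \<odot>\<^bsub>M\<^esub> x) ` carrier R \<subseteq> ?Z"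
      using x x0 submodule_smult[OF Z, of _ x] by auto
    moreover have "x \<in> (\<lambda>r. r \<odot>\<^bsub>M\<^esub> x) ` carrier R"
      using x by (intro image_eqI[of _ _ "\<one>\<^bsub>R\<^esub>"]) auto
    ultimately show "\<exists>W\<subseteq>?Z. semisimple_interval R M {\<zero>\<^bsub>M\<^esub>} W \<and> \<not> W \<subseteq> P"
      using xP by blast
  qed
qed

text \<open>Every \<open>m\<close> gives a map a \<mapsto> a \<otimes> m from Q, which sends the
  image of R into the image of \<open>M\<close>. The cokernel is thus a sum of images of the
  semisimple module Q/\<psi>(R).\<close>

lemma semisimple_unit_cokernel:
  assumes M: "left_module R M"
  shows "semisimple_interval R (tensR M) (unit M ` carrier M) (carrier (tens M))"
    (is "semisimple_interval R _ ?U _")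
proof -
  interpret M: left_module R M by fact
  interpret T: left_module Q "tens M" by (rule tens_module[OF M])
  note TR = tens_restrict_module[OF M]
  interpret TR: left_module R "tensR M" by (rule TR)
  have U: "submodule ?U R (tensR M)"
    by (rule submodule_image[OF M TR pure_one_hom[OF M] M.carrier_submodule])
  have T: "submodule (carrier (tens M)) R (tensR M)" using TR.carrier_submodule by simp
  have PQ: "left_module R (pullback_left_module Q \<psi>)"
  proof -
    have "abelian_group (pullback_left_module Q \<psi>)"
      by (rule abelian_groupI)
        (auto simp: pullback_left_module_def Q.a_ac intro!: bexI[of _ "\<ominus>\<^bsub>Q\<^esub> _"] Q.r_neg)
    then show ?thesis
      by (auto simp: left_module_def left_module_axioms_def R.ring_axioms pullback_left_module_def
          ring_hom_add[OF \<psi>] ring_hom_mult[OF \<psi>] Q.l_distr Q.r_distr Q.m_assoc)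
  qed
  show ?thesis
  proof (rule semisimple_interval_sum[OF TR U T])
    show "?U \<subseteq> carrier (tens M)" using submodule_subset[OF U] by simp
    fix P assume P: "submodule P R (tensR M)" "?U \<subseteq> P" "P \<subset> carrier (tens M)"
    \<comment> \<open>Pure tensors generate, so a proper submodule must miss one of them.\<close>
    have "\<exists>q\<in>carrier Q. \<exists>m\<in>carrier M. pure M q m \<notin> P"
    proof (rule ccontr)
      assume none: "\<not> ?thesis"
      have "y \<in> P" if "y \<in> carrier (tens M)" for y
        using that
      proof (rule tens_induct[OF M])
        show "\<zero>\<^bsub>tens M\<^esub> \<in> P" using submodule_zero[OF P(1)] by simp
        show "x \<ominus>\<^bsub>tens M\<^esub> y \<in> P" if "x \<in> P" "y \<in> P" for x y
          using submodule_diff[OF P(1) that] by simp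
      qed (use none in blast)
      then show False using P(3) by blast
    qed
    then obtain q m where q: "q \<in> carrier Q" and m: "m \<in> carrier M" and qm: "pure M q m \<notin> P" by blast
    define u where "u = unit M m"
    have u: "u \<in> carrier (tens M)" unfolding u_def by (rule pure_closed[OF M Q.one_closed m])
    have pure_eq: "pure M a m = a \<odot>\<^bsub>tens M\<^esub> u" if "a \<in> carrier Q" for a
      using smult_pure[OF M that Q.one_closed m] that by (simp add: u_def)
    have hom: "(\<lambda>a. pure M a m) \<in> lmod_hom R (pullback_left_module Q \<psi>) (tensR M)"
      by (rule lmod_homI)
        (simp_all add: pullback_left_module_def pure_eq u T.smult_l_distr T.smult_assoc)
    have "(\<lambda>a. pure M a m) ` \<psi> ` carrier R \<subseteq> ?U"
    proof
      fix y assume "y \<in> (\<lambda>a. pure M a m) ` \<psi> ` carrier R"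
      then obtain r where r: "r \<in> carrier R" "y = pure M (\<psi> r) m" by blast
      then have "y = unit M (r \<odot>\<^bsub>M\<^esub> m)" using pure_balanced[OF M Q.one_closed r(1) m] by simp
      then show "y \<in> ?U" using r m by blast
    qed
    from semisimple_interval_image[OF PQ TR hom semisimple_cokernel U this]
    have W: "semisimple_interval R (tensR M) ?U (?U <+>\<^bsub>tensR M\<^esub> (\<lambda>a. pure M a m) ` carrier Q)" .
    have H: "submodule ((\<lambda>a. pure M a m) ` carrier Q) R (tensR M)"
      using submodule_image[OF PQ TR hom semisimple_intervalD(2)[OF semisimple_cokernel]] .
    have "pure M q m \<in> ?U <+>\<^bsub>tensR M\<^esub> (\<lambda>a. pure M a m) ` carrier Q"
      using TR.set_add_upper(2)[OF U H] q by blast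
    then have "\<not> ?U <+>\<^bsub>tensR M\<^esub> (\<lambda>a. pure M a m) ` carrier Q \<subseteq> P" using qm by blast
    moreover have "?U <+>\<^bsub>tensR M\<^esub> (\<lambda>a. pure M a m) ` carrier Q \<subseteq> carrier (tens M)"
      using submodule_subset[OF semisimple_intervalD(2)[OF W]] by (simp only: restrict_scalars_simps(1))
    ultimately show "\<exists>W\<subseteq>carrier (tens M). semisimple_interval R (tensR M) ?U W \<and> \<not> W \<subseteq> P"
      using W by blast
  qed
qed

text \<open>
  By flatness, \<open>Q \<otimes> I\<close> is the left ideal \<open>J = Q \<psi>(I)\<close> of \<open>Q\<close>, which is projective. As \<open>I\<close> and \<open>R\<close>
  do not live on \<open>'u\<close>, the tensor products are formed with copies of them.
\<close>

lemma lift_to_tens: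
  assumes M: "left_module R M" and N: "left_module R N" and p: "p \<in> lmod_hom R M N"
    and onto: "p ` carrier M = carrier N"
    and I: "left_ideal I R" and f: "f \<in> lmod_hom R (ideal_module R I) N"
    and pt: "pt \<in> lmod_hom Q (tens M) (tens N)"
    and pt_pure: "\<And>q m. \<lbrakk>q \<in> carrier Q; m \<in> carrier M\<rbrakk> \<Longrightarrow> pt (pure M q m) = pure N q (p m)"
  obtains g where "g \<in> lmod_hom R (ideal_module R I) (tensR M)" "\<forall>i\<in>I. pt (g i) = unit N (f i)"
proof -
  note P = regular(1) and PQ = regular(2)
  interpret TM: left_module Q "tens M" by (rule tens_module[OF M])
  interpret TN: left_module Q "tens N" by (rule tens_module[OF N])
  have Is: "submodule I R (regular_module R)" using I by (simp add: left_ideal_def)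
  have IR [simp]: "i \<in> carrier R" if "i \<in> I" for i using submodule_in_carrier[OF Is that] by simp
  obtain j :: "'r set \<Rightarrow> 'u" where j: "inj_on j (Pow (carrier R))"
    using small by (auto simp: lepoll_def)
  define \<epsilon> where "\<epsilon> r = j {r}" for r
  have \<epsilon>: "inj_on \<epsilon> (carrier R)"
    unfolding \<epsilon>_def using inj_on_eq_iff[OF j] by (intro inj_onI) auto
  define \<delta> where "\<delta> = inv_into (carrier R) \<epsilon>"
  have \<delta> [simp]: "\<delta> (\<epsilon> r) = r" if "r \<in> carrier R" for r
    using that by (simp add: \<delta>_def inv_into_f_f[OF \<epsilon>])
  interpret e: module_image R "regular_module R" \<epsilon> by (rule module_image_of_inj[OF P]) (simp add: \<epsilon>)
  let ?R = "image_module \<epsilon> (regular_module R)"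
  let ?I = "?R\<lparr>carrier := \<epsilon> ` I\<rparr>"
  note R' = e.image_left_module
  interpret R': left_module R ?R by (rule R')
  have I': "submodule (\<epsilon> ` I) R ?R" by (rule submodule_image[OF P R' e.image_hom Is])
  have Im: "left_module R ?I" by (rule R'.submodule_module[OF I'])
  note e_add = e.image_add[simplified] and e_smult = e.image_smult[simplified]
  interpret TR: left_module Q "tens ?R" by (rule tens_module[OF R'])
  have \<delta>_hom: "\<delta> \<in> lmod_hom R ?R (regular_module R)"
    by (rule lmod_homI) (auto simp: e_add e_smult)
  have \<psi>_hom: "\<psi> \<in> lmod_hom R (regular_module R) (restrict_scalars \<psi> (regular_module Q))"
    by (rule lmod_homI) (auto simp: ring_hom_add[OF \<psi>] ring_hom_mult[OF \<psi>])
  obtain \<mu> where \<mu>: "\<mu> \<in> lmod_hom Q (tens ?R) (regular_module Q)"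
    and "\<And>q m. \<lbrakk>q \<in> carrier Q; m \<in> carrier ?R\<rbrakk> \<Longrightarrow> \<mu> (pure ?R q m) = q \<odot>\<^bsub>regular_module Q\<^esub> \<psi> (\<delta> m)"
    by (rule tens_extend[OF R' PQ lmod_hom_comp[OF \<delta>_hom \<psi>_hom]]) blast
  then have \<mu>_pure: "\<mu> (pure ?R q (\<epsilon> r)) = q \<otimes>\<^bsub>Q\<^esub> \<psi> r" if "q \<in> carrier Q" "r \<in> carrier R" for q r
    using that by simp
  have \<epsilon>1: "\<epsilon> \<one>\<^bsub>R\<^esub> \<in> carrier ?R" by simp
  \<comment> \<open>Each tensor is recovered from its value under \<open>\<mu>\<close> as a multiple
    of 1 \<otimes> 1, so \<open>\<mu>\<close> from Q \<otimes> R to Q is injective.\<close>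
  have \<mu>_inj: "y = \<mu> y \<odot>\<^bsub>tens ?R\<^esub> unit ?R (\<epsilon> \<one>\<^bsub>R\<^esub>)" if "y \<in> carrier (tens ?R)" for y
    using that
  proof (rule tens_induct[OF R'])
    note u = pure_closed[OF R' Q.one_closed \<epsilon>1]
    show "\<zero>\<^bsub>tens ?R\<^esub> = \<mu> \<zero>\<^bsub>tens ?R\<^esub> \<odot>\<^bsub>tens ?R\<^esub> unit ?R (\<epsilon> \<one>\<^bsub>R\<^esub>)"
      using u lmod_hom_zero[OF tens_module[OF R'] PQ \<mu>] by simp
    show "x \<ominus>\<^bsub>tens ?R\<^esub> y = \<mu> (x \<ominus>\<^bsub>tens ?R\<^esub> y) \<odot>\<^bsub>tens ?R\<^esub> unit ?R (\<epsilon> \<one>\<^bsub>R\<^esub>)"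
      if "x \<in> carrier (tens ?R)" "y \<in> carrier (tens ?R)"
        "x = \<mu> x \<odot>\<^bsub>tens ?R\<^esub> unit ?R (\<epsilon> \<one>\<^bsub>R\<^esub>)" "y = \<mu> y \<odot>\<^bsub>tens ?R\<^esub> unit ?R (\<epsilon> \<one>\<^bsub>R\<^esub>)" for x y
    proof -
      have "\<mu> (x \<ominus>\<^bsub>tens ?R\<^esub> y) = \<mu> x \<ominus>\<^bsub>Q\<^esub> \<mu> y"
        using lmod_hom_diff[OF tens_module[OF R'] PQ \<mu> that(1,2)] by simp
      moreover have "\<mu> x \<in> carrier Q" "\<mu> y \<in> carrier Q"
        using lmod_hom_closed[OF \<mu>] that(1,2) by simp_all
      ultimately show ?thesis using that(3,4) u by (simp add: TR.smult_l_diff)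
    qed
    fix q m assume q: "q \<in> carrier Q" and "m \<in> carrier ?R"
    then obtain r where r: "r \<in> carrier R" "m = \<epsilon> r" by auto
    have "pure ?R q (\<epsilon> r) = pure ?R (q \<otimes>\<^bsub>Q\<^esub> \<psi> r) (\<epsilon> \<one>\<^bsub>R\<^esub>)"
      using pure_balanced[OF R' q r(1) \<epsilon>1] e_smult[of r "\<one>\<^bsub>R\<^esub>"] r by simp
    also have "\<dots> = (q \<otimes>\<^bsub>Q\<^esub> \<psi> r) \<odot>\<^bsub>tens ?R\<^esub> unit ?R (\<epsilon> \<one>\<^bsub>R\<^esub>)"
      using smult_pure[OF R' _ Q.one_closed \<epsilon>1, of "q \<otimes>\<^bsub>Q\<^esub> \<psi> r"] q r by simp
    finally show "pure ?R q m = \<mu> (pure ?R q m) \<odot>\<^bsub>tens ?R\<^esub> unit ?R (\<epsilon> \<one>\<^bsub>R\<^esub>)"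
      unfolding r(2) \<mu>_pure[OF q r(1)] .
  qed
  have incl: "(\<lambda>x. x) \<in> lmod_hom R ?I ?R" using submodule_subset[OF I'] by (intro lmod_homI) auto
  obtain \<iota> where \<iota>: "\<iota> \<in> lmod_hom Q (tens ?I) (tens ?R)"
    and \<iota>_pure: "\<And>q m. \<lbrakk>q \<in> carrier Q; m \<in> carrier ?I\<rbrakk> \<Longrightarrow> \<iota> (pure ?I q m) = pure ?R q m"
    by (rule tens_map[OF Im R' incl]) blast
  \<comment> \<open>The multiplication map from Q \<otimes> I to Q. It is injective since
    \<open>\<iota>\<close> is so by flatness and \<open>\<mu>\<close> by the preceding
    computation.\<close>
  define \<kappa> where "\<kappa> y = \<mu> (\<iota> y)" for y
  have \<kappa>: "\<kappa> \<in> lmod_hom Q (tens ?I) (regular_module Q)"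
    unfolding \<kappa>_def by (rule lmod_hom_comp[OF \<iota> \<mu>])
  have TI: "left_module Q (tens ?I)" by (rule tens_module[OF Im])
  interpret TI: left_module Q "tens ?I" by (rule TI)
  have \<kappa>_ker: "y = \<zero>\<^bsub>tens ?I\<^esub>" if y: "y \<in> carrier (tens ?I)" and "\<kappa> y = \<zero>\<^bsub>Q\<^esub>" for y
  proof -
    have "\<iota> y = \<zero>\<^bsub>tens ?R\<^esub>"
      using \<mu>_inj[OF lmod_hom_closed[OF \<iota> y]] that(2) pure_closed[OF R' Q.one_closed \<epsilon>1]
      by (simp add: \<kappa>_def)
    then show ?thesis
      using y by (intro flat_tens_inj[OF flat Im R' incl _ \<iota> \<iota>_pure]) auto
  qed
  have \<kappa>_inj: "inj_on \<kappa> (carrier (tens ?I))"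
  proof (rule inj_onI)
    fix x y assume *: "x \<in> carrier (tens ?I)" "y \<in> carrier (tens ?I)" "\<kappa> x = \<kappa> y"
    have "\<kappa> (x \<ominus>\<^bsub>tens ?I\<^esub> y) = \<kappa> x \<ominus>\<^bsub>Q\<^esub> \<kappa> y"
      using lmod_hom_diff[OF TI PQ \<kappa> *(1,2)] by simp
    also have "\<dots> = \<zero>\<^bsub>Q\<^esub>"
      using *(3) lmod_hom_closed[OF \<kappa> *(2)] by (simp add: a_minus_def Q.r_neg)
    finally have "x \<ominus>\<^bsub>tens ?I\<^esub> y = \<zero>\<^bsub>tens ?I\<^esub>" using * by (intro \<kappa>_ker) auto
    then show "x = y" using TI.M.add_diff_cancel[OF *(1,2)] *(2) by simp
  qed
  define J where "J = \<kappa> ` carrier (tens ?I)"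
  have J: "submodule J Q (regular_module Q)"
    unfolding J_def by (rule submodule_image[OF TI PQ \<kappa> TI.carrier_submodule])
  have proj: "projective_module TYPE('u) Q (ideal_module Q J)"
    using Q_hereditary J by (simp add: left_hereditary_def left_ideal_def)
  have f\<delta>: "(\<lambda>y. f (\<delta> y)) \<in> lmod_hom R ?I N"
  proof (rule lmod_hom_comp[OF _ f])
    have "\<delta> \<in> lmod_hom R ?I (regular_module R)"
      using \<delta>_hom submodule_subset[OF I'] by (intro lmod_hom_restrict) auto
    then show "\<delta> \<in> lmod_hom R ?I (ideal_module R I)"
      unfolding ideal_module_def by (rule lmod_hom_into_submodule) auto
  qed
  obtain fs where fs: "fs \<in> lmod_hom Q (tens ?I) (tens N)"
    and fs_pure: "\<And>q m. \<lbrakk>q \<in> carrier Q; m \<in> carrier ?I\<rbrakk> \<Longrightarrow> fs (pure ?I q m) = pure N q (f (\<delta> m))"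
    by (rule tens_map[OF Im N f\<delta>]) blast
  \<comment> \<open>The map Q \<otimes> f, transported to the left ideal \<open>J\<close> along the
    inverse of \<open>\<kappa>\<close>.\<close>
  define F where "F z = fs (inv_into (carrier (tens ?I)) \<kappa> z)" for z
  have F\<kappa>: "F (\<kappa> y) = fs y" if "y \<in> carrier (tens ?I)" for y
    using that by (simp add: F_def inv_into_f_f[OF \<kappa>_inj])
  have F: "F \<in> lmod_hom Q (ideal_module Q J) (tens N)"
  proof (rule lmod_homI)
    fix z assume "z \<in> carrier (ideal_module Q J)"
    then obtain y where y: "y \<in> carrier (tens ?I)" "z = \<kappa> y" by (auto simp: ideal_module_def J_def)
    then show "F z \<in> carrier (tens N)" using lmod_hom_closed[OF fs] by (simp add: F\<kappa>)
    show "F (q \<odot>\<^bsub>ideal_module Q J\<^esub> z) = q \<odot>\<^bsub>tens N\<^esub> F z" if q: "q \<in> carrier Q" for q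
      using F\<kappa>[of "q \<odot>\<^bsub>tens ?I\<^esub> y"] lmod_hom_smult[OF \<kappa> q y(1)] lmod_hom_smult[OF fs q y(1)] y q
      by (simp add: ideal_module_def F\<kappa>)
    fix z' assume "z' \<in> carrier (ideal_module Q J)"
    then obtain y' where y': "y' \<in> carrier (tens ?I)" "z' = \<kappa> y'" by (auto simp: ideal_module_def J_def)
    then show "F (z \<oplus>\<^bsub>ideal_module Q J\<^esub> z') = F z \<oplus>\<^bsub>tens N\<^esub> F z'"
      using F\<kappa>[of "y \<oplus>\<^bsub>tens ?I\<^esub> y'"] lmod_hom_add[OF \<kappa> y(1) y'(1)] lmod_hom_add[OF fs y(1) y'(1)] y
      by (simp add: ideal_module_def F\<kappa>)
  qed
  \<comment> \<open>Tensoring preserves surjectivity: pure tensors lift along \<open>p\<close>, and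
    the image is a submodule. The projectivity of \<open>J\<close> can then be applied to
    \<open>pt\<close>.\<close>
  have im: "submodule (pt ` carrier (tens M)) Q (tens N)"
    by (rule submodule_image[OF tens_module[OF M] tens_module[OF N] pt TM.carrier_submodule])
  have "y \<in> pt ` carrier (tens M)" if "y \<in> carrier (tens N)" for y
    using that
  proof (rule tens_induct[OF N])
    fix q n assume q: "q \<in> carrier Q" and "n \<in> carrier N"
    then obtain m where m: "m \<in> carrier M" "n = p m" using onto by blast
    then show "pure N q n \<in> pt ` carrier (tens M)"
      using pt_pure[OF q m(1)] pure_closed[OF M q m(1)] by (metis image_eqI)
  qed (use submodule_zero[OF im] submodule_diff[OF im] in auto)
  then have "pt ` carrier (tens M) = carrier (tens N)" using submodule_subset[OF im] by blast
  then obtain G where G: "G \<in> lmod_hom Q (ideal_module Q J) (tens M)"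
    and G_lift: "\<forall>z\<in>carrier (ideal_module Q J). pt (G z) = F z"
    using proj F pt tens_module[OF M] tens_module[OF N] unfolding projective_module_def by blast
  have car: "\<epsilon> i \<in> carrier ?I" "unit ?I (\<epsilon> i) \<in> carrier (tens ?I)" if "i \<in> I" for i
    using that pure_closed[OF Im Q.one_closed, of "\<epsilon> i"] by auto
  have \<psi>\<kappa>: "\<psi> i = \<kappa> (unit ?I (\<epsilon> i))" if "i \<in> I" for i
    using \<iota>_pure[OF Q.one_closed car(1)[OF that]] \<mu>_pure[OF Q.one_closed, of i] that
    by (simp add: \<kappa>_def)
  have \<psi>J: "\<psi> i \<in> J" if "i \<in> I" for i using \<psi>\<kappa>[OF that] car(2)[OF that] by (simp add: J_def)
  have \<psi>_hom_J: "\<psi> \<in> lmod_hom R (ideal_module R I) (restrict_scalars \<psi> (ideal_module Q J))"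
    by (rule lmod_homI)
      (auto simp: ideal_module_def \<psi>J ring_hom_add[OF \<psi>] ring_hom_mult[OF \<psi>])
  show thesis
  proof (rule that)
    show "(\<lambda>i. G (\<psi> i)) \<in> lmod_hom R (ideal_module R I) (tensR M)"
      by (rule lmod_hom_comp[OF \<psi>_hom_J restrict_scalars_hom[OF \<psi> G]])
    show "\<forall>i\<in>I. pt (G (\<psi> i)) = unit N (f i)"
    proof
      fix i assume i: "i \<in> I"
      have "pt (G (\<psi> i)) = F (\<psi> i)" using G_lift \<psi>J[OF i] by (simp add: ideal_module_def)
      also have "\<dots> = unit N (f i)"
        using F\<kappa>[OF car(2)[OF i]] fs_pure[OF Q.one_closed car(1)[OF i]] i by (simp add: \<psi>\<kappa>)
      finally show "pt (G (\<psi> i)) = unit N (f i)" .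
    qed
  qed
qed

text \<open>Two corrections are made, one before and one after returning from Q \<otimes> M to
  \<open>M\<close>. Both are right multiplications by one element, supplied by
  \<open>QI_left_ideal_projection\<close>, so surjectivity of \<open>p\<close> is enough to lift
  them.\<close>

lemma left_ideal_projective:
  assumes I: "left_ideal I R"
  shows "projective_module TYPE('u) R (ideal_module R I)"
  unfolding projective_module_def
proof (intro conjI allI impI ballI)
  let ?I = "ideal_module R I"
  have Is: "submodule I R (regular_module R)" using I by (simp add: left_ideal_def)
  have IR [simp]: "i \<in> carrier R" if "i \<in> I" for i using submodule_in_carrier[OF Is that] by simp
  show Im: "left_module R ?I"
    unfolding ideal_module_def by (rule left_module.submodule_module[OF regular(1) Is])
  have I_simps [simp]: "carrier ?I = I" "x \<oplus>\<^bsub>?I\<^esub> y = x \<oplus>\<^bsub>R\<^esub> y" "r \<odot>\<^bsub>?I\<^esub> x = r \<otimes>\<^bsub>R\<^esub> x" for x y r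
    by (simp_all add: ideal_module_def)
  have I_closed [simp]: "i \<oplus>\<^bsub>R\<^esub> k \<in> I" "r \<otimes>\<^bsub>R\<^esub> i \<in> I" "i \<ominus>\<^bsub>R\<^esub> k \<in> I"
    if "i \<in> I" "k \<in> I" "r \<in> carrier R" for i k r
    using submodule_add[OF Is that(1,2)] submodule_smult[OF Is that(3,1)] submodule_diff[OF Is that(1,2)]
    by simp_all
  have hom_diff_I: "h (i \<ominus>\<^bsub>R\<^esub> i \<otimes>\<^bsub>R\<^esub> e) = h i \<ominus>\<^bsub>X\<^esub> i \<odot>\<^bsub>X\<^esub> h e"
    if X: "left_module R X" and h: "h \<in> lmod_hom R ?I X" and i: "i \<in> I" and e: "e \<in> I"
    for h i e and X :: "('r, 'u) module"
  proof -
    have ie: "i \<otimes>\<^bsub>R\<^esub> e \<in> I" using i e by simp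
    have "i \<ominus>\<^bsub>?I\<^esub> i \<otimes>\<^bsub>R\<^esub> e = i \<ominus>\<^bsub>R\<^esub> i \<otimes>\<^bsub>R\<^esub> e"
      using left_module.a_minus_restrict[OF regular(1) Is ie] by (simp add: ideal_module_def)
    then show ?thesis
      using lmod_hom_diff[OF Im X h, of i "i \<otimes>\<^bsub>R\<^esub> e"] lmod_hom_smult[OF h, of i e] i e ie by simp
  qed
  have smult_hom: "(\<lambda>i. i \<odot>\<^bsub>X\<^esub> w) \<in> lmod_hom R ?I X"
    if "left_module R X" "w \<in> carrier X" for w and X :: "('r, 'u) module"
    unfolding ideal_module_def
    using submodule_subset[OF Is] by (intro lmod_hom_restrict lmod_hom_smult_right that) simp
  fix M N :: "('r, 'u) module" and p f
  assume MN: "left_module R M \<and> left_module R N"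
    and p: "p \<in> lmod_hom R M N" and onto: "p ` carrier M = carrier N" and f: "f \<in> lmod_hom R ?I N"
  from MN have M: "left_module R M" and N: "left_module R N" by simp_all
  interpret M: left_module R M by (rule M)
  interpret N: left_module R N by (rule N)
  note TM = tens_restrict_module[OF M] and TN = tens_restrict_module[OF N]
  interpret TM: left_module R "tensR M" by (rule TM)
  interpret TN: left_module R "tensR N" by (rule TN)
  note uM = pure_one_hom[OF M] and uN = pure_one_hom[OF N]
  have unit_M [simp]: "unit M m \<in> carrier (tens M)" if "m \<in> carrier M" for m
    using lmod_hom_closed[OF uM that] by simp
  have unit_N [simp]: "unit N n \<in> carrier (tens N)" if "n \<in> carrier N" for n
    using lmod_hom_closed[OF uN that] by simp
  have f_closed [simp]: "f i \<in> carrier N" if "i \<in> I" for i using lmod_hom_closed[OF f] that by simp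
  have p_closed [simp]: "p m \<in> carrier N" if "m \<in> carrier M" for m using lmod_hom_closed[OF p that] .
  obtain pt where pt: "pt \<in> lmod_hom Q (tens M) (tens N)"
    and pt_pure: "\<And>q m. \<lbrakk>q \<in> carrier Q; m \<in> carrier M\<rbrakk> \<Longrightarrow> pt (pure M q m) = pure N q (p m)"
    by (rule tens_map[OF M N p]) blast
  note ptR = restrict_scalars_hom[OF \<psi> pt]
  have pt_unit: "pt (unit M m) = unit N (p m)" if "m \<in> carrier M" for m
    using pt_pure[OF Q.one_closed that] .
  obtain g where g: "g \<in> lmod_hom R ?I (tensR M)" and "\<forall>i\<in>I. pt (g i) = unit N (f i)"
    by (rule lift_to_tens[OF M N p onto I f pt pt_pure]) blast
  then have pt_g: "pt (g i) = unit N (f i)" if "i \<in> I" for i using that by blast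
  have g_closed [simp]: "g i \<in> carrier (tens M)" if "i \<in> I" for i using lmod_hom_closed[OF g] that by simp

  \<comment> \<open>The cokernel of the unit is semisimple, so \<open>g\<close> can be corrected to take values in the image of \<open>M\<close>.\<close>
  let ?U = "unit M ` carrier M"
  have U: "submodule ?U R (tensR M)"
    by (rule submodule_image[OF M TM uM M.carrier_submodule])
  let ?D = "{i \<in> carrier ?I. g i \<in> ?U}"
  have "semisimple_interval R ?I ?D {i \<in> carrier ?I. g i \<in> carrier (tens M)}"
    by (rule semisimple_interval_preimage[OF Im TM g semisimple_unit_cokernel[OF M]])
  moreover have "{i \<in> carrier ?I. g i \<in> carrier (tens M)} = I" by auto
  ultimately have "semisimple_interval R ?I ?D I" by simp
  then obtain e where e: "e \<in> I" and ie: "\<forall>i\<in>I. i \<ominus>\<^bsub>R\<^esub> i \<otimes>\<^bsub>R\<^esub> e \<in> ?D"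
    using QI_left_ideal_projection[OF QI small I] by blast
  \<comment> \<open>By \<open>ie\<close>, g(i) - i g(e) lies in \<open>?U\<close> for every i.
    Trading g(e) for the unit of a preimage \<open>m\<close> of \<open>f e\<close> therefore moves
    all values into \<open>?U\<close>, and this choice of \<open>m\<close> makes \<open>pt w\<close>
    vanish, so the lifting property survives.\<close>
  obtain m where m: "m \<in> carrier M" "p m = f e" using onto f_closed[OF e] by (metis imageE)
  define w where "w = unit M m \<ominus>\<^bsub>tensR M\<^esub> g e"
  have w: "w \<in> carrier (tensR M)" using m e TM.M.minus_closed[of "unit M m" "g e"] by (simp add: w_def)
  define g' where "g' i = g i \<oplus>\<^bsub>tensR M\<^esub> i \<odot>\<^bsub>tensR M\<^esub> w" for i
  have g': "g' \<in> lmod_hom R ?I (tensR M)"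
    unfolding g'_def by (rule lmod_hom_sum[OF TM g smult_hom[OF TM w]])
  have g'_U: "g' i \<in> ?U" if i: "i \<in> I" for i
  proof -
    have c: "g i \<in> carrier (tensR M)" "i \<odot>\<^bsub>tensR M\<^esub> g e \<in> carrier (tensR M)"
      "i \<odot>\<^bsub>tensR M\<^esub> unit M m \<in> carrier (tensR M)"
      using i e m TM.smult_closed[of i "g e"] TM.smult_closed[of i "unit M m"] by simp_all
    have "i \<odot>\<^bsub>tensR M\<^esub> w = i \<odot>\<^bsub>tensR M\<^esub> unit M m \<ominus>\<^bsub>tensR M\<^esub> i \<odot>\<^bsub>tensR M\<^esub> g e"
      unfolding w_def using i e m by (intro TM.smult_r_diff) simp_all
    then have "g' i = (g i \<ominus>\<^bsub>tensR M\<^esub> i \<odot>\<^bsub>tensR M\<^esub> g e) \<oplus>\<^bsub>tensR M\<^esub> i \<odot>\<^bsub>tensR M\<^esub> unit M m"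
      unfolding g'_def a_minus_def using c by (simp only: TM.M.a_ac TM.M.a_inv_closed TM.M.a_closed)
    moreover have "g i \<ominus>\<^bsub>tensR M\<^esub> i \<odot>\<^bsub>tensR M\<^esub> g e \<in> ?U"
      using bspec[OF ie i] unfolding mem_Collect_eq hom_diff_I[OF TM g i e] by blast
    moreover have "i \<odot>\<^bsub>tensR M\<^esub> unit M m \<in> ?U"
      by (rule submodule_smult[OF U IR[OF i] imageI[OF m(1)]])
    ultimately show ?thesis by (simp only: submodule_add[OF U])
  qed
  have pt_w: "pt w = \<zero>\<^bsub>tens N\<^esub>"
  proof -
    have "pt w = pt (unit M m) \<ominus>\<^bsub>tensR N\<^esub> pt (g e)"
      unfolding w_def using m e by (intro lmod_hom_diff[OF TM TN ptR]) simp_all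
    also have "\<dots> = \<zero>\<^bsub>tensR N\<^esub>"
      unfolding pt_unit[OF m(1)] m(2) pt_g[OF e] a_minus_def
      by (rule TN.M.r_neg) (simp add: e)
    finally show ?thesis by simp
  qed
  have pt_g': "pt (g' i) = unit N (f i)" if i: "i \<in> I" for i
  proof -
    have "pt (g' i) = pt (g i) \<oplus>\<^bsub>tensR N\<^esub> i \<odot>\<^bsub>tensR N\<^esub> pt w"
      unfolding g'_def using i w TM.smult_closed[of i w]
      by (subst lmod_hom_add[OF ptR]) (simp_all only: g_closed lmod_hom_smult[OF ptR] IR restrict_scalars_simps(1))
    also have "i \<odot>\<^bsub>tensR N\<^esub> pt w = \<zero>\<^bsub>tensR N\<^esub>"
      using TN.smult_r_null[of i] i pt_w by simp
    finally show ?thesis using TN.M.r_zero[of "unit N (f i)"] i by (simp add: pt_g)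
  qed

  \<comment> \<open>The kernel of the unit is injective, so the image of \<open>M\<close> in \<open>Q \<otimes> M\<close> can be mapped back to \<open>M\<close>.\<close>
  let ?Z = "{x \<in> carrier M. unit M x \<in> {\<zero>\<^bsub>tens M\<^esub>}}"
  obtain \<rho> where \<rho>: "\<rho> \<in> lmod_hom R M M" and \<rho>Z: "\<And>x. x \<in> carrier M \<Longrightarrow> \<rho> x \<in> ?Z"
    and \<rho>_id: "\<And>x. x \<in> ?Z \<Longrightarrow> \<rho> x = x"
    by (rule QI_semisimple_retract[OF QI M semisimple_unit_kernel[OF M]]) blast
  \<comment> \<open>The projection along the kernel of the unit: it leaves the unit of
    \<open>x\<close> unchanged, and it depends on \<open>x\<close> only through that unit. It thus
    inverts the unit on its image.\<close>
  define \<sigma> where "\<sigma> x = x \<ominus>\<^bsub>M\<^esub> \<rho> x" for x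
  have "(\<lambda>x. x) \<in> lmod_hom R M M" by (rule lmod_homI) auto
  then have \<sigma>: "\<sigma> \<in> lmod_hom R M M"
    unfolding \<sigma>_def by (rule lmod_hom_difference[OF M _ \<rho>])
  have \<sigma>_closed [simp]: "\<sigma> x \<in> carrier M" if "x \<in> carrier M" for x using lmod_hom_closed[OF \<sigma> that] .
  have unit_\<sigma>: "unit M (\<sigma> x) = unit M x" if x: "x \<in> carrier M" for x
  proof -
    have "unit M (\<sigma> x) = unit M x \<ominus>\<^bsub>tensR M\<^esub> unit M (\<rho> x)"
      unfolding \<sigma>_def using x \<rho>Z[OF x] by (intro lmod_hom_diff[OF M TM uM]) auto
    also have "unit M (\<rho> x) = \<zero>\<^bsub>tensR M\<^esub>" using \<rho>Z[OF x] by simp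
    finally show ?thesis using TM.M.diff_zero[of "unit M x"] x by simp
  qed
  have \<sigma>_eq: "\<sigma> x = \<sigma> y" if xy: "x \<in> carrier M" "y \<in> carrier M" "unit M x = unit M y" for x y
  proof -
    have "unit M (x \<ominus>\<^bsub>M\<^esub> y) = unit M x \<ominus>\<^bsub>tensR M\<^esub> unit M y"
      by (rule lmod_hom_diff[OF M TM uM xy(1,2)])
    also have "\<dots> = \<zero>\<^bsub>tensR M\<^esub>"
      unfolding xy(3) a_minus_def by (rule TM.M.r_neg) (simp add: xy)
    finally have "\<rho> (x \<ominus>\<^bsub>M\<^esub> y) = x \<ominus>\<^bsub>M\<^esub> y" using xy by (intro \<rho>_id) simp
    then have "\<sigma> (x \<ominus>\<^bsub>M\<^esub> y) = \<zero>\<^bsub>M\<^esub>" using xy by (simp add: \<sigma>_def) (simp add: a_minus_def M.M.r_neg)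
    then have "\<sigma> x \<ominus>\<^bsub>M\<^esub> \<sigma> y = \<zero>\<^bsub>M\<^esub>" using lmod_hom_diff[OF M M \<sigma> xy(1,2)] by simp
    then show ?thesis using M.M.add_diff_cancel[of "\<sigma> x" "\<sigma> y"] xy by simp
  qed
  \<comment> \<open>Any preimage of \<open>g' i\<close> under the unit gives the same value, which
    makes \<open>h\<close> linear although the chosen preimages need not be.\<close>
  define h where "h i = \<sigma> (inv_into (carrier M) (unit M) (g' i))" for i
  have h_eq: "h i = \<sigma> x" if "i \<in> I" "x \<in> carrier M" "unit M x = g' i" for i x
    unfolding h_def
    using that g'_U[OF that(1)] by (intro \<sigma>_eq) (simp_all add: inv_into_into f_inv_into_f)
  have h_witness: "\<exists>x\<in>carrier M. unit M x = g' i \<and> h i = \<sigma> x" if i: "i \<in> I" for i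
  proof -
    obtain x where x: "x \<in> carrier M" "g' i = unit M x" using g'_U[OF i] by blast
    then show ?thesis using h_eq[OF i x(1) x(2)[symmetric]] by metis
  qed
  have h: "h \<in> lmod_hom R ?I M"
  proof (rule lmod_homI)
    fix i assume "i \<in> carrier ?I"
    then have i: "i \<in> I" by simp
    then obtain x where x: "x \<in> carrier M" "unit M x = g' i" "h i = \<sigma> x" using h_witness by blast
    then show "h i \<in> carrier M" by simp
    show "h (r \<odot>\<^bsub>?I\<^esub> i) = r \<odot>\<^bsub>M\<^esub> h i" if r: "r \<in> carrier R" for r
    proof -
      have "unit M (r \<odot>\<^bsub>M\<^esub> x) = g' (r \<odot>\<^bsub>?I\<^esub> i)"
        using lmod_hom_smult[OF uM r x(1)] lmod_hom_smult[OF g' r, of i] i x by simp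
      then have "h (r \<odot>\<^bsub>?I\<^esub> i) = \<sigma> (r \<odot>\<^bsub>M\<^esub> x)" using i r x by (intro h_eq) simp_all
      then show ?thesis using lmod_hom_smult[OF \<sigma> r x(1)] x by simp
    qed
    fix k assume "k \<in> carrier ?I"
    then have k: "k \<in> I" by simp
    then obtain y where y: "y \<in> carrier M" "unit M y = g' k" "h k = \<sigma> y" using h_witness by blast
    have "unit M (x \<oplus>\<^bsub>M\<^esub> y) = g' (i \<oplus>\<^bsub>?I\<^esub> k)"
      using lmod_hom_add[OF uM x(1) y(1)] lmod_hom_add[OF g', of i k] i k x y by simp
    then have "h (i \<oplus>\<^bsub>?I\<^esub> k) = \<sigma> (x \<oplus>\<^bsub>M\<^esub> y)"
      using i k x y I_closed(1)[OF i k R.one_closed] by (intro h_eq) simp_all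
    then show "h (i \<oplus>\<^bsub>?I\<^esub> k) = h i \<oplus>\<^bsub>M\<^esub> h k" using lmod_hom_add[OF \<sigma> x(1) y(1)] x y by simp
  qed
  have h_closed [simp]: "h i \<in> carrier M" if "i \<in> I" for i using lmod_hom_closed[OF h] that by simp
  have unit_h: "unit N (p (h i)) = unit N (f i)" if i: "i \<in> I" for i
  proof -
    obtain x where x: "x \<in> carrier M" "unit M x = g' i" "h i = \<sigma> x" using h_witness[OF i] by blast
    have "unit N (p (h i)) = pt (unit M (h i))" using pt_unit i by simp
    also have "\<dots> = pt (g' i)" using x by (simp add: unit_\<sigma>)
    finally show ?thesis using pt_g'[OF i] by simp
  qed

  \<comment> \<open>The remaining error \<open>f - p h\<close> takes values in the semisimple kernel of the unit of \<open>N\<close>.\<close>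
  define d where "d i = f i \<ominus>\<^bsub>N\<^esub> p (h i)" for i
  have d: "d \<in> lmod_hom R ?I N"
    unfolding d_def by (rule lmod_hom_difference[OF N f lmod_hom_comp[OF h p]])
  have d_closed [simp]: "d i \<in> carrier N" if "i \<in> I" for i using lmod_hom_closed[OF d] that by simp
  let ?ZN = "{x \<in> carrier N. unit N x \<in> {\<zero>\<^bsub>tens N\<^esub>}}"
  have dZ: "d i \<in> ?ZN" if i: "i \<in> I" for i
  proof -
    have "unit N (d i) = unit N (f i) \<ominus>\<^bsub>tensR N\<^esub> unit N (p (h i))"
      unfolding d_def using i by (intro lmod_hom_diff[OF N TN uN]) simp_all
    also have "\<dots> = \<zero>\<^bsub>tensR N\<^esub>"
      unfolding unit_h[OF i] a_minus_def by (rule TN.M.r_neg) (simp add: i)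
    finally show ?thesis using i by simp
  qed
  let ?D' = "{i \<in> carrier ?I. d i \<in> {\<zero>\<^bsub>N\<^esub>}}"
  have "semisimple_interval R ?I ?D' {i \<in> carrier ?I. d i \<in> ?ZN}"
    by (rule semisimple_interval_preimage[OF Im N d semisimple_unit_kernel[OF N]])
  moreover have "{i \<in> carrier ?I. d i \<in> ?ZN} = I" using dZ by auto
  ultimately have "semisimple_interval R ?I ?D' I" by simp
  then obtain e' where e': "e' \<in> I" and ie': "\<forall>i\<in>I. i \<ominus>\<^bsub>R\<^esub> i \<otimes>\<^bsub>R\<^esub> e' \<in> ?D'"
    using QI_left_ideal_projection[OF QI small I] by blast
  \<comment> \<open>The error is right multiplication by \<open>d e'\<close>, since \<open>d\<close>
    vanishes on \<open>?D'\<close>; a preimage \<open>n\<close> of that one element removes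
    it.\<close>
  obtain n where n: "n \<in> carrier M" "p n = d e'" using onto d_closed[OF e'] by (metis imageE)
  have d_e': "d i = i \<odot>\<^bsub>N\<^esub> d e'" if i: "i \<in> I" for i
  proof -
    have "d i \<ominus>\<^bsub>N\<^esub> i \<odot>\<^bsub>N\<^esub> d e' = \<zero>\<^bsub>N\<^esub>"
      using bspec[OF ie' i] unfolding mem_Collect_eq hom_diff_I[OF N d i e'] by blast
    then show ?thesis
      using N.M.add_diff_cancel[of "d i" "i \<odot>\<^bsub>N\<^esub> d e'"] i e' by simp
  qed
  show "\<exists>g\<in>lmod_hom R ?I M. \<forall>x\<in>carrier ?I. p (g x) = f x"
  proof (intro bexI ballI)
    show "(\<lambda>i. h i \<oplus>\<^bsub>M\<^esub> i \<odot>\<^bsub>M\<^esub> n) \<in> lmod_hom R ?I M"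
      by (rule lmod_hom_sum[OF M h smult_hom[OF M n(1)]])
    fix i assume "i \<in> carrier ?I"
    then have i: "i \<in> I" by simp
    have "p (h i \<oplus>\<^bsub>M\<^esub> i \<odot>\<^bsub>M\<^esub> n) = p (h i) \<oplus>\<^bsub>N\<^esub> i \<odot>\<^bsub>N\<^esub> d e'"
      using i n lmod_hom_add[OF p, of "h i" "i \<odot>\<^bsub>M\<^esub> n"] lmod_hom_smult[OF p, of i n] by simp
    also have "\<dots> = p (h i) \<oplus>\<^bsub>N\<^esub> (f i \<ominus>\<^bsub>N\<^esub> p (h i))"
      using d_e'[OF i] by (simp add: d_def)
    also have "\<dots> = f i" using i by (simp add: N.M.add_diff_cancel)
    finally show "p (h i \<oplus>\<^bsub>M\<^esub> i \<odot>\<^bsub>M\<^esub> n) = f i" .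
  qed
qed

end

theorem theorem3p12:
  fixes R :: "('r, 'x) ring_scheme" and Q :: "('q, 'y) ring_scheme"
    and \<psi> :: "'r \<Rightarrow> 'q" and n :: nat
    and \<tau> :: "nat \<Rightarrow> ('r, 'u) torsion_pair"
  assumes universe: "Pow (carrier R \<times> (UNIV :: nat set)) \<lesssim> (UNIV :: 'u set)"
    and QI: "left_QI_ring TYPE('u) R"
    and Gdim: "has_gabriel_dimension TYPE('u) R n"
    and filtration: "\<tau> = gabriel_filtration R"
    and quotients: "ring_of_quotients R (\<tau> 1) Q \<psi>"
    and perfect: "perfect_torsion_theory R (\<tau> 1) Q \<psi>"
    and hereditary: "left_hereditary TYPE('u) Q"
  shows "left_hereditary TYPE('u) R"
proof -
  have R: "ring R" using QI by (simp add: left_QI_ring_def)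
  interpret R: ring R by fact
  have Q: "ring Q" and \<psi>: "\<psi> \<in> ring_hom R Q"
    and closed: "torsion_closed R (\<tau> 1) (pullback_left_module Q \<psi>)"
    and coker: "torsion R (\<tau> 1) (quotient_module (pullback_left_module Q \<psi>) (\<psi> ` carrier R))"
    using quotients unfolding ring_of_quotients_def by blast+
  have flat: "flat_right_module TYPE('u) R (pullback_right_module Q \<psi>)"
    and topology: "gabriel_topology R (\<tau> 1) = {I. left_ideal I R \<and> genlideal Q (\<psi> ` I) = carrier Q}"
    using perfect unfolding perfect_torsion_theory_def by blast+
  have tt: "torsion_theory R (\<tau> 1)" and ss: "\<And>T. T \<in> fst (\<tau> 1) \<Longrightarrow> semisimple_module R T"
    using gabriel_filtration_one_le[OF QI] by (simp_all add: filtration hereditary_torsion_theory_def)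
  have PQ: "left_module R (pullback_left_module Q \<psi>)"
    using closed by (simp add: torsion_closed_def topology_injective_def)
  \<comment> \<open>Torsion-free modules on other types are by definition isomorphic to one on
    \<open>'u\<close>; that isomorphism embeds Q.\<close>
  obtain emb :: "'q \<Rightarrow> 'u" where emb: "inj_on emb (carrier Q)"
    using closed unfolding torsion_closed_def torsion_free_def lmod_isomorphic_def bij_betw_def
    by (auto simp: pullback_left_module_def)
  \<comment> \<open>The size condition is used twice: the slice at 0 leaves room for codes of
    subsets of R, and singletons indexed by \<open>nat\<close> make \<open>'u\<close>
    infinite.\<close>
  have "inj_on (\<lambda>A. A \<times> {0 :: nat}) (Pow (carrier R))" by (auto simp: inj_on_def)
  then have "Pow (carrier R) \<lesssim> Pow (carrier R \<times> (UNIV :: nat set))" unfolding lepoll_def by blast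
  then have small: "Pow (carrier R) \<lesssim> (UNIV :: 'u set)" using universe lepoll_trans by blast
  have "inj (\<lambda>n :: nat. {(\<zero>\<^bsub>R\<^esub>, n)})" by (auto simp: inj_on_def)
  then have "(UNIV :: nat set) \<lesssim> Pow (carrier R \<times> (UNIV :: nat set))" unfolding lepoll_def by blast
  then have inf: "infinite (UNIV :: 'u set)" using universe lepoll_trans infinite_le_lepoll by blast
  have reg: "left_module R (regular_module R)" by (rule regular_left_module[OF R])
  have "\<psi> \<in> lmod_hom R (regular_module R) (pullback_left_module Q \<psi>)"
    using \<psi> by (intro lmod_homI)
      (auto simp: pullback_left_module_def ring_hom_closed ring_hom_add ring_hom_mult)
  then have "submodule (\<psi> ` carrier R) R (pullback_left_module Q \<psi>)"
    using submodule_image[OF reg PQ] left_module.carrier_submodule[OF reg] by simp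
  then have coker_ss: "semisimple_interval R (pullback_left_module Q \<psi>) (\<psi> ` carrier R) (carrier Q)"
    using torsion_quotient_semisimple[OF PQ _ tt ss coker] by (simp add: pullback_left_module_def)
  interpret Q: ring Q by fact
  interpret semisimple_base_change R Q \<psi> emb
  proof unfold_locales
    show "semisimple_interval R (regular_module R) J (carrier R)"
      if "left_ideal J R" "genlideal Q (\<psi> ` J) = carrier Q" for J
    proof -
      have "J \<in> gabriel_topology R (\<tau> 1)" using topology that by blast
      then have "torsion R (\<tau> 1) (quotient_module (regular_module R) J)"
        by (simp add: gabriel_topology_def)
      then show ?thesis
        using torsion_quotient_semisimple[OF reg _ tt ss] that(1) by (simp add: left_ideal_def)
    qed
  qed (fact \<psi> inf emb QI small flat hereditary coker_ss)+
  show ?thesis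
    unfolding left_hereditary_def using R left_ideal_projective by blast
qed

end
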